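(* Let $M$ be a three-dimensional contact sub-Riemannian manifold equipped with a smooth measure $\mu$. Let $\Sigma\subset M$ be a $C^2$ embedded surface, let $p$ be an isolated non-degenerate characteristic point of $\Sigma$, and let $u$ be a local defining function of class $C^2$ for $\Sigma$ in a neighborhood of $p$. Denote by $W=\|\nabla u\|$ the norm of the horizontal gradient of $u$. Then $\frac1W$ is locally integrable on $\Sigma$ around $p$ with respect to the Riemannian induced measure $\sigma_{\mathrm{R}}$, i.e. there is a neighborhood $U$ of $p$ in $M$ such that $$\int_{\Sigma\cap U}\frac1W\,d\sigma_{\mathrm{R}}<+\infty.$$ In particular, the horizontal mean curvature $\mathcal{H}$ of $\Sigma$ is locally integrable around $p$: there is a neighborhood $U$ of $p$ in $M$ such that $\int_{\Sigma\cap U}|\mathcal{H}|\,d\sigma_{\mathrm{R}}<+\infty$.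
   Context: A three-dimensional contact sub-Riemannian manifold is a smooth connected 3-manifold $M$ with a contact one-form $\omega$ (i.e. $\omega\wedge d\omega\neq 0$ everywhere), the rank-2 distribution $\mathcal{D}=\ker\omega\subset TM$, and a smooth metric $g$ on $\mathcal{D}$. A smooth measure $\mu$ is one given by a smooth positive density. Horizontal gradient and divergence: for a $C^1$ function $f$, $\nabla f$ is the section of $\mathcal{D}$ with $g(\nabla f,V)=Vf$ for all sections $V$ of $\mathcal{D}$; if $X_1,X_2$ is a local orthonormal frame of $\mathcal{D}$ then $\nabla f=\sum_i (X_if)X_i$. The norm is $\|\nabla f\|=g(\nabla f,\nabla f)^{1/2}$. The divergence $\mathrm{div}_\mu(X)$ is defined by $\mathcal{L}_X\mu=\mathrm{div}_\mu(X)\mu$. A local defining function for $\Sigma$ near $p\in\Sigma$ is a $C^2$ function $u$ on a neighborhood $U\subset M$ of $p$ with $\Sigma\cap U=\{u=0\}$ and $du\neq0$ on $\Sigma\cap U$. Characteristic points: $p\in\Sigma$ is characteristic if $\mathcal{D}_p\subseteq T_p\Sigma$, equivalently $X_1u(p)=X_2u(p)=0$. The set of characteristic points is $C(\Sigma)$; it is closed and has zero measure in $\Sigma$. A characteristic point is isolated if it is an isolated point of $C(\Sigma)$. Horizontal Hessian: given an affine connection $\tilde\nabla$ on $\mathcal{D}$, $\mathrm{Hess}_{\mathrm{H}}(u)(V,W)=g(\tilde\nabla_V\nabla u,W)$ for sections $V,W$ of $\mathcal{D}$. At a characteristic point $p$ it is independent of $\tilde\nabla$ and, in the frame $X_1,X_2$,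 is given by the matrix $(X_iX_ju(p))_{i,j}$. The characteristic point $p$ is non-degenerate if $\det(\mathrm{Hess}_{\mathrm{H}}(u)|_p)\neq0$; this is independent of the choice of $u$. Horizontal mean curvature: for $q\in\Sigma\setminus C(\Sigma)$, $\mathcal{H}(q)=-\mathrm{div}_\mu\left(\frac{\nabla u}{\|\nabla u\|}\right)\big|_q$ with $u$ a local defining function for $\Sigma$ near $q$; up to sign it does not depend on $u$. Riemannian induced measure: choose any Riemannian metric on $M$ extending $g$, and let $n$ be the corresponding unit normal to $\Sigma$; $\sigma_{\mathrm{R}}$ is the measure on $\Sigma$ with density $|i_n\mu|$. The choice of extension plays no role in the integrability statement. *)

theory Defs
  imports "HOL-Analysis.Analysis"
begin

text \<open>
  Differential geometry on a 3-manifold \<open>M\<close>, which is the whole of a Hausdorff, second countable type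
  \<open>'m\<close> and carries a smooth atlas \<open>A\<close>.  A chart is a pair of its domain and its coordinate map.
  Functions, sections and charts are total HOL functions; their values outside the relevant open
  set are irrelevant.
\<close>

subsection \<open>Functions of class \<open>C\<^sup>k\<close> on open subsets of normed spaces\<close>

primrec Ck_on :: "nat \<Rightarrow> 'a::real_normed_vector set \<Rightarrow> ('a \<Rightarrow> 'b::real_normed_vector) \<Rightarrow> bool" where
  "Ck_on 0 S f \<longleftrightarrow> continuous_on S f"
| "Ck_on (Suc k) S f \<longleftrightarrow>
     (\<forall>x\<in>S. f differentiable at x) \<and> (\<forall>v. Ck_on k S (\<lambda>x. frechet_derivative f (at x) v))"

subsection \<open>Smooth 3-manifolds\<close>

type_synonym 'm chart = "'m set \<times> ('m \<Rightarrow> real^3)"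

abbreviation chart_dom :: "'m chart \<Rightarrow> 'm set" where "chart_dom c \<equiv> fst c"
abbreviation chart_map :: "'m chart \<Rightarrow> 'm \<Rightarrow> real^3" where "chart_map c \<equiv> snd c"

definition chart_inv :: "'m chart \<Rightarrow> real^3 \<Rightarrow> 'm" where
  "chart_inv c = inv_into (chart_dom c) (chart_map c)"

definition is_chart :: "'m::topological_space chart \<Rightarrow> bool" where
  "is_chart c \<longleftrightarrow> open (chart_dom c) \<and> open (chart_map c ` chart_dom c) \<and>
     homeomorphism (chart_dom c) (chart_map c ` chart_dom c) (chart_map c) (chart_inv c)"

definition smooth_atlas :: "'m::topological_space chart set \<Rightarrow> bool" where
  "smooth_atlas A \<longleftrightarrow>
     (\<forall>c\<in>A. is_chart c) \<and> (\<Union>c\<in>A. chart_dom c) = UNIV \<and>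
     (\<forall>c\<in>A. \<forall>c'\<in>A. \<forall>k. Ck_on k (chart_map c ` (chart_dom c \<inter> chart_dom c'))
                            (chart_map c' \<circ> chart_inv c))"

text \<open>An arbitrary chart around a point, for notions that do not depend on the chart.\<close>

definition chart_at :: "'m chart set \<Rightarrow> 'm \<Rightarrow> 'm chart" where
  "chart_at A q = (SOME c. c \<in> A \<and> q \<in> chart_dom c)"

definition Ck_fun :: "'m chart set \<Rightarrow> nat \<Rightarrow> 'm set \<Rightarrow> ('m \<Rightarrow> real) \<Rightarrow> bool" where
  "Ck_fun A k U f \<longleftrightarrow> (\<forall>c\<in>A. Ck_on k (chart_map c ` (U \<inter> chart_dom c)) (f \<circ> chart_inv c))"

subsection \<open>Tangent vectors and vector fields\<close>

text \<open>
  A tangent vector at \<open>q\<close> is the family of its components in all the charts around \<open>q\<close>, related by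
  the differentials of the transition maps (and \<open>0\<close> at the other charts, for uniqueness).
\<close>

type_synonym 'm tvec = "'m chart \<Rightarrow> real^3"

definition tangent :: "'m chart set \<Rightarrow> 'm \<Rightarrow> 'm tvec set" where
  "tangent A q = {v.
     (\<forall>c\<in>A. \<forall>c'\<in>A. q \<in> chart_dom c \<inter> chart_dom c' \<longrightarrow>
        v c' = frechet_derivative (chart_map c' \<circ> chart_inv c) (at (chart_map c q)) (v c)) \<and>
     (\<forall>c. \<not> (c \<in> A \<and> q \<in> chart_dom c) \<longrightarrow> v c = 0)}"

definition tadd :: "'m tvec \<Rightarrow> 'm tvec \<Rightarrow> 'm tvec" where
  "tadd v w = (\<lambda>c. v c + w c)"

definition tscale :: "real \<Rightarrow> 'm tvec \<Rightarrow> 'm tvec" where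
  "tscale a v = (\<lambda>c. a *\<^sub>R v c)"

definition tlinear_on :: "'m tvec set \<Rightarrow> ('m tvec \<Rightarrow> real) \<Rightarrow> bool" where
  "tlinear_on E f \<longleftrightarrow>
     (\<forall>v\<in>E. \<forall>w\<in>E. \<forall>a b. f (tadd (tscale a v) (tscale b w)) = a * f v + b * f w)"

text \<open>
  \<open>push A \<psi> y e\<close> is the image of \<open>e\<close> under the differential at \<open>y\<close> of \<open>\<psi> : \<real>\<^sup>n \<rightarrow> M\<close>.  In particular
  \<open>push A (chart_inv c) x e\<close> is the tangent vector with component \<open>e\<close> in the chart \<open>c\<close>.
\<close>

definition push :: "'m chart set \<Rightarrow> ('v::real_normed_vector \<Rightarrow> 'm) \<Rightarrow> 'v \<Rightarrow> 'v \<Rightarrow> 'm tvec" where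
  "push A \<psi> y e = (\<lambda>c. if c \<in> A \<and> \<psi> y \<in> chart_dom c
                          then frechet_derivative (chart_map c \<circ> \<psi>) (at y) e else 0)"

definition differential :: "'m chart set \<Rightarrow> ('m \<Rightarrow> real) \<Rightarrow> 'm \<Rightarrow> 'm tvec \<Rightarrow> real" where
  "differential A f q v =
     (let c = chart_at A q in frechet_derivative (f \<circ> chart_inv c) (at (chart_map c q)) (v c))"

text \<open>Sections of class \<open>C\<^sup>k\<close> over \<open>U\<close> of a family \<open>E\<close> of subspaces of the tangent spaces.\<close>

definition Ck_section ::
    "'m chart set \<Rightarrow> ('m \<Rightarrow> 'm tvec set) \<Rightarrow> nat \<Rightarrow> 'm set \<Rightarrow> ('m \<Rightarrow> 'm tvec) \<Rightarrow> bool" where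
  "Ck_section A E k U X \<longleftrightarrow>
     (\<forall>q\<in>U. X q \<in> E q) \<and>
     (\<forall>c\<in>A. Ck_on k (chart_map c ` (U \<inter> chart_dom c)) (\<lambda>x. X (chart_inv c x) c))"

definition smooth_section ::
    "'m chart set \<Rightarrow> ('m \<Rightarrow> 'm tvec set) \<Rightarrow> 'm set \<Rightarrow> ('m \<Rightarrow> 'm tvec) \<Rightarrow> bool" where
  "smooth_section A E U X \<longleftrightarrow> (\<forall>k. Ck_section A E k U X)"

subsection \<open>Contact sub-Riemannian structures\<close>

definition smooth_one_form ::
    "'m::topological_space chart set \<Rightarrow> ('m \<Rightarrow> 'm tvec \<Rightarrow> real) \<Rightarrow> bool" where
  "smooth_one_form A \<omega> \<longleftrightarrow>
     (\<forall>q. tlinear_on (tangent A q) (\<omega> q)) \<and>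
     (\<forall>U X. open U \<and> smooth_section A (tangent A) U X \<longrightarrow> (\<forall>k. Ck_fun A k U (\<lambda>q. \<omega> q (X q))))"

text \<open>
  \<open>d\<omega>(V,W) = V(\<omega>(W)) - W(\<omega>(V)) - \<omega>([V,W])\<close>, evaluated on the extensions \<open>V, W\<close> of \<open>v, w\<close> with
  constant components in the chart \<open>c\<close>, whose bracket vanishes.
\<close>

definition ext_deriv ::
    "'m chart set \<Rightarrow> ('m \<Rightarrow> 'm tvec \<Rightarrow> real) \<Rightarrow> 'm \<Rightarrow> 'm tvec \<Rightarrow> 'm tvec \<Rightarrow> real" where
  "ext_deriv A \<omega> q v w =
     (let c = chart_at A q;
          x = chart_map c q;
          a = (\<lambda>e y. \<omega> (chart_inv c y) (push A (chart_inv c) y e))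
      in frechet_derivative (a (w c)) (at x) (v c) - frechet_derivative (a (v c)) (at x) (w c))"

definition contact_form ::
    "'m::topological_space chart set \<Rightarrow> ('m \<Rightarrow> 'm tvec \<Rightarrow> real) \<Rightarrow> bool" where
  "contact_form A \<omega> \<longleftrightarrow> smooth_one_form A \<omega> \<and>
     (\<forall>q. \<exists>v1\<in>tangent A q. \<exists>v2\<in>tangent A q. \<exists>v3\<in>tangent A q.
        \<omega> q v1 * ext_deriv A \<omega> q v2 v3 + \<omega> q v2 * ext_deriv A \<omega> q v3 v1
          + \<omega> q v3 * ext_deriv A \<omega> q v1 v2 \<noteq> 0)"

definition distribution ::
    "'m chart set \<Rightarrow> ('m \<Rightarrow> 'm tvec \<Rightarrow> real) \<Rightarrow> 'm \<Rightarrow> 'm tvec set" where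
  "distribution A \<omega> q = {v \<in> tangent A q. \<omega> q v = 0}"

text \<open>Smooth metrics on \<open>E\<close>; with \<open>E = tangent A\<close> these are the Riemannian metrics.\<close>

definition smooth_metric_on ::
    "'m::topological_space chart set \<Rightarrow> ('m \<Rightarrow> 'm tvec set) \<Rightarrow>
     ('m \<Rightarrow> 'm tvec \<Rightarrow> 'm tvec \<Rightarrow> real) \<Rightarrow> bool" where
  "smooth_metric_on A E g \<longleftrightarrow>
     (\<forall>q. \<forall>v\<in>E q. tlinear_on (E q) (g q v)) \<and>
     (\<forall>q. \<forall>v\<in>E q. \<forall>w\<in>E q. g q v w = g q w v) \<and>
     (\<forall>q. \<forall>v\<in>E q. v \<noteq> (\<lambda>c. 0) \<longrightarrow> g q v v > 0) \<and>
     (\<forall>U X Y. open U \<and> smooth_section A E U X \<and> smooth_section A E U Y \<longrightarrow>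
        (\<forall>k. Ck_fun A k U (\<lambda>q. g q (X q) (Y q))))"

definition contact_sub_riemannian ::
    "'m::{second_countable_topology,t2_space} chart set \<Rightarrow> ('m \<Rightarrow> 'm tvec \<Rightarrow> real) \<Rightarrow>
     ('m \<Rightarrow> 'm tvec \<Rightarrow> 'm tvec \<Rightarrow> real) \<Rightarrow> bool" where
  "contact_sub_riemannian A \<omega> g \<longleftrightarrow>
     smooth_atlas A \<and> connected (UNIV :: 'm set) \<and> contact_form A \<omega> \<and>
     smooth_metric_on A (distribution A \<omega>) g"

definition riemannian_extension ::
    "'m::topological_space chart set \<Rightarrow> ('m \<Rightarrow> 'm tvec \<Rightarrow> real) \<Rightarrow>
     ('m \<Rightarrow> 'm tvec \<Rightarrow> 'm tvec \<Rightarrow> real) \<Rightarrow> ('m \<Rightarrow> 'm tvec \<Rightarrow> 'm tvec \<Rightarrow> real) \<Rightarrow> bool" where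
  "riemannian_extension A \<omega> g G \<longleftrightarrow>
     smooth_metric_on A (tangent A) G \<and>
     (\<forall>q. \<forall>v\<in>distribution A \<omega> q. \<forall>w\<in>distribution A \<omega> q. G q v w = g q v w)"

subsection \<open>Smooth measures and the divergence\<close>

text \<open>
  A density is the family \<open>\<rho>\<close> of its coefficients with respect to Lebesgue measure in the charts.
\<close>

definition smooth_positive_density :: "'m chart set \<Rightarrow> ('m chart \<Rightarrow> real^3 \<Rightarrow> real) \<Rightarrow> bool" where
  "smooth_positive_density A \<rho> \<longleftrightarrow>
     (\<forall>c\<in>A. (\<forall>k. Ck_on k (chart_map c ` chart_dom c) (\<rho> c)) \<and>
              (\<forall>x\<in>chart_map c ` chart_dom c. \<rho> c x > 0)) \<and>
     (\<forall>c\<in>A. \<forall>c'\<in>A. \<forall>q\<in>chart_dom c \<inter> chart_dom c'.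
        \<rho> c (chart_map c q) = \<rho> c' (chart_map c' q) *
          \<bar>det (matrix (frechet_derivative (chart_map c' \<circ> chart_inv c) (at (chart_map c q))))\<bar>)"

definition smooth_measure ::
    "'m::topological_space chart set \<Rightarrow> ('m chart \<Rightarrow> real^3 \<Rightarrow> real) \<Rightarrow> 'm measure \<Rightarrow> bool" where
  "smooth_measure A \<rho> \<mu> \<longleftrightarrow>
     smooth_positive_density A \<rho> \<and> sets \<mu> = sets borel \<and>
     (\<forall>c\<in>A. \<forall>B\<in>sets borel. B \<subseteq> chart_dom c \<longrightarrow>
        emeasure \<mu> B = (\<integral>\<^sup>+x\<in>chart_map c ` B. ennreal (\<rho> c x) \<partial>lborel))"

text \<open>The value \<open>\<bar>\<mu>(v1,v2,v3)\<bar>\<close> of the density on three tangent vectors at \<open>q\<close>.\<close>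

definition density_eval ::
    "'m chart set \<Rightarrow> ('m chart \<Rightarrow> real^3 \<Rightarrow> real) \<Rightarrow> 'm \<Rightarrow> 'm tvec \<Rightarrow> 'm tvec \<Rightarrow> 'm tvec \<Rightarrow> real" where
  "density_eval A \<rho> q v1 v2 v3 =
     (let c = chart_at A q
      in \<rho> c (chart_map c q) * \<bar>det (vector [v1 c, v2 c, v3 c] :: real^3^3)\<bar>)"

text \<open>
  The coefficient in the chart \<open>c\<close> of the Lie derivative of the density along \<open>X\<close>, that is
  \<open>X(\<mu>(\<partial>\<^sub>1,\<partial>\<^sub>2,\<partial>\<^sub>3)) - \<Sum>\<^sub>i \<mu>(\<dots>,[X,\<partial>\<^sub>i],\<dots>) = X(\<rho>) + \<rho> \<Sum>\<^sub>i \<partial>\<^sub>i X\<^sup>i\<close>.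
\<close>

definition lie_derivative_density ::
    "('m chart \<Rightarrow> real^3 \<Rightarrow> real) \<Rightarrow> ('m \<Rightarrow> 'm tvec) \<Rightarrow> 'm chart \<Rightarrow> real^3 \<Rightarrow> real" where
  "lie_derivative_density \<rho> X c x =
     frechet_derivative (\<rho> c) (at x) (X (chart_inv c x) c) +
     \<rho> c x * (\<Sum>i\<in>UNIV. frechet_derivative (\<lambda>y. X (chart_inv c y) c) (at x) (axis i 1) $ i)"

definition divergence ::
    "'m chart set \<Rightarrow> ('m chart \<Rightarrow> real^3 \<Rightarrow> real) \<Rightarrow> ('m \<Rightarrow> 'm tvec) \<Rightarrow> 'm \<Rightarrow> real" where
  "divergence A \<rho> X q =
     (let c = chart_at A q; x = chart_map c q in lie_derivative_density \<rho> X c x / \<rho> c x)"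

subsection \<open>Horizontal gradient and horizontal Hessian\<close>

definition hgrad ::
    "'m chart set \<Rightarrow> ('m \<Rightarrow> 'm tvec \<Rightarrow> real) \<Rightarrow> ('m \<Rightarrow> 'm tvec \<Rightarrow> 'm tvec \<Rightarrow> real) \<Rightarrow>
     ('m \<Rightarrow> real) \<Rightarrow> 'm \<Rightarrow> 'm tvec" where
  "hgrad A \<omega> g u q =
     (THE v. v \<in> distribution A \<omega> q \<and> (\<forall>w\<in>distribution A \<omega> q. g q v w = differential A u q w))"

definition hgrad_norm ::
    "'m chart set \<Rightarrow> ('m \<Rightarrow> 'm tvec \<Rightarrow> real) \<Rightarrow> ('m \<Rightarrow> 'm tvec \<Rightarrow> 'm tvec \<Rightarrow> real) \<Rightarrow>
     ('m \<Rightarrow> real) \<Rightarrow> 'm \<Rightarrow> real" where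
  "hgrad_norm A \<omega> g u q = sqrt (g q (hgrad A \<omega> g u q) (hgrad A \<omega> g u q))"

text \<open>
  An affine connection on \<open>\<D>\<close>: \<open>nab q v Y\<close> is the covariant derivative at \<open>q\<close> in the direction
  \<open>v \<in> T\<^sub>qM\<close> of a local section \<open>Y\<close> of \<open>\<D>\<close>.  It acts on \<open>C\<^sup>1\<close> sections, because the horizontal
  gradient of a \<open>C\<^sup>2\<close> function is only \<open>C\<^sup>1\<close>.  Sections are total functions, so locality is explicit.
\<close>

definition affine_connection ::
    "'m::topological_space chart set \<Rightarrow> ('m \<Rightarrow> 'm tvec \<Rightarrow> real) \<Rightarrow>
     ('m \<Rightarrow> 'm tvec \<Rightarrow> ('m \<Rightarrow> 'm tvec) \<Rightarrow> 'm tvec) \<Rightarrow> bool" where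
  "affine_connection A \<omega> nab \<longleftrightarrow>
     (\<forall>U q Y. open U \<and> q \<in> U \<and> Ck_section A (distribution A \<omega>) 1 U Y \<longrightarrow>
        (\<forall>v\<in>tangent A q. nab q v Y \<in> distribution A \<omega> q) \<and>
        (\<forall>v\<in>tangent A q. \<forall>w\<in>tangent A q. \<forall>a b.
           nab q (tadd (tscale a v) (tscale b w)) Y
             = tadd (tscale a (nab q v Y)) (tscale b (nab q w Y))) \<and>
        (\<forall>v\<in>tangent A q. \<forall>Z. Ck_section A (distribution A \<omega>) 1 U Z \<longrightarrow>
           nab q v (\<lambda>x. tadd (Y x) (Z x)) = tadd (nab q v Y) (nab q v Z)) \<and>
        (\<forall>v\<in>tangent A q. \<forall>f. Ck_fun A 1 U f \<longrightarrow>
           nab q v (\<lambda>x. tscale (f x) (Y x))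
             = tadd (tscale (differential A f q v) (Y q)) (tscale (f q) (nab q v Y))) \<and>
        (\<forall>v\<in>tangent A q. \<forall>Z. (\<forall>x\<in>U. Z x = Y x) \<longrightarrow> nab q v Z = nab q v Y)) \<and>
     (\<forall>U V Y. open U \<and> smooth_section A (tangent A) U V \<and>
        smooth_section A (distribution A \<omega>) U Y \<longrightarrow>
        smooth_section A (distribution A \<omega>) U (\<lambda>q. nab q (V q) Y))"

definition hess_H ::
    "'m chart set \<Rightarrow> ('m \<Rightarrow> 'm tvec \<Rightarrow> real) \<Rightarrow> ('m \<Rightarrow> 'm tvec \<Rightarrow> 'm tvec \<Rightarrow> real) \<Rightarrow>
     ('m \<Rightarrow> 'm tvec \<Rightarrow> ('m \<Rightarrow> 'm tvec) \<Rightarrow> 'm tvec) \<Rightarrow> ('m \<Rightarrow> real) \<Rightarrow>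
     'm \<Rightarrow> 'm tvec \<Rightarrow> 'm tvec \<Rightarrow> real" where
  "hess_H A \<omega> g nab u q v w = g q (nab q v (hgrad A \<omega> g u)) w"

subsection \<open>Surfaces\<close>

definition surface_param ::
    "'m::topological_space chart set \<Rightarrow> 'm set \<Rightarrow> (real^2) set \<Rightarrow> (real^2 \<Rightarrow> 'm) \<Rightarrow> bool" where
  "surface_param A \<Sigma> V \<psi> \<longleftrightarrow>
     open V \<and> \<psi> ` V \<subseteq> \<Sigma> \<and> openin (top_of_set \<Sigma>) (\<psi> ` V) \<and>
     (\<exists>\<psi>'. homeomorphism V (\<psi> ` V) \<psi> \<psi>') \<and>
     (\<forall>c\<in>A. Ck_on 2 (V \<inter> \<psi> -` chart_dom c) (chart_map c \<circ> \<psi>)) \<and>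
     (\<forall>y\<in>V. \<forall>c\<in>A. \<psi> y \<in> chart_dom c \<longrightarrow> inj (frechet_derivative (chart_map c \<circ> \<psi>) (at y)))"

definition embedded_C2_surface :: "'m::topological_space chart set \<Rightarrow> 'm set \<Rightarrow> bool" where
  "embedded_C2_surface A \<Sigma> \<longleftrightarrow> (\<forall>q\<in>\<Sigma>. \<exists>V \<psi>. surface_param A \<Sigma> V \<psi> \<and> q \<in> \<psi> ` V)"

definition surface_tangent :: "'m::topological_space chart set \<Rightarrow> 'm set \<Rightarrow> 'm \<Rightarrow> 'm tvec set" where
  "surface_tangent A \<Sigma> q =
     {push A \<psi> y e | V \<psi> y e. surface_param A \<Sigma> V \<psi> \<and> y \<in> V \<and> \<psi> y = q}"

definition local_defining_function ::
    "'m::topological_space chart set \<Rightarrow> 'm set \<Rightarrow> 'm \<Rightarrow> 'm set \<Rightarrow> ('m \<Rightarrow> real) \<Rightarrow> bool" where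
  "local_defining_function A \<Sigma> q U u \<longleftrightarrow>
     open U \<and> q \<in> U \<and> Ck_fun A 2 U u \<and> \<Sigma> \<inter> U = {x \<in> U. u x = 0} \<and>
     (\<forall>x\<in>\<Sigma> \<inter> U. \<exists>v\<in>tangent A x. differential A u x v \<noteq> 0)"

definition characteristic_set ::
    "'m::topological_space chart set \<Rightarrow> ('m \<Rightarrow> 'm tvec \<Rightarrow> real) \<Rightarrow> 'm set \<Rightarrow> 'm set" where
  "characteristic_set A \<omega> \<Sigma> = {q \<in> \<Sigma>. distribution A \<omega> q \<subseteq> surface_tangent A \<Sigma> q}"

text \<open>
  Neither the connection, nor the local defining function, nor the orthonormal basis \<open>e1, e2\<close> of
  \<open>\<D>\<^sub>p\<close> matters at a characteristic point, so it suffices to ask for one choice of them.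
\<close>

definition nondegenerate_characteristic_point ::
    "'m::topological_space chart set \<Rightarrow> ('m \<Rightarrow> 'm tvec \<Rightarrow> real) \<Rightarrow>
     ('m \<Rightarrow> 'm tvec \<Rightarrow> 'm tvec \<Rightarrow> real) \<Rightarrow> 'm set \<Rightarrow> 'm \<Rightarrow> bool" where
  "nondegenerate_characteristic_point A \<omega> g \<Sigma> p \<longleftrightarrow>
     p \<in> characteristic_set A \<omega> \<Sigma> \<and>
     (\<exists>nab U u. \<exists>e1\<in>distribution A \<omega> p. \<exists>e2\<in>distribution A \<omega> p.
        affine_connection A \<omega> nab \<and> local_defining_function A \<Sigma> p U u \<and>
        g p e1 e1 = 1 \<and> g p e2 e2 = 1 \<and> g p e1 e2 = 0 \<and>
        det (vector [vector [hess_H A \<omega> g nab u p e1 e1, hess_H A \<omega> g nab u p e1 e2],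
                     vector [hess_H A \<omega> g nab u p e2 e1, hess_H A \<omega> g nab u p e2 e2]]
               :: real^2^2) \<noteq> 0)"

text \<open>
  The local defining functions determine \<open>\<H> q\<close> only up to sign, hence a predicate on \<open>\<H>\<close>: any
  choice of sign at each non-characteristic point is allowed.
\<close>

definition horizontal_mean_curvature ::
    "'m::topological_space chart set \<Rightarrow> ('m \<Rightarrow> 'm tvec \<Rightarrow> real) \<Rightarrow>
     ('m \<Rightarrow> 'm tvec \<Rightarrow> 'm tvec \<Rightarrow> real) \<Rightarrow> ('m chart \<Rightarrow> real^3 \<Rightarrow> real) \<Rightarrow> 'm set \<Rightarrow>
     ('m \<Rightarrow> real) \<Rightarrow> bool" where
  "horizontal_mean_curvature A \<omega> g \<rho> \<Sigma> H \<longleftrightarrow>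
     (\<forall>q\<in>\<Sigma> - characteristic_set A \<omega> \<Sigma>. \<exists>U u. local_defining_function A \<Sigma> q U u \<and>
        H q = - divergence A \<rho> (\<lambda>x. tscale (1 / hgrad_norm A \<omega> g u x) (hgrad A \<omega> g u x)) q)"

subsection \<open>The Riemannian induced measure\<close>

definition unit_normal ::
    "'m::topological_space chart set \<Rightarrow> ('m \<Rightarrow> 'm tvec \<Rightarrow> 'm tvec \<Rightarrow> real) \<Rightarrow> 'm set \<Rightarrow>
     ('m \<Rightarrow> 'm tvec) \<Rightarrow> bool" where
  "unit_normal A G \<Sigma> n \<longleftrightarrow>
     (\<forall>q\<in>\<Sigma>. n q \<in> tangent A q \<and> G q (n q) (n q) = 1 \<and>
        (\<forall>w\<in>surface_tangent A \<Sigma> q. G q (n q) w = 0))"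

text \<open>
  The measure on \<open>\<Sigma>\<close> with density \<open>\<bar>i\<^sub>n\<mu>\<bar>\<close>: in every local parametrization its density with
  respect to Lebesgue measure is \<open>\<bar>\<mu>(n, \<partial>\<^sub>1\<psi>, \<partial>\<^sub>2\<psi>)\<bar>\<close>.  This determines it uniquely, since countably
  many parametrizations cover \<open>\<Sigma>\<close>.
\<close>

definition riemannian_induced_measure ::
    "'m::topological_space chart set \<Rightarrow> ('m chart \<Rightarrow> real^3 \<Rightarrow> real) \<Rightarrow> 'm set \<Rightarrow>
     ('m \<Rightarrow> 'm tvec) \<Rightarrow> 'm measure \<Rightarrow> bool" where
  "riemannian_induced_measure A \<rho> \<Sigma> n \<sigma> \<longleftrightarrow>
     sets \<sigma> = sets (restrict_space borel \<Sigma>) \<and>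
     (\<forall>V \<psi> B. surface_param A \<Sigma> V \<psi> \<and> B \<in> sets borel \<and> B \<subseteq> V \<longrightarrow>
        emeasure \<sigma> (\<psi> ` B) =
          (\<integral>\<^sup>+y\<in>B. ennreal (density_eval A \<rho> (\<psi> y) (n (\<psi> y))
                      (push A \<psi> y (axis 1 1)) (push A \<psi> y (axis 2 1))) \<partial>lborel))"

definition finite_integral_over :: "'a measure \<Rightarrow> 'a set \<Rightarrow> ('a \<Rightarrow> ennreal) \<Rightarrow> bool" where
  "finite_integral_over \<sigma> S f \<longleftrightarrow>
     S \<in> sets \<sigma> \<and> f \<in> borel_measurable (restrict_space \<sigma> S) \<and> (\<integral>\<^sup>+x\<in>S. f x \<partial>\<sigma>) < \<infinity>"

end

theory Submission
  imports Defs
begin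

text \<open>
  Near \<open>p\<close> choose an orthonormal frame \<open>X\<^sub>1, X\<^sub>2\<close> of the distribution and write \<open>a\<^sub>i = X\<^sub>i u\<close>, so that
  \<open>W\<^sup>2 = a\<^sub>1\<^sup>2 + a\<^sub>2\<^sup>2\<close>.  At the characteristic point \<open>p\<close> the \<open>a\<^sub>i\<close> vanish, the distribution is the tangent
  plane of \<open>\<Sigma>\<close>, and the derivative of \<open>(a\<^sub>1, a\<^sub>2)\<close> along that plane is the horizontal Hessian.
  Nondegeneracy therefore gives \<open>W \<ge> k \<bar>y - y\<^sub>0\<bar>\<close> in a parametrization of \<open>\<Sigma>\<close> in which \<open>y\<^sub>0\<close>
  represents \<open>p\<close>.  The induced measure is at most a multiple of Lebesgue measure there, so a dyadic
  ring of radius \<open>2\<^sup>-\<^sup>j\<close> contributes \<open>O(2\<^sup>-\<^sup>j)\<close> to the integral of \<open>1/W\<close>.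

  On \<open>\<Sigma>\<close> all defining functions have proportional differentials.  The divergence of the horizontal
  normal depends, up to sign, only on the ratio of \<open>a\<^sub>1\<close> and \<open>a\<^sub>2\<close> along \<open>\<Sigma>\<close>, so \<open>\<bar>H\<bar>\<close> may be computed
  from the given \<open>u\<close>, where it is visibly bounded by \<open>C/W\<close>.
\<close>

section \<open>Functions of class \<open>C\<^sup>k\<close>\<close>

text \<open>The estimates live in one fixed chart around \<open>p\<close>, whereas
  \<open>differential\<close>, \<open>divergence\<close> and \<open>density_eval\<close> are defined
  through \<open>chart_at\<close>, an arbitrary chart that may jump from point to point.
  Independence of the chart must therefore precede every coordinate formula; for the divergence it
  rests on the symmetry of second derivatives and on Jacobi's formula. Three kinds of defining
  function meet: the given \<open>u\<close>, the one that witnesses nondegeneracy, and at each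
  noncharacteristic point the one hidden in \<open>horizontal_mean_curvature\<close>. The last may
  vary with the point without any regularity, so even the measurability of \<open>H\<close> has to
  be read off from the formula in \<open>u\<close>. As \<open>u\<close> is only of class C^2, the
  functions a_1, a_2 are only C^1. The lower bound for W therefore uses just the first order
  expansion of (a_1, a_2) at one point, and the divergence is put into a form with first derivatives
  of the a_i only. The decay 2^-j of the rings is the product of their area, of order 4^-j, with the
  size 2^j of 1/W.\<close>

lemma frechet_derivative_eqI: "(f has_derivative f') (at x) \<Longrightarrow> frechet_derivative f (at x) = f'"
  using frechet_derivative_at by metis

text \<open>\<open>frechet_derivative\<close> is a Hilbert choice among the derivatives at
  \<open>x\<close>. Both functions have the same ones, so the choices coincide even where no
  derivative exists.\<close>

lemma frechet_derivative_cong_open: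
  assumes "open S" "x \<in> S" "\<And>y. y \<in> S \<Longrightarrow> f y = g y"
  shows "frechet_derivative f (at x) = frechet_derivative g (at x)"
proof -
  have "(f has_derivative D) (at x) \<longleftrightarrow> (g has_derivative D) (at x)" for D
    using assms has_derivative_transform_within_open[of f D x UNIV S g]
      has_derivative_transform_within_open[of g D x UNIV S f] by auto
  then show ?thesis by (simp add: frechet_derivative_def)
qed

lemma differentiable_cong_open:
  assumes "open S" "x \<in> S" "\<And>y. y \<in> S \<Longrightarrow> f y = g y"
  shows "f differentiable at x \<longleftrightarrow> g differentiable at x"
  using assms has_derivative_transform_within_open[of f _ x UNIV S g]
      has_derivative_transform_within_open[of g _ x UNIV S f] by (auto simp: differentiable_def)

lemma Ck_on_subset: "Ck_on k S f \<Longrightarrow> T \<subseteq> S \<Longrightarrow> Ck_on k T f"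
  by (induction k arbitrary: f) (auto intro: continuous_on_subset)

lemma Ck_on_cong:
  assumes "open S" "\<And>x. x \<in> S \<Longrightarrow> f x = g x"
  shows "Ck_on k S f \<longleftrightarrow> Ck_on k S g"
  using assms(2)
proof (induction k arbitrary: f g)
  case 0
  then show ?case by (auto cong: continuous_on_cong)
next
  case (Suc k)
  have "Ck_on k S (\<lambda>x. frechet_derivative f (at x) v) \<longleftrightarrow> Ck_on k S (\<lambda>x. frechet_derivative g (at x) v)" for v
    by (rule Suc.IH) (use frechet_derivative_cong_open[OF assms(1)] Suc.prems in metis)
  then show ?case
    using differentiable_cong_open[OF assms(1), of _ f g] Suc.prems by simp
qed

lemma Ck_on_Suc_D: "Ck_on (Suc k) S f \<Longrightarrow> Ck_on k S f"
proof (induction k arbitrary: f)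
  case 0
  then show ?case
    by (auto intro!: differentiable_imp_continuous_on
        simp: differentiable_on_def differentiable_at_withinI)
qed auto

lemma Ck_on_mono: "Ck_on k S f \<Longrightarrow> j \<le> k \<Longrightarrow> Ck_on j S f"
  by (induction k) (auto simp: le_Suc_eq dest: Ck_on_Suc_D simp del: Ck_on.simps(2))

lemma Ck_on_continuous: "Ck_on k S f \<Longrightarrow> continuous_on S f"
  using Ck_on_mono[of k S f 0] by simp

lemma Ck_on_differentiable: "Ck_on k S f \<Longrightarrow> k > 0 \<Longrightarrow> x \<in> S \<Longrightarrow> f differentiable at x"
  by (cases k) auto

lemma Ck_on_has_derivative:
  "Ck_on k S f \<Longrightarrow> k > 0 \<Longrightarrow> x \<in> S \<Longrightarrow> (f has_derivative frechet_derivative f (at x)) (at x)"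
  using Ck_on_differentiable frechet_derivative_works by blast

text \<open>Lets an explicit formula \<open>f'\<close> stand in for
  \<open>frechet_derivative\<close> when regularity is proved: derivatives are unique, and on an
  open set \<open>Ck_on\<close> depends only on the values there.\<close>

lemma Ck_on_SucI:
  assumes "open S" "\<And>x. x \<in> S \<Longrightarrow> (f has_derivative f' x) (at x)" "\<And>v. Ck_on k S (\<lambda>x. f' x v)"
  shows "Ck_on (Suc k) S f"
proof -
  have "Ck_on k S (\<lambda>x. frechet_derivative f (at x) v) \<longleftrightarrow> Ck_on k S (\<lambda>x. f' x v)" for v
    by (rule Ck_on_cong[OF assms(1)]) (simp add: frechet_derivative_eqI[OF assms(2)])
  then show ?thesis using assms by (auto simp: differentiable_def)
qed

lemma Ck_on_const [simp]: "Ck_on k S (\<lambda>x. c)"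
  by (induction k arbitrary: c) auto

lemma Ck_on_bounded_linear:
  assumes "bounded_linear L" "open S" "Ck_on k S f"
  shows "Ck_on k S (\<lambda>x. L (f x))"
  using assms(3)
proof (induction k arbitrary: f)
  case 0
  then show ?case using bounded_linear.continuous_on[OF assms(1)] by auto
next
  case (Suc k)
  then show ?case
    by (intro Ck_on_SucI[OF assms(2), where f' = "\<lambda>x v. L (frechet_derivative f (at x) v)"]
        bounded_linear.has_derivative[OF assms(1)] Ck_on_has_derivative[OF Suc.prems]) auto
qed

lemma Ck_on_add:
  assumes "open S" "Ck_on k S f" "Ck_on k S g"
  shows "Ck_on k S (\<lambda>x. f x + g x)"
  using assms(2,3)
proof (induction k arbitrary: f g)
  case 0
  then show ?case by (auto intro: continuous_intros)
next
  case (Suc k)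
  show ?case
  proof (rule Ck_on_SucI[OF assms(1)])
    show "((\<lambda>x. f x + g x) has_derivative
        (\<lambda>v. frechet_derivative f (at x) v + frechet_derivative g (at x) v)) (at x)" if "x \<in> S" for x
      by (intro has_derivative_add Ck_on_has_derivative[OF Suc.prems(1)]
          Ck_on_has_derivative[OF Suc.prems(2)] that) auto
  qed (use Suc in auto)
qed

lemma Ck_on_sum:
  assumes "open S" "\<And>i. i \<in> I \<Longrightarrow> Ck_on k S (f i)"
  shows "Ck_on k S (\<lambda>x. \<Sum>i\<in>I. f i x)"
  using assms(2) by (induction I rule: infinite_finite_induct) (auto intro: Ck_on_add[OF assms(1)])

lemma Ck_on_bilinear:
  assumes "bounded_bilinear b" "open S" "Ck_on k S f" "Ck_on k S g"
  shows "Ck_on k S (\<lambda>x. b (f x) (g x))"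
  using assms(3,4)
proof (induction k arbitrary: f g)
  case 0
  then show ?case using bounded_bilinear.continuous_on[OF assms(1)] by auto
next
  case (Suc k)
  have fg: "Ck_on k S f" "Ck_on k S g" using Suc.prems Ck_on_Suc_D by blast+
  show ?case
  proof (rule Ck_on_SucI[OF assms(2)])
    show "((\<lambda>x. b (f x) (g x)) has_derivative
        (\<lambda>v. b (f x) (frechet_derivative g (at x) v) + b (frechet_derivative f (at x) v) (g x))) (at x)"
      if "x \<in> S" for x
      by (intro bounded_bilinear.FDERIV[OF assms(1)] Ck_on_has_derivative[OF Suc.prems(1)]
          Ck_on_has_derivative[OF Suc.prems(2)] that) auto
    show "Ck_on k S (\<lambda>x. b (f x) (frechet_derivative g (at x) v) + b (frechet_derivative f (at x) v) (g x))" for v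
      using Suc.prems by (intro Ck_on_add[OF assms(2)] Suc.IH fg) auto
  qed
qed

lemmas Ck_on_mult = Ck_on_bilinear[OF bounded_bilinear_mult]
lemmas Ck_on_scaleR = Ck_on_bilinear[OF bounded_bilinear_scaleR]
lemmas Ck_on_inner = Ck_on_bilinear[OF bounded_bilinear_inner]

lemma Ck_on_uminus: "open S \<Longrightarrow> Ck_on k S f \<Longrightarrow> Ck_on k S (\<lambda>x. - f x)"
  by (rule Ck_on_bounded_linear[OF bounded_linear_minus[OF bounded_linear_ident]])

lemma Ck_on_diff: "open S \<Longrightarrow> Ck_on k S f \<Longrightarrow> Ck_on k S g \<Longrightarrow> Ck_on k S (\<lambda>x. f x - g x)"
  using Ck_on_add[of S k f "\<lambda>x. - g x"] Ck_on_uminus[of S k g] by simp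

lemma linear_euclidean_expand:
  fixes L :: "'a::euclidean_space \<Rightarrow> 'b::real_vector"
  assumes "linear L"
  shows "L v = (\<Sum>b\<in>Basis. (v \<bullet> b) *\<^sub>R L b)"
  using linear_sum[OF assms, of "\<lambda>b. (v \<bullet> b) *\<^sub>R b" Basis] linear_cmul[OF assms]
  by (simp add: euclidean_representation)

text \<open>\<open>Ck_on\<close> controls derivatives in fixed directions only. Expanding the moving
  direction \<open>X x\<close> in the basis leaves finitely many fixed directions with coefficients
  of class \<open>C\<^sup>k\<close>.\<close>

lemma Ck_on_dir_derivative:
  fixes f :: "'a::euclidean_space \<Rightarrow> 'b::real_normed_vector"
  assumes "open S" "Ck_on (Suc k) S f" "Ck_on k S X"
  shows "Ck_on k S (\<lambda>x. frechet_derivative f (at x) (X x))"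
proof -
  have "Ck_on k S (\<lambda>x. frechet_derivative f (at x) b)" for b using assms(2) by simp
  then have 1: "Ck_on k S (\<lambda>x. \<Sum>b\<in>Basis. (X x \<bullet> b) *\<^sub>R frechet_derivative f (at x) b)"
    using assms(1,3) by (intro Ck_on_sum Ck_on_scaleR Ck_on_inner Ck_on_const)
  have 2: "(\<Sum>b\<in>Basis. (X x \<bullet> b) *\<^sub>R frechet_derivative f (at x) b)
     = frechet_derivative f (at x) (X x)" if "x \<in> S" for x
    by (rule linear_euclidean_expand[symmetric], rule linear_frechet_derivative)
      (use assms(2) that in simp)
  show ?thesis
    using Ck_on_cong[of S "\<lambda>x. \<Sum>b\<in>Basis. (X x \<bullet> b) *\<^sub>R frechet_derivative f (at x) b"
        "\<lambda>x. frechet_derivative f (at x) (X x)" k, OF assms(1) 2] 1 by simp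
qed

text \<open>By the chain rule the derivative of \<open>g\<close> is evaluated on a vector that moves
  with \<open>x\<close>. Expanded in the basis, its coefficients come from the derivative of
  \<open>f\<close>, and the derivatives of \<open>g\<close> in the fixed basis directions, composed
  with \<open>f\<close>, fall under the induction hypothesis.\<close>

lemma Ck_on_compose:
  fixes f :: "'a::real_normed_vector \<Rightarrow> 'b::euclidean_space"
  assumes "open S" "f ` S \<subseteq> T" "Ck_on k S f" "Ck_on k T g"
  shows "Ck_on k S (\<lambda>x. g (f x))"
  using assms(3,4)
proof (induction k arbitrary: g)
  case 0
  then show ?case using assms(2) continuous_on_compose2[of T g S f] by simp
next
  case (Suc k)
  have fk: "Ck_on k S f" using Suc.prems(1) by (rule Ck_on_Suc_D)
  have der: "((\<lambda>x. g (f x)) has_derivative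
      (\<lambda>v. \<Sum>b\<in>Basis. (frechet_derivative f (at x) v \<bullet> b) *\<^sub>R frechet_derivative g (at (f x)) b)) (at x)"
    if "x \<in> S" for x
  proof -
    have "g differentiable at (f x)" using Suc.prems(2) that assms(2) by auto
    then have gd: "(g has_derivative frechet_derivative g (at (f x))) (at (f x))"
      by (simp add: frechet_derivative_works[symmetric])
    have "((\<lambda>x. g (f x)) has_derivative
        (\<lambda>v. frechet_derivative g (at (f x)) (frechet_derivative f (at x) v))) (at x)"
      by (rule has_derivative_compose[OF Ck_on_has_derivative[OF Suc.prems(1) _ that] gd]) simp
    then show ?thesis
      by (subst (asm) linear_euclidean_expand[OF has_derivative_linear[OF gd]])
  qed
  show ?case
  proof (rule Ck_on_SucI[OF assms(1) der])
    fix v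
    have "Ck_on k S (\<lambda>x. frechet_derivative f (at x) v)" using Suc.prems(1) by simp
    moreover have "Ck_on k S (\<lambda>x. frechet_derivative g (at (f x)) b)" for b
      using Suc.IH[OF fk, of "\<lambda>y. frechet_derivative g (at y) b"] Suc.prems(2) by simp
    ultimately show "Ck_on k S (\<lambda>x. \<Sum>b\<in>Basis. (frechet_derivative f (at x) v \<bullet> b) *\<^sub>R
        frechet_derivative g (at (f x)) b)"
      using assms(1) by (intro Ck_on_sum Ck_on_scaleR Ck_on_inner Ck_on_const)
  qed
qed

text \<open>The derivative is again a product of copies of \<open>inverse\<close>, so the induction
  closes on itself. The square root works in the same way, with derivative
  \<open>v / (2 * sqrt x)\<close>.\<close>

lemma Ck_on_inverse_real: "Ck_on k (- {0}) (inverse :: real \<Rightarrow> real)"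
proof (induction k)
  case 0
  then show ?case by (auto intro!: continuous_intros)
next
  case (Suc k)
  show ?case
    by (rule Ck_on_SucI[where f' = "\<lambda>x v. - (inverse x * v * inverse x)"])
      (auto intro!: has_derivative_inverse' Ck_on_uminus Ck_on_mult Suc)
qed

lemma Ck_on_inverse:
  fixes f :: "'a::real_normed_vector \<Rightarrow> real"
  shows "open S \<Longrightarrow> Ck_on k S f \<Longrightarrow> (\<And>x. x \<in> S \<Longrightarrow> f x \<noteq> 0) \<Longrightarrow> Ck_on k S (\<lambda>x. inverse (f x))"
  by (rule Ck_on_compose[OF _ _ _ Ck_on_inverse_real]) auto

lemma Ck_on_sqrt_real: "Ck_on k {0<..} sqrt"
proof (induction k)
  case 0
  then show ?case by (auto intro!: continuous_intros)
next
  case (Suc k)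
  show ?case
  proof (rule Ck_on_SucI[where f' = "\<lambda>x v. inverse (sqrt x) * (v / 2)"])
    show "(sqrt has_derivative (\<lambda>v. inverse (sqrt x) * (v / 2))) (at x)" if "x \<in> {0<..}" for x
      using that by (auto intro!: derivative_eq_intros simp: field_simps)
    show "Ck_on k {0<..} (\<lambda>x. inverse (sqrt x) * (v / 2))" for v
      by (intro Ck_on_mult Ck_on_inverse Suc Ck_on_const) auto
  qed auto
qed

lemma Ck_on_sqrt:
  fixes f :: "'a::real_normed_vector \<Rightarrow> real"
  shows "open S \<Longrightarrow> Ck_on k S f \<Longrightarrow> (\<And>x. x \<in> S \<Longrightarrow> f x > 0) \<Longrightarrow> Ck_on k S (\<lambda>x. sqrt (f x))"
  by (rule Ck_on_compose[OF _ _ _ Ck_on_sqrt_real]) auto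

section \<open>Second derivatives, determinants and linear maps\<close>

lemma has_real_derivative_along_line:
  assumes "(f has_derivative D) (at (a + s *\<^sub>R u))"
  shows "((\<lambda>s. f (a + s *\<^sub>R u)) has_real_derivative D u) (at s)"
proof -
  have "((\<lambda>s. a + s *\<^sub>R u) has_derivative (\<lambda>h. h *\<^sub>R u)) (at s)"
    by (auto intro!: derivative_eq_intros)
  from has_derivative_compose[OF this assms]
  have "((\<lambda>s. f (a + s *\<^sub>R u)) has_derivative (\<lambda>h. D (h *\<^sub>R u))) (at s)" .
  then show ?thesis
    using linear_cmul[OF has_derivative_linear[OF assms]]
    by (simp add: has_field_derivative_def mult.commute[of _ "D u"])
qed

text \<open>Two applications of the mean value theorem: along \<open>u\<close> to the difference of
  \<open>f\<close> between two parallel lines, then along \<open>v\<close> to the derivative of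
  \<open>f\<close> in direction \<open>u\<close>. The left side is symmetric in \<open>u\<close> and
  \<open>v\<close>, the right side is not.\<close>

lemma second_difference_mean_value:
  fixes f :: "'a::real_normed_vector \<Rightarrow> real"
  assumes f: "Ck_on 2 S f" and t: "t > 0"
    and S: "\<And>s r. 0 \<le> s \<Longrightarrow> s \<le> t \<Longrightarrow> 0 \<le> r \<Longrightarrow> r \<le> t \<Longrightarrow> x + s *\<^sub>R u + r *\<^sub>R v \<in> S"
  shows "\<exists>s r. 0 \<le> s \<and> s \<le> t \<and> 0 \<le> r \<and> r \<le> t \<and>
    f (x + t *\<^sub>R u + t *\<^sub>R v) - f (x + t *\<^sub>R u) - f (x + t *\<^sub>R v) + f x
      = t * t * frechet_derivative (\<lambda>y. frechet_derivative f (at y) u) (at (x + s *\<^sub>R u + r *\<^sub>R v)) v"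
proof -
  have f1: "(f has_derivative frechet_derivative f (at y)) (at y)" if "y \<in> S" for y
    using Ck_on_has_derivative[OF f _ that] by simp
  have f2: "((\<lambda>y. frechet_derivative f (at y) u) has_derivative
      frechet_derivative (\<lambda>y. frechet_derivative f (at y) u) (at y)) (at y)" if "y \<in> S" for y
    using f that by (intro Ck_on_has_derivative[of 1 S]) (auto simp: numeral_2_eq_2)
  have "\<exists>s. 0 < s \<and> s < t \<and>
     (f ((x + t *\<^sub>R v) + t *\<^sub>R u) - f (x + t *\<^sub>R u)) - (f ((x + t *\<^sub>R v) + 0 *\<^sub>R u) - f (x + 0 *\<^sub>R u))
      = (t - 0) * (frechet_derivative f (at ((x + t *\<^sub>R v) + s *\<^sub>R u)) u - frechet_derivative f (at (x + s *\<^sub>R u)) u)"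
    using S[of _ t] S[of _ 0] t
    by (intro MVT2 DERIV_diff has_real_derivative_along_line f1)
      (auto simp: algebra_simps)
  then obtain s where s: "0 < s" "s < t" and
    e1: "f (x + t *\<^sub>R u + t *\<^sub>R v) - f (x + t *\<^sub>R u) - f (x + t *\<^sub>R v) + f x =
      t * (frechet_derivative f (at (x + s *\<^sub>R u + t *\<^sub>R v)) u - frechet_derivative f (at (x + s *\<^sub>R u)) u)"
    by (auto simp: algebra_simps)
  have "\<exists>r. 0 < r \<and> r < t \<and>
     frechet_derivative f (at (x + s *\<^sub>R u + t *\<^sub>R v)) u - frechet_derivative f (at (x + s *\<^sub>R u + 0 *\<^sub>R v)) u
      = (t - 0) * frechet_derivative (\<lambda>y. frechet_derivative f (at y) u) (at (x + s *\<^sub>R u + r *\<^sub>R v)) v"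
    using S[of s] s t
    by (intro MVT2 has_real_derivative_along_line f2) (auto simp: algebra_simps)
  then obtain r where "0 < r" "r < t"
     "frechet_derivative f (at (x + s *\<^sub>R u + t *\<^sub>R v)) u - frechet_derivative f (at (x + s *\<^sub>R u)) u
      = t * frechet_derivative (\<lambda>y. frechet_derivative f (at y) u) (at (x + s *\<^sub>R u + r *\<^sub>R v)) v"
    by auto
  with s e1 show ?thesis by (intro exI[of _ s] exI[of _ r]) auto
qed

text \<open>Schwarz's theorem. The same second difference equals \<open>t * t\<close> times either
  mixed derivative, each at some point close to \<open>x\<close>. Were the two derivatives at
  \<open>x\<close> at distance \<open>2 * e\<close>, continuity would keep them apart at those
  points too.\<close>

lemma second_derivative_symmetric_real:
  fixes f :: "'a::real_normed_vector \<Rightarrow> real"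
  assumes "open S" "x \<in> S" and f: "Ck_on 2 S f"
  shows "frechet_derivative (\<lambda>y. frechet_derivative f (at y) u) (at x) v =
         frechet_derivative (\<lambda>y. frechet_derivative f (at y) v) (at x) u"
proof (rule ccontr)
  define F where "F = (\<lambda>u v x. frechet_derivative (\<lambda>y. frechet_derivative f (at y) u) (at x) v)"
  assume "\<not> ?thesis"
  then have ne: "F u v x \<noteq> F v u x" by (simp add: F_def)
  define e where "e = \<bar>F u v x - F v u x\<bar> / 2"
  have e: "e > 0" using ne by (simp add: e_def)
  have "continuous_on S (F u v)" "continuous_on S (F v u)"
    using f by (auto simp: F_def numeral_2_eq_2)
  then have "isCont (F u v) x" "isCont (F v u) x"
    using assms by (auto simp: continuous_on_eq_continuous_at)
  then have "\<forall>\<^sub>F y in nhds x. dist (F u v y) (F u v x) < e" "\<forall>\<^sub>F y in nhds x. dist (F v u y) (F v u x) < e"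
    using e by (auto simp: isCont_def tendsto_iff eventually_at_filter elim!: eventually_mono)
  moreover have "\<forall>\<^sub>F y in nhds x. y \<in> S" using assms by (auto simp: eventually_nhds)
  ultimately have "\<forall>\<^sub>F y in nhds x. dist (F u v y) (F u v x) < e \<and> dist (F v u y) (F v u x) < e \<and> y \<in> S"
    by eventually_elim auto
  then obtain d where d: "d > 0" "\<And>y. dist y x < d \<Longrightarrow> dist (F u v y) (F u v x) < e"
    "\<And>y. dist y x < d \<Longrightarrow> dist (F v u y) (F v u x) < e" "\<And>y. dist y x < d \<Longrightarrow> y \<in> S"
    unfolding eventually_nhds_metric by blast
  \<comment> \<open>Small enough that every point of the parallelogram spanned by \<open>t u\<close>
    and \<open>t v\<close> is within \<open>d / 2\<close> of \<open>x\<close>; the summand 1 keeps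
    the denominator positive when \<open>u\<close> and \<open>v\<close> vanish.\<close>
  define t where "t = d / (2 * (norm u + norm v + 1))"
  have pos: "norm u + norm v + 1 > 0"
    by (simp add: add_nonneg_pos)
  then have t: "t > 0" using d(1) by (simp add: t_def)
  have near: "dist (x + s *\<^sub>R u + r *\<^sub>R v) x < d" if "0 \<le> s" "s \<le> t" "0 \<le> r" "r \<le> t" for s r
  proof -
    have "dist (x + s *\<^sub>R u + r *\<^sub>R v) x \<le> s * norm u + r * norm v"
      using norm_triangle_ineq[of "s *\<^sub>R u" "r *\<^sub>R v"] that by (simp add: dist_norm)
    also have "\<dots> \<le> t * norm u + t * norm v"
      using that by (intro add_mono mult_right_mono) auto
    also have "\<dots> \<le> t * (norm u + norm v + 1)" using t by (simp add: algebra_simps)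
    also have "\<dots> = d / 2" using pos by (simp add: t_def field_simps)
    also have "\<dots> < d" using d(1) by simp
    finally show ?thesis .
  qed
  obtain s r where 1: "0 \<le> s" "s \<le> t" "0 \<le> r" "r \<le> t"
    "f (x + t *\<^sub>R u + t *\<^sub>R v) - f (x + t *\<^sub>R u) - f (x + t *\<^sub>R v) + f x = t * t * F u v (x + s *\<^sub>R u + r *\<^sub>R v)"
    using second_difference_mean_value[OF f t, of x u v] near d(4) unfolding F_def by blast
  have near': "dist (x + s *\<^sub>R v + r *\<^sub>R u) x < d" if "0 \<le> s" "s \<le> t" "0 \<le> r" "r \<le> t" for s r
    using near[of r s] that by (simp add: add.commute add.left_commute)
  obtain s' r' where 2: "0 \<le> s'" "s' \<le> t" "0 \<le> r'" "r' \<le> t"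
    "f (x + t *\<^sub>R v + t *\<^sub>R u) - f (x + t *\<^sub>R v) - f (x + t *\<^sub>R u) + f x = t * t * F v u (x + s' *\<^sub>R v + r' *\<^sub>R u)"
    using second_difference_mean_value[OF f t, of x v u] near' d(4) unfolding F_def by blast
  have "f (x + t *\<^sub>R u + t *\<^sub>R v) = f (x + t *\<^sub>R v + t *\<^sub>R u)" by (simp add: ac_simps)
  then have "t * t * F u v (x + s *\<^sub>R u + r *\<^sub>R v) = t * t * F v u (x + s' *\<^sub>R v + r' *\<^sub>R u)"
    using 1(5) 2(5) by linarith
  then have "F u v (x + s *\<^sub>R u + r *\<^sub>R v) = F v u (x + s' *\<^sub>R v + r' *\<^sub>R u)"
    using t by simp
  then have "dist (F u v x) (F v u x) < e + e"
    using d(2)[OF near[OF 1(1-4)]] d(3)[OF near'[OF 2(1-4)]] by (metis add_strict_mono dist_commute dist_triangle le_less_trans)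
  then show False by (simp add: e_def dist_real_def)
qed

lemma frechet_derivative_inner_left:
  "f differentiable at x \<Longrightarrow> frechet_derivative (\<lambda>y. f y \<bullet> b) (at x) = (\<lambda>v. frechet_derivative f (at x) v \<bullet> b)"
  by (rule frechet_derivative_eqI)
    (auto intro!: has_derivative_inner_left simp: frechet_derivative_works[symmetric])

lemma second_derivative_symmetric:
  fixes f :: "'a::real_normed_vector \<Rightarrow> 'b::euclidean_space"
  assumes "open S" "x \<in> S" and f: "Ck_on 2 S f"
  shows "frechet_derivative (\<lambda>y. frechet_derivative f (at y) u) (at x) v =
         frechet_derivative (\<lambda>y. frechet_derivative f (at y) v) (at x) u"
proof (rule euclidean_eqI)
  fix b :: 'b
  have fb: "Ck_on 2 S (\<lambda>y. f y \<bullet> b)"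
    using assms by (intro Ck_on_inner) auto
  have *: "frechet_derivative (\<lambda>y. frechet_derivative f (at y) u) (at x) v \<bullet> b =
     frechet_derivative (\<lambda>y. frechet_derivative (\<lambda>y. f y \<bullet> b) (at y) u) (at x) v" for u v
  proof -
    have "frechet_derivative (\<lambda>y. frechet_derivative (\<lambda>y. f y \<bullet> b) (at y) u) (at x) =
        frechet_derivative (\<lambda>y. frechet_derivative f (at y) u \<bullet> b) (at x)"
      using f by (intro frechet_derivative_cong_open[OF assms(1,2)])
        (auto simp: frechet_derivative_inner_left numeral_2_eq_2)
    then show ?thesis
      using f assms(2) by (auto simp: frechet_derivative_inner_left numeral_2_eq_2)
  qed
  show "frechet_derivative (\<lambda>y. frechet_derivative f (at y) u) (at x) v \<bullet> b =
         frechet_derivative (\<lambda>y. frechet_derivative f (at y) v) (at x) u \<bullet> b"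
    unfolding * by (rule second_derivative_symmetric_real[OF assms(1,2) fb])
qed

text \<open>Jacobi's formula. \<open>Q M D\<close> is the product rule applied to the six terms of
  the determinant at \<open>M\<close> in direction \<open>D\<close>. It becomes
  \<open>det M * trace E\<close> when \<open>D = M ** E\<close>, and every direction has this form
  with \<open>E = B ** D\<close>, since \<open>B\<close> is a right inverse of
  \<open>M x\<close>.\<close>

lemma has_derivative_det3:
  fixes M :: "'a::real_normed_vector \<Rightarrow> real^3^3"
  assumes M: "(M has_derivative M') (at x)" and B: "M x ** B = mat 1"
  shows "((\<lambda>x. det (M x)) has_derivative (\<lambda>h. det (M x) * trace (B ** M' h))) (at x)"
proof -
  define Q :: "real^3^3 \<Rightarrow> real^3^3 \<Rightarrow> real" where "Q = (\<lambda>M D.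
     D$1$1 * M$2$2 * M$3$3 + M$1$1 * D$2$2 * M$3$3 + M$1$1 * M$2$2 * D$3$3 +
     (D$1$2 * M$2$3 * M$3$1 + M$1$2 * D$2$3 * M$3$1 + M$1$2 * M$2$3 * D$3$1) +
     (D$1$3 * M$2$1 * M$3$2 + M$1$3 * D$2$1 * M$3$2 + M$1$3 * M$2$1 * D$3$2) -
     (D$1$1 * M$2$3 * M$3$2 + M$1$1 * D$2$3 * M$3$2 + M$1$1 * M$2$3 * D$3$2) -
     (D$1$2 * M$2$1 * M$3$3 + M$1$2 * D$2$1 * M$3$3 + M$1$2 * M$2$1 * D$3$3) -
     (D$1$3 * M$2$2 * M$3$1 + M$1$3 * D$2$2 * M$3$1 + M$1$3 * M$2$2 * D$3$1))"
  have Q: "Q M (M ** E) = det M * trace E" for M E :: "real^3^3"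
    by (simp add: Q_def matrix_matrix_mult_def sum_3 trace_def det_3 algebra_simps)
  have ij: "((\<lambda>x. M x $ i $ j) has_derivative (\<lambda>h. M' h $ i $ j)) (at x)" for i j
    by (intro bounded_linear.has_derivative[OF bounded_linear_vec_nth] M)
  have "((\<lambda>x. det (M x)) has_derivative (\<lambda>h. Q (M x) (M' h))) (at x)"
    unfolding det_3 Q_def
    by (rule derivative_eq_intros ij | simp add: algebra_simps)+
  moreover have "Q (M x) (M' h) = det (M x) * trace (B ** M' h)" for h
    using Q[of "M x" "B ** M' h"] B by (simp add: matrix_mul_assoc matrix_mul_lid)
  ultimately show ?thesis by simp
qed

text \<open>Both sides have dimension 2, the kernel because \<open>l\<close> is not zero and the
  range because \<open>L\<close> is injective, and one contains the other. Applied with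
  \<open>L\<close> the derivative of a parametrization and \<open>l\<close> the differential of a
  defining function.\<close>

lemma hyperplane_eq_range:
  fixes L :: "real^2 \<Rightarrow> real^3" and l :: "real^3 \<Rightarrow> real"
  assumes "linear L" "inj L" "linear l" "\<And>e. l (L e) = 0" "l \<nu> \<noteq> 0"
  shows "{v. l v = 0} = range L"
proof -
  define a where "a = adjoint l 1"
  have l: "l v = a \<bullet> v" for v
    using adjoint_works[OF assms(3), of v 1] by (simp add: a_def inner_commute)
  have "a \<noteq> 0" using assms(5) l by auto
  then have "dim {v. a \<bullet> v = 0} = 2" by (simp add: dim_hyperplane)
  moreover have "dim (range L) = 2"
    using dim_image_eq[OF assms(1), of UNIV] assms(2) by (simp add: dim_UNIV)
  moreover have "subspace (range L)" using linear_subspace_image[OF assms(1) subspace_UNIV] .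
  moreover have "range L \<subseteq> {v. a \<bullet> v = 0}" using assms(4) l by auto
  ultimately have "range L = {v. a \<bullet> v = 0}"
    by (intro subspace_dim_equal) (auto simp: subspace_hyperplane)
  then show ?thesis by (simp add: l)
qed

text \<open>Subtracting from \<open>v\<close> a multiple of \<open>\<nu>\<close> brings it into the
  kernel of \<open>l\<close>, which is the plane \<open>range L\<close>, and there \<open>l'\<close>
  vanishes as well.\<close>

lemma functionals_vanishing_on_plane_proportional:
  fixes L :: "real^2 \<Rightarrow> real^3" and l l' :: "real^3 \<Rightarrow> real"
  assumes "linear L" "inj L" "linear l" "\<And>e. l (L e) = 0" "l \<nu> \<noteq> 0"
    "linear l'" "\<And>e. l' (L e) = 0"
  shows "l' v = l' \<nu> / l \<nu> * l v"
proof -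
  have "l (v - (l v / l \<nu>) *\<^sub>R \<nu>) = 0"
    using assms(5) by (simp add: linear_diff[OF assms(3)] linear_cmul[OF assms(3)])
  then obtain e where "v - (l v / l \<nu>) *\<^sub>R \<nu> = L e"
    using hyperplane_eq_range[OF assms(1-5)] by blast
  then have "l' (v - (l v / l \<nu>) *\<^sub>R \<nu>) = 0" using assms(7) by simp
  then show ?thesis
    by (simp add: linear_diff[OF assms(6)] linear_cmul[OF assms(6)])
qed

text \<open>An injective linear map is bounded below by some \<open>B\<close>. Near
  \<open>y0\<close> the remainder consumes at most half of this growth.\<close>

lemma linear_growth_of_injective_derivative:
  fixes F :: "'a::euclidean_space \<Rightarrow> 'b::euclidean_space"
  assumes F: "(F has_derivative F') (at y0)" and "F y0 = 0" "inj F'"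
  shows "\<exists>c>0. \<exists>r>0. \<forall>y. norm (y - y0) < r \<longrightarrow> c * norm (y - y0) \<le> norm (F y)"
proof -
  have lin: "linear F'" using F by (rule has_derivative_linear)
  obtain B where B: "B > 0" "\<And>x. B * norm x \<le> norm (F' x)"
    using linear_inj_bounded_below_pos[OF lin assms(3)] by blast
  obtain r where r: "r > 0" "\<And>y. norm (y - y0) < r \<Longrightarrow> norm (F y - F y0 - F' (y - y0)) \<le> B / 2 * norm (y - y0)"
    using F B(1) unfolding has_derivative_at_alt by (meson half_gt_zero)
  have "B / 2 * norm (y - y0) \<le> norm (F y)" if "norm (y - y0) < r" for y
  proof -
    have "norm (F' (y - y0)) \<le> norm (F y) + norm (F y - F' (y - y0))"
      by (metis add.commute norm_minus_commute norm_triangle_sub)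
    then show ?thesis using r(2)[OF that] B(2)[of "y - y0"] assms(2) by simp
  qed
  then show ?thesis using r(1) B(1) by (intro exI[of _ "B / 2"] conjI exI[of _ r]) auto
qed

section \<open>Charts and tangent vectors\<close>

abbreviation chart_ran :: "'m chart \<Rightarrow> (real^3) set" where
  "chart_ran c \<equiv> chart_map c ` chart_dom c"

text \<open>Inverse to taking the component in the chart \<open>c\<close>: it identifies
  \<open>real^3\<close> with \<open>tangent A q\<close>, so that statements about tangent vectors
  become linear algebra in coordinates.\<close>

definition lift :: "'m chart set \<Rightarrow> 'm chart \<Rightarrow> 'm \<Rightarrow> real^3 \<Rightarrow> 'm tvec" where
  "lift A c q e = push A (chart_inv c) (chart_map c q) e"

definition chart_field :: "'m chart set \<Rightarrow> 'm chart \<Rightarrow> (real^3 \<Rightarrow> real^3) \<Rightarrow> 'm \<Rightarrow> 'm tvec" where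
  "chart_field A c X q = lift A c q (X (chart_map c q))"

lemma matrix_real_works: "linear f \<Longrightarrow> matrix f *v x = f x" for f :: "real^'n \<Rightarrow> real^'m"
  using fun_cong[OF matrix_vector_mul(2), of f x] by blast

text \<open>The vectors are rows here, so applying \<open>f\<close> to each of them multiplies the
  matrix on the right by the transpose of the matrix of \<open>f\<close>.\<close>

lemma det_vector_image:
  fixes f :: "real^3 \<Rightarrow> real^3"
  assumes "linear f"
  shows "det (vector [f a, f b, f c] :: real^3^3) = det (vector [a, b, c] :: real^3^3) * det (matrix f)"
proof -
  have f: "(\<Sum>j\<in>UNIV. v $ j * matrix f $ i $ j) = f v $ i" for v i
    using arg_cong[OF matrix_real_works[OF assms, of v], of "\<lambda>z. z $ i"]
    by (simp only: matrix_vector_mult_def vec_lambda_beta mult.commute)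
  have "(vector [f a, f b, f c] :: real^3^3) = vector [a, b, c] ** transpose (matrix f)"
    unfolding vec_eq_iff matrix_matrix_mult_def transpose_def forall_3 vec_lambda_beta vector_3 f by (intro conjI refl)
  then show ?thesis by (simp only: det_mul det_transpose)
qed

locale atlas =
  fixes A :: "'m::topological_space chart set"
  assumes atlas: "smooth_atlas A"
begin

lemma chart: "c \<in> A \<Longrightarrow> is_chart c"
  using atlas by (simp add: smooth_atlas_def)

lemma
  assumes "c \<in> A"
  shows open_dom: "open (chart_dom c)" and open_ran: "open (chart_ran c)"
    and inv_map: "q \<in> chart_dom c \<Longrightarrow> chart_inv c (chart_map c q) = q"
    and continuous_map: "continuous_on (chart_dom c) (chart_map c)"
    and continuous_inv: "continuous_on (chart_ran c) (chart_inv c)"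
  using chart[OF assms] by (auto simp: is_chart_def homeomorphism_def)

lemma map_inv: "c \<in> A \<Longrightarrow> x \<in> chart_ran c \<Longrightarrow> chart_map c (chart_inv c x) = x"
  using inv_map[of c] by auto

lemma inv_in_dom: "c \<in> A \<Longrightarrow> x \<in> chart_ran c \<Longrightarrow> chart_inv c x \<in> chart_dom c"
  using inv_map[of c] by auto

lemma chart_image_iff:
  "c \<in> A \<Longrightarrow> x \<in> chart_map c ` (U \<inter> chart_dom c) \<longleftrightarrow> x \<in> chart_ran c \<and> chart_inv c x \<in> U"
  using inv_map[of c] by force

lemma open_chart_image:
  assumes "c \<in> A" "open U"
  shows "open (chart_map c ` (U \<inter> chart_dom c))"
proof -
  have "chart_map c ` (U \<inter> chart_dom c) = chart_inv c -` U \<inter> chart_ran c"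
    using chart_image_iff[OF assms(1)] by blast
  then show ?thesis
    using continuous_on_open_vimage[OF open_ran[OF assms(1)]] continuous_inv[OF assms(1)] assms(2) by metis
qed

lemma Ck_transition:
  assumes "c \<in> A" "c' \<in> A"
  shows "Ck_on k (chart_map c ` (chart_dom c \<inter> chart_dom c')) (chart_map c' \<circ> chart_inv c)"
  using atlas assms by (simp add: smooth_atlas_def)

lemma open_overlap: "c \<in> A \<Longrightarrow> c' \<in> A \<Longrightarrow> open (chart_map c ` (chart_dom c \<inter> chart_dom c'))"
  using open_chart_image[of c "chart_dom c'"] open_dom[of c'] by (simp add: Int_commute)

lemma transition_has_derivative:
  assumes "c \<in> A" "c' \<in> A" "q \<in> chart_dom c" "q \<in> chart_dom c'"
  shows "((chart_map c' \<circ> chart_inv c) has_derivative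
      frechet_derivative (chart_map c' \<circ> chart_inv c) (at (chart_map c q))) (at (chart_map c q))"
  using Ck_on_has_derivative[OF Ck_transition[OF assms(1,2), of 1]] assms(3,4) by simp

lemma derivative_in_charts:
  assumes c: "c \<in> A" "c' \<in> A" "q \<in> chart_dom c" "q \<in> chart_dom c'"
    and f: "((f \<circ> chart_inv c') has_derivative D) (at (chart_map c' q))"
  shows "((f \<circ> chart_inv c) has_derivative
     (\<lambda>v. D (frechet_derivative (chart_map c' \<circ> chart_inv c) (at (chart_map c q)) v))) (at (chart_map c q))"
proof -
  have "((f \<circ> chart_inv c') has_derivative D) (at ((chart_map c' \<circ> chart_inv c) (chart_map c q)))"
    using f inv_map[OF c(1)] c by simp
  from has_derivative_compose[OF transition_has_derivative[OF c] this]
  show ?thesis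
    by (rule has_derivative_transform_within_open[OF _ open_overlap[OF c(1,2)]])
      (use c inv_map[OF c(1)] inv_map[OF c(2)] in auto)
qed

lemma derivative_of_map_in_charts:
  assumes c: "c \<in> A" "c' \<in> A" "\<psi> y \<in> chart_dom c" "\<psi> y \<in> chart_dom c'"
    and V: "open V" "y \<in> V" "continuous_on V \<psi>"
    and f: "((chart_map c \<circ> \<psi>) has_derivative D) (at y)"
  shows "((chart_map c' \<circ> \<psi>) has_derivative
     (\<lambda>v. frechet_derivative (chart_map c' \<circ> chart_inv c) (at (chart_map c (\<psi> y))) (D v))) (at y)"
proof -
  have 1: "open (\<psi> -` (chart_dom c \<inter> chart_dom c') \<inter> V)"
    using V(3) open_dom[OF c(1)] open_dom[OF c(2)] continuous_on_open_vimage[OF V(1), of \<psi>] by blast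
  have 2: "((chart_map c' \<circ> chart_inv c) has_derivative
      frechet_derivative (chart_map c' \<circ> chart_inv c) (at (chart_map c (\<psi> y)))) (at ((chart_map c \<circ> \<psi>) y))"
    using transition_has_derivative[OF c] by simp
  show ?thesis
    by (rule has_derivative_transform_within_open[OF has_derivative_compose[OF f 2] 1])
      (use c V inv_map[OF c(1)] in auto)
qed

lemma transition_derivative_compose:
  assumes "c \<in> A" "c' \<in> A" "c'' \<in> A" "q \<in> chart_dom c" "q \<in> chart_dom c'" "q \<in> chart_dom c''"
  shows "frechet_derivative (chart_map c'' \<circ> chart_inv c) (at (chart_map c q)) v =
    frechet_derivative (chart_map c'' \<circ> chart_inv c') (at (chart_map c' q))
      (frechet_derivative (chart_map c' \<circ> chart_inv c) (at (chart_map c q)) v)"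
  using frechet_derivative_eqI[OF derivative_in_charts[OF assms(1,2,4,5)
        transition_has_derivative[OF assms(2,3,5,6)]]] by simp

lemma transition_derivative_same:
  assumes "c \<in> A" "q \<in> chart_dom c"
  shows "frechet_derivative (chart_map c \<circ> chart_inv c) (at (chart_map c q)) v = v"
proof -
  have "frechet_derivative (chart_map c \<circ> chart_inv c) (at (chart_map c q)) =
      frechet_derivative (\<lambda>x. x) (at (chart_map c q))"
    using map_inv[OF assms(1)] assms(2) by (intro frechet_derivative_cong_open[OF open_ran[OF assms(1)]]) auto
  then show ?thesis by simp
qed

lemma lift_component:
  "q \<in> chart_dom c \<Longrightarrow> c \<in> A \<Longrightarrow> lift A c q e c' = (if c' \<in> A \<and> q \<in> chart_dom c'
     then frechet_derivative (chart_map c' \<circ> chart_inv c) (at (chart_map c q)) e else 0)"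
  by (simp add: lift_def push_def inv_map)

lemma lift_same [simp]: "c \<in> A \<Longrightarrow> q \<in> chart_dom c \<Longrightarrow> lift A c q e c = e"
  by (simp add: lift_component transition_derivative_same)

lemma lift_tangent:
  assumes "c \<in> A" "q \<in> chart_dom c"
  shows "lift A c q e \<in> tangent A q"
  unfolding tangent_def mem_Collect_eq
proof (intro conjI ballI allI impI)
  fix c' c'' assume "c' \<in> A" "c'' \<in> A" "q \<in> chart_dom c' \<inter> chart_dom c''"
  with assms transition_derivative_compose[of c c' c'' q e]
  show "lift A c q e c'' = frechet_derivative (chart_map c'' \<circ> chart_inv c') (at (chart_map c' q)) (lift A c q e c')"
    by (simp add: lift_component)
next
  fix c' assume "\<not> (c' \<in> A \<and> q \<in> chart_dom c')"
  with assms show "lift A c q e c' = 0"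
    by (cases "c' \<in> A") (simp_all add: lift_component)
qed

lemma tangent_component:
  "v \<in> tangent A q \<Longrightarrow> c \<in> A \<Longrightarrow> c' \<in> A \<Longrightarrow> q \<in> chart_dom c \<Longrightarrow> q \<in> chart_dom c' \<Longrightarrow>
     v c' = frechet_derivative (chart_map c' \<circ> chart_inv c) (at (chart_map c q)) (v c)"
  unfolding tangent_def mem_Collect_eq by blast

lemma tangent_component_0: "v \<in> tangent A q \<Longrightarrow> \<not> (c \<in> A \<and> q \<in> chart_dom c) \<Longrightarrow> v c = 0"
  unfolding tangent_def mem_Collect_eq by blast

text \<open>The equality holds at every pair \<open>c'\<close>, including those that are no chart
  around \<open>q\<close>, because the components of a tangent vector are 0 there by
  convention.\<close>

lemma tangent_eq_lift:
  assumes "v \<in> tangent A q" "c \<in> A" "q \<in> chart_dom c"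
  shows "v = lift A c q (v c)"
proof
  fix c' show "v c' = lift A c q (v c) c'"
    using tangent_component[OF assms(1,2) _ assms(3), of c'] tangent_component_0[OF assms(1), of c'] assms(2,3)
    by (cases "c' \<in> A"; cases "q \<in> chart_dom c'") (simp_all add: lift_component)
qed

lemma lift_linear:
  assumes "c \<in> A" "q \<in> chart_dom c"
  shows "lift A c q (a *\<^sub>R e + b *\<^sub>R f) = tadd (tscale a (lift A c q e)) (tscale b (lift A c q f))"
proof
  fix c'
  show "lift A c q (a *\<^sub>R e + b *\<^sub>R f) c' = tadd (tscale a (lift A c q e)) (tscale b (lift A c q f)) c'"
  proof (cases "c' \<in> A \<and> q \<in> chart_dom c'")
    case True
    then have "linear (frechet_derivative (chart_map c' \<circ> chart_inv c) (at (chart_map c q)))"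
      using transition_has_derivative assms has_derivative_linear by blast
    then show ?thesis
      using assms by (simp add: lift_component tadd_def tscale_def linear_add linear_cmul)
  qed (use assms in \<open>auto simp: lift_component tadd_def tscale_def\<close>)
qed

lemma lift_add: "c \<in> A \<Longrightarrow> q \<in> chart_dom c \<Longrightarrow> lift A c q (e + f) = tadd (lift A c q e) (lift A c q f)"
  using lift_linear[of c q 1 e 1 f] by (simp add: tadd_def tscale_def)

lemma lift_scale: "c \<in> A \<Longrightarrow> q \<in> chart_dom c \<Longrightarrow> lift A c q (a *\<^sub>R e) = tscale a (lift A c q e)"
  using lift_linear[of c q a e 0 e] by (simp add: tadd_def tscale_def)

lemma ex_chart: "\<exists>c\<in>A. q \<in> chart_dom c"
  using atlas unfolding smooth_atlas_def by blast

lemma chart_at: "chart_at A q \<in> A" "q \<in> chart_dom (chart_at A q)"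
  unfolding chart_at_def using someI_ex[of "\<lambda>c. c \<in> A \<and> q \<in> chart_dom c"] ex_chart[of q] by blast+

lemma tangent_tadd: "v \<in> tangent A q \<Longrightarrow> w \<in> tangent A q \<Longrightarrow> tadd v w \<in> tangent A q"
  by (metis chart_at lift_add lift_tangent tangent_eq_lift)

lemma tangent_tscale: "v \<in> tangent A q \<Longrightarrow> tscale a v \<in> tangent A q"
  by (metis chart_at lift_scale lift_tangent tangent_eq_lift)

text \<open>In another chart \<open>c'\<close> the component of the field is the differential of the
  transition map applied to \<open>X\<close>, taken at the point transported back to
  \<open>c\<close>. Transition maps are of every order, so no derivative of \<open>X\<close> is
  lost.\<close>

lemma Ck_section_chart_field:
  assumes c: "c \<in> A" and U: "open U" "U \<subseteq> chart_dom c"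
    and X: "Ck_on k (chart_map c ` U) X"
    and E: "\<And>q. q \<in> U \<Longrightarrow> chart_field A c X q \<in> E q"
  shows "Ck_section A E k U (chart_field A c X)"
  unfolding Ck_section_def
proof (intro conjI ballI)
  fix c' assume c': "c' \<in> A"
  let ?S = "chart_map c ` (U \<inter> chart_dom c')" and ?S' = "chart_map c' ` (U \<inter> chart_dom c')"
  have open_S: "open ?S"
    using open_chart_image[OF c open_Int[OF U(1) open_dom[OF c']]] U(2)
    by (simp add: Int_absorb2 le_infI1)
  have open_S': "open ?S'"
    using open_chart_image[OF c' U(1)] .
  have "Ck_on k ?S (\<lambda>z. frechet_derivative (chart_map c' \<circ> chart_inv c) (at z) (X z))"
    by (rule Ck_on_dir_derivative[OF open_S Ck_on_subset[OF Ck_transition[OF c c']] Ck_on_subset[OF X]])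
      (use U in auto)
  moreover have "(chart_map c \<circ> chart_inv c') ` ?S' \<subseteq> ?S"
    using inv_map[OF c'] U by auto
  moreover have "Ck_on k ?S' (chart_map c \<circ> chart_inv c')"
    by (rule Ck_on_subset[OF Ck_transition[OF c' c]]) (use U in auto)
  ultimately have "Ck_on k ?S' (\<lambda>x. frechet_derivative (chart_map c' \<circ> chart_inv c)
      (at ((chart_map c \<circ> chart_inv c') x)) (X ((chart_map c \<circ> chart_inv c') x)))"
    using Ck_on_compose[OF open_S', where f = "chart_map c \<circ> chart_inv c'"] by blast
  moreover have "frechet_derivative (chart_map c' \<circ> chart_inv c)
      (at ((chart_map c \<circ> chart_inv c') x)) (X ((chart_map c \<circ> chart_inv c') x)) =
      chart_field A c X (chart_inv c' x) c'" if "x \<in> ?S'" for x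
    using that U c c' inv_map[OF c'] by (auto simp: chart_field_def lift_component)
  ultimately show "Ck_on k ?S' (\<lambda>x. chart_field A c X (chart_inv c' x) c')"
    using Ck_on_cong[OF open_S', of "\<lambda>x. frechet_derivative (chart_map c' \<circ> chart_inv c)
      (at ((chart_map c \<circ> chart_inv c') x)) (X ((chart_map c \<circ> chart_inv c') x))"
      "\<lambda>x. chart_field A c X (chart_inv c' x) c'" k] by simp
qed (use E in auto)

lemma chart_field_tangent: "c \<in> A \<Longrightarrow> q \<in> chart_dom c \<Longrightarrow> chart_field A c X q \<in> tangent A q"
  by (simp add: chart_field_def lift_tangent)

lemma Ck_funI:
  assumes c: "c \<in> A" and U: "open U" "U \<subseteq> chart_dom c"
    and f: "Ck_on k (chart_map c ` U) (f \<circ> chart_inv c)"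
  shows "Ck_fun A k U f"
  unfolding Ck_fun_def
proof
  fix c' assume c': "c' \<in> A"
  let ?S' = "chart_map c' ` (U \<inter> chart_dom c')"
  have open_S': "open ?S'"
    using open_chart_image[OF c' U(1)] .
  have "(chart_map c \<circ> chart_inv c') ` ?S' \<subseteq> chart_map c ` U"
    using inv_map[OF c'] U by auto
  moreover have "Ck_on k ?S' (chart_map c \<circ> chart_inv c')"
    by (rule Ck_on_subset[OF Ck_transition[OF c' c]]) (use U in auto)
  ultimately have "Ck_on k ?S' (\<lambda>x. (f \<circ> chart_inv c) ((chart_map c \<circ> chart_inv c') x))"
    using Ck_on_compose[OF open_S', where f = "chart_map c \<circ> chart_inv c'"] f by blast
  moreover have "(f \<circ> chart_inv c) ((chart_map c \<circ> chart_inv c') x) = (f \<circ> chart_inv c') x" if "x \<in> ?S'" for x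
    using that U inv_map[OF c] inv_map[OF c'] by auto
  ultimately show "Ck_on k ?S' (f \<circ> chart_inv c')"
    using Ck_on_cong[OF open_S', of "\<lambda>x. (f \<circ> chart_inv c) ((chart_map c \<circ> chart_inv c') x)"
        "f \<circ> chart_inv c'" k] by simp
qed

lemma Ck_funD:
  assumes "Ck_fun A k U f" "c \<in> A" "U' \<subseteq> U" "U' \<subseteq> chart_dom c"
  shows "Ck_on k (chart_map c ` U') (f \<circ> chart_inv c)"
  using assms unfolding Ck_fun_def by (blast intro: Ck_on_subset)

text \<open>Chain rule: the change of the derivative of \<open>f\<close> from
  \<open>chart_at A q\<close> to \<open>c\<close> is compensated by the transformation law for the
  components of \<open>v\<close>.\<close>

lemma differential_in_chart:
  assumes f: "Ck_fun A (Suc k) U f" and q: "q \<in> U" and c: "c \<in> A" "q \<in> chart_dom c"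
    and v: "v \<in> tangent A q"
  shows "differential A f q v = frechet_derivative (f \<circ> chart_inv c) (at (chart_map c q)) (v c)"
proof -
  let ?c = "chart_at A q"
  have "((f \<circ> chart_inv c) has_derivative frechet_derivative (f \<circ> chart_inv c) (at (chart_map c q))) (at (chart_map c q))"
    by (rule Ck_on_has_derivative[of "Suc k"]) (use f q c in \<open>auto simp: Ck_fun_def simp del: Ck_on.simps\<close>)
  from derivative_in_charts[OF chart_at(1) c(1) chart_at(2) c(2) this]
  have "frechet_derivative (f \<circ> chart_inv ?c) (at (chart_map ?c q)) (v ?c) =
      frechet_derivative (f \<circ> chart_inv c) (at (chart_map c q))
        (frechet_derivative (chart_map c \<circ> chart_inv ?c) (at (chart_map ?c q)) (v ?c))"
    by (simp add: frechet_derivative_eqI)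
  then show ?thesis
    using tangent_component[OF v chart_at(1) c(1) chart_at(2) c(2)]
    by (simp add: differential_def Let_def)
qed

section \<open>Densities under a change of chart\<close>

lemma density_change_of_chart:
  assumes "smooth_positive_density A \<rho>" "c \<in> A" "c' \<in> A" "q \<in> chart_dom c" "q \<in> chart_dom c'"
  shows "\<rho> c (chart_map c q) = \<rho> c' (chart_map c' q) *
      \<bar>det (matrix (frechet_derivative (chart_map c' \<circ> chart_inv c) (at (chart_map c q))))\<bar>"
proof -
  have "\<forall>c\<in>A. \<forall>c'\<in>A. \<forall>q\<in>chart_dom c \<inter> chart_dom c'. \<rho> c (chart_map c q) = \<rho> c' (chart_map c' q) *
      \<bar>det (matrix (frechet_derivative (chart_map c' \<circ> chart_inv c) (at (chart_map c q))))\<bar>"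
    using assms(1) unfolding smooth_positive_density_def by (rule conjunct2)
  then show ?thesis using assms(2-5) by blast
qed

lemma Ck_density: "smooth_positive_density A \<rho> \<Longrightarrow> c \<in> A \<Longrightarrow> Ck_on k (chart_ran c) (\<rho> c)"
  and density_pos: "smooth_positive_density A \<rho> \<Longrightarrow> c \<in> A \<Longrightarrow> x \<in> chart_ran c \<Longrightarrow> \<rho> c x > 0"
  unfolding smooth_positive_density_def by blast+

text \<open>The Jacobian determinant by which the coefficient of the density changes is the one by
  which the determinant of the three component vectors changes, in the opposite direction.\<close>

lemma density_eval_in_chart:
  assumes \<rho>: "smooth_positive_density A \<rho>" and c: "c \<in> A" "q \<in> chart_dom c"
    and v: "v1 \<in> tangent A q" "v2 \<in> tangent A q" "v3 \<in> tangent A q"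
  shows "density_eval A \<rho> q v1 v2 v3 = \<rho> c (chart_map c q) * \<bar>det (vector [v1 c, v2 c, v3 c] :: real^3^3)\<bar>"
proof -
  let ?c = "chart_at A q"
  let ?D = "frechet_derivative (chart_map c \<circ> chart_inv ?c) (at (chart_map ?c q))"
  have w: "w c = ?D (w ?c)" if "w \<in> tangent A q" for w
    by (rule tangent_component[OF that chart_at(1) c(1) chart_at(2) c(2)])
  have "det (vector [v1 c, v2 c, v3 c] :: real^3^3) =
      det (vector [v1 ?c, v2 ?c, v3 ?c] :: real^3^3) * det (matrix ?D)"
    unfolding w[OF v(1)] w[OF v(2)] w[OF v(3)]
    by (rule det_vector_image[OF has_derivative_linear[OF
        transition_has_derivative[OF chart_at(1) c(1) chart_at(2) c(2)]]])
  moreover have "\<rho> ?c (chart_map ?c q) = \<rho> c (chart_map c q) * \<bar>det (matrix ?D)\<bar>"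
    by (rule density_change_of_chart[OF \<rho> chart_at(1) c(1) chart_at(2) c(2)])
  ultimately show ?thesis
    unfolding density_eval_def Let_def by (simp only: abs_mult mult.assoc mult.commute mult.left_commute)
qed

end

section \<open>The divergence in charts\<close>

lemma trace_matrix: "trace (matrix f) = (\<Sum>i\<in>UNIV. f (axis i 1) $ i)" for f :: "real^'n \<Rightarrow> real^'n"
  by (simp add: trace_def matrix_def)

lemma matrix_real_compose:
  fixes f :: "real^'n \<Rightarrow> real^'m" and g :: "real^'m \<Rightarrow> real^'k"
  assumes "linear f" "linear g"
  shows "matrix (\<lambda>x. g (f x)) = matrix g ** matrix f"
proof -
  have "matrix (\<lambda>x. g (f x)) *v x = (matrix g ** matrix f) *v x" for x
    using matrix_real_works[of f] matrix_real_works[of g] matrix_real_works[OF linear_compose[OF assms, unfolded o_def]] assms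
    by (simp add: matrix_vector_mul_assoc[symmetric])
  then show ?thesis by (simp add: matrix_eq)
qed

lemma matrix_ident: "matrix (\<lambda>x. x :: real^'n) = mat 1"
  using matrix_id_mat_1 by (simp add: id_def)

lemma has_derivative_matrix:
  fixes f :: "'a::real_normed_vector \<Rightarrow> real^'n \<Rightarrow> real^'m"
  assumes "\<And>u. ((\<lambda>x. f x u) has_derivative f' u) (at x)"
  shows "((\<lambda>x. matrix (f x)) has_derivative (\<lambda>h. matrix (\<lambda>u. f' u h))) (at x)"
  unfolding has_derivative_componentwise_within[of "\<lambda>x. matrix (f x)"]
  using bounded_linear.has_derivative[OF bounded_linear_vec_nth assms]
  by (auto simp: Basis_vec_def inner_axis matrix_def)

lemma has_derivative_abs_real:
  fixes f :: "'a::real_normed_vector \<Rightarrow> real"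
  assumes "(f has_derivative f') (at x)" "f x \<noteq> 0"
  shows "((\<lambda>x. \<bar>f x\<bar>) has_derivative (\<lambda>h. f' h * sgn (f x))) (at x)"
  using has_derivative_compose[OF assms(1) has_derivative_norm[OF assms(2)]] by simp

text \<open>Product rule for the pairing of the differential of \<open>\<Phi>\<close> with the
  moving vector \<open>Z\<close>. Expanding \<open>Z\<close> in the basis requires the second
  derivative \<open>B u h\<close> to be linear in the inner direction \<open>u\<close>; linearity in
  \<open>h\<close> is clear, and symmetry carries it over to \<open>u\<close>.\<close>

lemma has_derivative_dir_derivative:
  fixes \<Phi> :: "'a::euclidean_space \<Rightarrow> 'b::euclidean_space"
  assumes O: "open S" "x \<in> S" and \<Phi>: "Ck_on 2 S \<Phi>" and Z: "(Z has_derivative DZ) (at x)"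
  shows "((\<lambda>y. frechet_derivative \<Phi> (at y) (Z y)) has_derivative
      (\<lambda>h. frechet_derivative (\<lambda>y. frechet_derivative \<Phi> (at y) (Z x)) (at x) h +
           frechet_derivative \<Phi> (at x) (DZ h))) (at x)"
proof -
  define B where "B = (\<lambda>u. frechet_derivative (\<lambda>y. frechet_derivative \<Phi> (at y) u) (at x))"
  have lin: "linear (frechet_derivative \<Phi> (at y))" if "y \<in> S" for y
    using Ck_on_differentiable[OF \<Phi> _ that] linear_frechet_derivative by auto
  have C1: "Ck_on 1 S (\<lambda>y. frechet_derivative \<Phi> (at y) u)" for u
    using \<Phi> by (simp add: numeral_2_eq_2)
  have B: "((\<lambda>y. frechet_derivative \<Phi> (at y) u) has_derivative B u) (at x)" for u
    unfolding B_def using Ck_on_has_derivative[OF C1] O(2) by simp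
  have B_sym: "B u v = B v u" for u v
    unfolding B_def by (rule second_derivative_symmetric[OF O \<Phi>])
  have "linear (\<lambda>u. B u h)" for h
    using has_derivative_linear[OF B[of h]] B_sym[of _ h] by simp
  then have B_expand: "B u h = (\<Sum>b\<in>Basis. (u \<bullet> b) *\<^sub>R B b h)" for u h
    by (rule linear_euclidean_expand)
  have "((\<lambda>y. \<Sum>b\<in>Basis. (Z y \<bullet> b) *\<^sub>R frechet_derivative \<Phi> (at y) b) has_derivative
      (\<lambda>h. \<Sum>b\<in>Basis. (Z x \<bullet> b) *\<^sub>R B b h + (DZ h \<bullet> b) *\<^sub>R frechet_derivative \<Phi> (at x) b)) (at x)"
    by (intro has_derivative_sum has_derivative_scaleR has_derivative_inner_left Z B)
  moreover have "(\<Sum>b\<in>Basis. (Z x \<bullet> b) *\<^sub>R B b h + (DZ h \<bullet> b) *\<^sub>R frechet_derivative \<Phi> (at x) b) =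
      B (Z x) h + frechet_derivative \<Phi> (at x) (DZ h)" for h
    using B_expand[of "Z x" h] linear_euclidean_expand[OF lin[OF O(2)], of "DZ h"]
    by (simp add: sum.distrib)
  ultimately have "((\<lambda>y. \<Sum>b\<in>Basis. (Z y \<bullet> b) *\<^sub>R frechet_derivative \<Phi> (at y) b) has_derivative
      (\<lambda>h. B (Z x) h + frechet_derivative \<Phi> (at x) (DZ h))) (at x)" by simp
  then have "((\<lambda>y. frechet_derivative \<Phi> (at y) (Z y)) has_derivative
      (\<lambda>h. B (Z x) h + frechet_derivative \<Phi> (at x) (DZ h))) (at x)"
    by (rule has_derivative_transform_within_open[OF _ O])
      (rule linear_euclidean_expand[OF lin, symmetric])
  then show ?thesis by (simp add: B_def)
qed

context atlas
begin

text \<open>The second derivatives of the transition map enter the divergence of the field and the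
  derivative of the density with opposite signs, by Jacobi's formula for the derivative of \<open>det\<close>.\<close>

lemma lie_derivative_density_change_of_chart:
  assumes \<rho>: "smooth_positive_density A \<rho>" and c: "c \<in> A" "c' \<in> A" "q \<in> chart_dom c" "q \<in> chart_dom c'"
    and N: "open N" "q \<in> N" "\<And>x. x \<in> N \<Longrightarrow> X x \<in> tangent A x"
    and X: "(\<lambda>x. X (chart_inv c x) c) differentiable at (chart_map c q)"
  shows "lie_derivative_density \<rho> X c (chart_map c q) / \<rho> c (chart_map c q) =
    lie_derivative_density \<rho> X c' (chart_map c' q) / \<rho> c' (chart_map c' q)"
proof -
  define \<Phi> where "\<Phi> = chart_map c' \<circ> chart_inv c"
  define \<Psi> where "\<Psi> = chart_map c \<circ> chart_inv c'"
  define M where "M = N \<inter> chart_dom c \<inter> chart_dom c'"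
  have oM: "open M" unfolding M_def by (intro open_Int N(1) open_dom c)
  have M: "M \<inter> chart_dom c = M" "M \<inter> chart_dom c' = M" by (auto simp: M_def)
  have O: "open (chart_map c ` M)" by (rule open_chart_image[OF c(1) oM, unfolded M(1)])
  have O': "open (chart_map c' ` M)" by (rule open_chart_image[OF c(2) oM, unfolded M(2)])
  define x where "x = chart_map c q"
  define x' where "x' = chart_map c' q"
  have qM: "q \<in> M" using c N by (simp add: M_def)
  have x: "x \<in> chart_map c ` M" "x' \<in> chart_map c' ` M" using qM by (auto simp: x_def x'_def)
  have \<Phi>x: "\<Phi> x = x'" "\<Psi> x' = x"
    using inv_map[OF c(1,3)] inv_map[OF c(2,4)] by (simp_all add: \<Phi>_def \<Psi>_def x_def x'_def)
  have C\<Phi>: "Ck_on 2 (chart_map c ` M) \<Phi>"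
    unfolding \<Phi>_def by (rule Ck_on_subset[OF Ck_transition[OF c(1,2)]]) (auto simp: M_def)
  define D where "D = frechet_derivative \<Phi> (at x)"
  define D' where "D' = frechet_derivative \<Psi> (at x')"
  have D: "(\<Phi> has_derivative D) (at x)" and D': "(\<Psi> has_derivative D') (at x')"
    using transition_has_derivative[OF c] transition_has_derivative[OF c(2,1,4,3)]
    by (simp_all add: D_def D'_def \<Phi>_def \<Psi>_def x_def x'_def)
  have linD: "linear D" "linear D'" using D D' has_derivative_linear by blast+
  have DD': "D (D' v) = v" "D' (D v) = v" for v
    using transition_derivative_compose[OF c(2,1,2,4,3,4), of v] transition_derivative_compose[OF c(1,2,1,3,4,3), of v]
      transition_derivative_same[OF c(1,3), of v] transition_derivative_same[OF c(2,4), of v]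
    by (simp_all add: D_def D'_def \<Phi>_def \<Psi>_def x_def x'_def)
  define Z where "Z = (\<lambda>x. X (chart_inv c x) c)"
  define Z' where "Z' = (\<lambda>x. X (chart_inv c' x) c')"
  define DZ where "DZ = frechet_derivative Z (at x)"
  have DZ: "(Z has_derivative DZ) (at x)"
    using X by (simp add: DZ_def Z_def x_def frechet_derivative_works[symmetric])
  \<comment> \<open>The second derivative of \<open>\<Phi>\<close> with one slot filled by
    \<open>Z x\<close>. It is the extra term created when the field, transported by the differential
    of \<open>\<Phi>\<close>, is differentiated.\<close>
  define B where "B = frechet_derivative (\<lambda>y. frechet_derivative \<Phi> (at y) (Z x)) (at x)"
  have "((\<lambda>y. frechet_derivative \<Phi> (at y) (Z y)) has_derivative (\<lambda>h. B h + D (DZ h))) (at x)"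
    unfolding B_def D_def by (rule has_derivative_dir_derivative[OF O x(1) C\<Phi> DZ])
  then have "((\<lambda>y. frechet_derivative \<Phi> (at y) (Z y)) has_derivative (\<lambda>h. B h + D (DZ h))) (at (\<Psi> x'))"
    by (simp add: \<Phi>x)
  from has_derivative_compose[OF D' this]
  have "((\<lambda>y. frechet_derivative \<Phi> (at (\<Psi> y)) (Z (\<Psi> y))) has_derivative (\<lambda>h. B (D' h) + D (DZ (D' h)))) (at x')" .
  then have DZ': "(Z' has_derivative (\<lambda>h. B (D' h) + D (DZ (D' h)))) (at x')"
  proof (rule has_derivative_transform_within_open[OF _ O' x(2)])
    fix y assume "y \<in> chart_map c' ` M"
    then obtain r where r: "r \<in> M" "y = chart_map c' r" by auto
    then have rc: "r \<in> chart_dom c" "r \<in> chart_dom c'" "r \<in> N" by (auto simp: M_def)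
    show "frechet_derivative \<Phi> (at (\<Psi> y)) (Z (\<Psi> y)) = Z' y"
      using tangent_component[OF N(3)[OF rc(3)] c(1,2) rc(1,2)] inv_map[OF c(1) rc(1)] inv_map[OF c(2) rc(2)]
      by (simp add: \<Phi>_def \<Psi>_def Z_def Z'_def r(2))
  qed
  have Z'x: "Z' x' = D (Z x)"
    using tangent_component[OF N(3)[OF N(2)] c] inv_map[OF c(1,3)] inv_map[OF c(2,4)]
    by (simp add: Z'_def Z_def D_def \<Phi>_def x_def x'_def)
  have linB: "linear B"
  proof -
    have "Ck_on 1 (chart_map c ` M) (\<lambda>y. frechet_derivative \<Phi> (at y) (Z x))"
      using C\<Phi> by (simp add: numeral_2_eq_2)
    from has_derivative_linear[OF Ck_on_has_derivative[OF this zero_less_one x(1)]]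
    show ?thesis by (simp only: B_def)
  qed
  have linDZ: "linear DZ" using DZ by (rule has_derivative_linear)
  have mD: "matrix D ** matrix D' = mat 1" "matrix D' ** matrix D = mat 1"
    using matrix_real_compose[OF linD(2,1)] matrix_real_compose[OF linD] by (simp_all add: DD' matrix_ident)
  \<comment> \<open>Conjugation by \<open>D\<close> preserves the trace of \<open>DZ\<close>. What
    remains is the contribution of the second derivatives of the transition map.\<close>
  have tr: "trace (matrix (\<lambda>h. B (D' h) + D (DZ (D' h)))) = trace (matrix D' ** matrix B) + trace (matrix DZ)"
  proof -
    have "matrix (\<lambda>h. B (D' h) + D (DZ (D' h))) = matrix (\<lambda>h. B (D' h)) + matrix (\<lambda>h. D (DZ (D' h)))"
      by (simp add: matrix_def vec_eq_iff)
    also have "\<dots> = matrix B ** matrix D' + matrix D ** (matrix DZ ** matrix D')"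
      using matrix_real_compose[OF linD(2) linB] matrix_real_compose[OF linD(2) linDZ]
        matrix_real_compose[OF linear_compose[OF linD(2) linDZ, unfolded o_def] linD(1)] by simp
    finally have "trace (matrix (\<lambda>h. B (D' h) + D (DZ (D' h)))) =
        trace (matrix B ** matrix D') + trace (matrix D ** (matrix DZ ** matrix D'))"
      by (simp add: trace_add)
    also have "trace (matrix D ** (matrix DZ ** matrix D')) = trace (matrix DZ ** (matrix D' ** matrix D))"
      by (subst trace_mul_sym) (simp only: matrix_mul_assoc)
    also have "trace (matrix B ** matrix D') = trace (matrix D' ** matrix B)"
      by (rule trace_mul_sym)
    finally show ?thesis by (simp only: mD(2) matrix_mul_rid)
  qed
  define J where "J = (\<lambda>y. matrix (frechet_derivative \<Phi> (at y)))"
  have J: "J x = matrix D" by (simp add: J_def D_def)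
  have detD: "det (matrix D) \<noteq> 0"
    using det_mul[of "matrix D" "matrix D'"] mD(1) by auto
  have "((\<lambda>y. frechet_derivative \<Phi> (at y) u) has_derivative
      frechet_derivative (\<lambda>y. frechet_derivative \<Phi> (at y) u) (at x)) (at x)" for u
  proof -
    have "Ck_on 1 (chart_map c ` M) (\<lambda>y. frechet_derivative \<Phi> (at y) u)"
      using C\<Phi> by (simp add: numeral_2_eq_2)
    from Ck_on_has_derivative[OF this zero_less_one x(1)] show ?thesis .
  qed
  from has_derivative_matrix[OF this]
  have "(J has_derivative (\<lambda>h. matrix (\<lambda>u. frechet_derivative (\<lambda>y. frechet_derivative \<Phi> (at y) u) (at x) h))) (at x)"
    by (simp add: J_def)
  note dJ0 = has_derivative_det3[OF this, unfolded J, OF mD(1)]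
  have ab: "\<bar>d\<bar> * t = d * t * sgn d" for d t :: real by (simp add: abs_sgn)
  from has_derivative_abs_real[OF dJ0, unfolded J, OF detD]
  have "((\<lambda>y. \<bar>det (J y)\<bar>) has_derivative (\<lambda>h. \<bar>det (matrix D)\<bar> * trace (matrix D' **
      matrix (\<lambda>u. frechet_derivative (\<lambda>y. frechet_derivative \<Phi> (at y) u) (at x) h)))) (at x)"
    by (simp only: J ab not_False_eq_True simp_thms)
  note dJ = this
  define R where "R = frechet_derivative (\<rho> c') (at x')"
  have R: "(\<rho> c' has_derivative R) (at (\<Phi> x))"
    unfolding R_def \<Phi>x
  proof (rule Ck_on_has_derivative)
    show "Ck_on 1 (chart_ran c') (\<rho> c')" by (rule Ck_density[OF \<rho> c(2)])
  qed (use c in \<open>auto simp: x'_def\<close>)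
  have "((\<lambda>y. \<rho> c' (\<Phi> y) * \<bar>det (J y)\<bar>) has_derivative (\<lambda>h. \<rho> c' (\<Phi> x) * (\<bar>det (matrix D)\<bar> * trace (matrix D' **
      matrix (\<lambda>u. frechet_derivative (\<lambda>y. frechet_derivative \<Phi> (at y) u) (at x) h))) + R (D h) * \<bar>det (J x)\<bar>)) (at x)"
    by (rule has_derivative_mult[OF has_derivative_compose[OF D R] dJ])
  then have "(\<rho> c has_derivative (\<lambda>h. \<rho> c' (\<Phi> x) * (\<bar>det (matrix D)\<bar> * trace (matrix D' **
      matrix (\<lambda>u. frechet_derivative (\<lambda>y. frechet_derivative \<Phi> (at y) u) (at x) h))) + R (D h) * \<bar>det (J x)\<bar>)) (at x)"
  proof (rule has_derivative_transform_within_open[OF _ O x(1)])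
    fix y assume "y \<in> chart_map c ` M"
    then obtain r where r: "r \<in> M" "y = chart_map c r" by auto
    then have rc: "r \<in> chart_dom c" "r \<in> chart_dom c'" by (auto simp: M_def)
    show "\<rho> c' (\<Phi> y) * \<bar>det (J y)\<bar> = \<rho> c y"
      using density_change_of_chart[OF \<rho> c(1,2) rc] inv_map[OF c(1) rc(1)] r(2)
      by (simp add: J_def \<Phi>_def)
  qed
  then have "frechet_derivative (\<rho> c) (at x) (Z x) = \<rho> c' x' * (\<bar>det (matrix D)\<bar> * trace (matrix D' **
      matrix (\<lambda>u. frechet_derivative (\<lambda>y. frechet_derivative \<Phi> (at y) u) (at x) (Z x)))) + R (D (Z x)) * \<bar>det (matrix D)\<bar>"
    by (simp add: frechet_derivative_eqI \<Phi>x J)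
  \<comment> \<open>Jacobi's formula differentiates the columns \<open>u\<close> of the Jacobian in
    direction \<open>Z x\<close>, whereas \<open>B\<close> has \<open>Z x\<close> in the inner slot.
    Symmetry exchanges the two, and the trace becomes the one found in \<open>tr\<close>.\<close>
  also have "(\<lambda>u. frechet_derivative (\<lambda>y. frechet_derivative \<Phi> (at y) u) (at x) (Z x)) = B"
    unfolding B_def by (rule ext) (rule second_derivative_symmetric[OF O x(1) C\<Phi>])
  finally have d\<rho>: "frechet_derivative (\<rho> c) (at x) (Z x) = \<bar>det (matrix D)\<bar> * (\<rho> c' x' * trace (matrix D' ** matrix B) + R (Z' x'))"
    by (simp add: Z'x algebra_simps)
  have \<rho>x: "\<rho> c x = \<rho> c' x' * \<bar>det (matrix D)\<bar>"
    using density_change_of_chart[OF \<rho> c] by (simp add: x_def x'_def D_def \<Phi>_def)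
  have "lie_derivative_density \<rho> X c x = frechet_derivative (\<rho> c) (at x) (Z x) + \<rho> c x * trace (matrix DZ)"
    by (simp add: lie_derivative_density_def Z_def DZ_def trace_matrix)
  moreover have "lie_derivative_density \<rho> X c' x' = R (Z' x') + \<rho> c' x' * trace (matrix (\<lambda>h. B (D' h) + D (DZ (D' h))))"
    using frechet_derivative_eqI[OF DZ'] by (simp add: lie_derivative_density_def Z'_def R_def trace_matrix)
  ultimately have "lie_derivative_density \<rho> X c x = \<bar>det (matrix D)\<bar> * lie_derivative_density \<rho> X c' x'"
    by (simp add: tr d\<rho> \<rho>x algebra_simps)
  then show ?thesis using detD \<rho>x by (simp add: x_def x'_def)
qed

lemma divergence_in_chart:
  assumes \<rho>: "smooth_positive_density A \<rho>" and c: "c \<in> A" "q \<in> chart_dom c"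
    and N: "open N" "q \<in> N" "\<And>x. x \<in> N \<Longrightarrow> X x \<in> tangent A x"
    and X: "(\<lambda>x. X (chart_inv c x) c) differentiable at (chart_map c q)"
  shows "divergence A \<rho> X q = lie_derivative_density \<rho> X c (chart_map c q) / \<rho> c (chart_map c q)"
  using lie_derivative_density_change_of_chart[OF \<rho> c(1) chart_at(1) c(2) chart_at(2) N X]
  by (simp add: divergence_def Let_def)

end

section \<open>Orthonormal frames of the distribution\<close>

text \<open>Stated for any ordering of the axes, so that whichever coordinate vector the form does
  not annihilate at the base point can be placed last.\<close>

lemma axis3_basis:
  fixes i j k :: 3
  assumes "{i, j, k} = UNIV"
  shows "\<forall>v :: real^3. \<exists>s t r. v = s *\<^sub>R axis i 1 + t *\<^sub>R axis j 1 + r *\<^sub>R axis k 1"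
    and "\<forall>s t r. s *\<^sub>R axis i (1::real) + t *\<^sub>R axis j 1 + r *\<^sub>R axis k 1 = 0 \<longrightarrow> s = 0 \<and> t = 0"
proof -
  have "card {i, j, k} = 3" using assms by simp
  then have ne: "i \<noteq> j" "i \<noteq> k" "j \<noteq> k" by (auto simp: card_insert_if split: if_splits)
  have all: "P i \<and> P j \<and> P k \<Longrightarrow> P l" for P and l :: 3
    using UNIV_I[of l] unfolding assms[symmetric] by auto
  show "\<forall>v :: real^3. \<exists>s t r. v = s *\<^sub>R axis i 1 + t *\<^sub>R axis j 1 + r *\<^sub>R axis k 1"
  proof
    fix v :: "real^3"
    have "v $ l = ((v $ i) *\<^sub>R axis i 1 + (v $ j) *\<^sub>R axis j 1 + (v $ k) *\<^sub>R axis k 1) $ l" for l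
      by (rule all) (use ne in \<open>simp add: axis_def\<close>)
    then show "\<exists>s t r. v = s *\<^sub>R axis i 1 + t *\<^sub>R axis j 1 + r *\<^sub>R axis k 1"
      unfolding vec_eq_iff by blast
  qed
  show "\<forall>s t r. s *\<^sub>R axis i (1::real) + t *\<^sub>R axis j 1 + r *\<^sub>R axis k 1 = 0 \<longrightarrow> s = 0 \<and> t = 0"
  proof (intro allI impI)
    fix s t r :: real
    assume "s *\<^sub>R axis i (1::real) + t *\<^sub>R axis j 1 + r *\<^sub>R axis k 1 = 0"
    then have "(s *\<^sub>R axis i (1::real) + t *\<^sub>R axis j 1 + r *\<^sub>R axis k 1) $ l = 0" for l by simp
    from this[of i] this[of j] show "s = 0 \<and> t = 0" using ne by (simp add: axis_def)
  qed
qed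

locale sub_riemannian = atlas A
  for A :: "'m::topological_space chart set" +
  fixes \<omega> :: "'m \<Rightarrow> 'm tvec \<Rightarrow> real"
    and g :: "'m \<Rightarrow> 'm tvec \<Rightarrow> 'm tvec \<Rightarrow> real"
  assumes one_form: "smooth_one_form A \<omega>"
    and nonvanishing: "\<exists>v\<in>tangent A q. \<omega> q v \<noteq> 0"
    and metric: "smooth_metric_on A (distribution A \<omega>) g"
begin

lemma one_form_linear: "v \<in> tangent A q \<Longrightarrow> w \<in> tangent A q \<Longrightarrow>
    \<omega> q (tadd (tscale a v) (tscale b w)) = a * \<omega> q v + b * \<omega> q w"
  using one_form unfolding smooth_one_form_def tlinear_on_def by blast

lemma one_form_lift_linear: "c \<in> A \<Longrightarrow> q \<in> chart_dom c \<Longrightarrow>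
    \<omega> q (lift A c q (a *\<^sub>R e + b *\<^sub>R f)) = a * \<omega> q (lift A c q e) + b * \<omega> q (lift A c q f)"
  by (simp add: lift_linear lift_tangent one_form_linear)

lemma Ck_one_form_lift:
  assumes c: "c \<in> A"
  shows "Ck_on k (chart_ran c) (\<lambda>x. \<omega> (chart_inv c x) (lift A c (chart_inv c x) e))"
proof -
  have "smooth_section A (tangent A) (chart_dom c) (chart_field A c (\<lambda>_. e))"
    unfolding smooth_section_def
    by (intro allI Ck_section_chart_field[OF c open_dom[OF c] order_refl] Ck_on_const chart_field_tangent[OF c])
  then have "Ck_fun A k (chart_dom c) (\<lambda>q. \<omega> q (chart_field A c (\<lambda>_. e) q))"
    using one_form open_dom[OF c] unfolding smooth_one_form_def by blast
  from Ck_funD[OF this c order_refl order_refl] show ?thesis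
    by (simp add: o_def chart_field_def)
qed

lemma distribution_tangent: "v \<in> distribution A \<omega> q \<Longrightarrow> v \<in> tangent A q"
  by (simp add: distribution_def)

lemma distribution_combination: "v \<in> distribution A \<omega> q \<Longrightarrow> w \<in> distribution A \<omega> q \<Longrightarrow>
    tadd (tscale a v) (tscale b w) \<in> distribution A \<omega> q"
  by (simp add: distribution_def one_form_linear tangent_tadd tangent_tscale)

lemma lift_distribution_iff: "c \<in> A \<Longrightarrow> q \<in> chart_dom c \<Longrightarrow>
    lift A c q e \<in> distribution A \<omega> q \<longleftrightarrow> \<omega> q (lift A c q e) = 0"
  by (simp add: distribution_def lift_tangent)

lemma metric_linear_right:
  assumes "v \<in> distribution A \<omega> q" "w1 \<in> distribution A \<omega> q" "w2 \<in> distribution A \<omega> q"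
  shows "g q v (tadd (tscale a w1) (tscale b w2)) = a * g q v w1 + b * g q v w2"
proof -
  have "tlinear_on (distribution A \<omega> q) (g q v)"
    by (rule bspec[OF spec[OF conjunct1[OF metric[unfolded smooth_metric_on_def]]] assms(1)])
  from this[unfolded tlinear_on_def, rule_format, OF assms(2,3)] show ?thesis .
qed

lemma metric_sym: "v \<in> distribution A \<omega> q \<Longrightarrow> w \<in> distribution A \<omega> q \<Longrightarrow> g q v w = g q w v"
  and metric_pos: "v \<in> distribution A \<omega> q \<Longrightarrow> v \<noteq> (\<lambda>c. 0) \<Longrightarrow> g q v v > 0"
proof -
  note m = metric[unfolded smooth_metric_on_def]
  show "v \<in> distribution A \<omega> q \<Longrightarrow> w \<in> distribution A \<omega> q \<Longrightarrow> g q v w = g q w v"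
    by (rule bspec[OF bspec[OF spec[OF conjunct1[OF conjunct2[OF m]]]]])
  show "v \<in> distribution A \<omega> q \<Longrightarrow> v \<noteq> (\<lambda>c. 0) \<Longrightarrow> g q v v > 0"
    by (rule mp[OF bspec[OF spec[OF conjunct1[OF conjunct2[OF conjunct2[OF m]]]]]])
qed

lemma metric_linear_left:
  assumes "v \<in> distribution A \<omega> q" "w1 \<in> distribution A \<omega> q" "w2 \<in> distribution A \<omega> q"
  shows "g q (tadd (tscale a w1) (tscale b w2)) v = a * g q w1 v + b * g q w2 v"
  by (simp only: metric_sym[OF distribution_combination[OF assms(2,3)] assms(1)] metric_linear_right[OF assms]
    metric_sym[OF assms(1,2)] metric_sym[OF assms(1,3)])

text \<open>With \<open>\<omega>(b) \<noteq> 0\<close> at \<open>p\<close>, the fields \<open>\<omega>(b) v\<^sub>i - \<omega>(v\<^sub>i) b\<close> span \<open>ker \<omega>\<close> near \<open>p\<close>.\<close>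

lemma ex_frame_of_distribution:
  assumes c: "c \<in> A" "p \<in> chart_dom c"
  obtains U V1 V2 where "open U" "p \<in> U" "U \<subseteq> chart_dom c"
    "\<And>k. Ck_on k (chart_map c ` U) V1" "\<And>k. Ck_on k (chart_map c ` U) V2"
    "\<And>q. q \<in> U \<Longrightarrow> chart_field A c V1 q \<in> distribution A \<omega> q"
    "\<And>q. q \<in> U \<Longrightarrow> chart_field A c V2 q \<in> distribution A \<omega> q"
    "\<And>q v. q \<in> U \<Longrightarrow> v \<in> distribution A \<omega> q \<Longrightarrow>
       \<exists>s t. v c = s *\<^sub>R V1 (chart_map c q) + t *\<^sub>R V2 (chart_map c q)"
    "\<And>q s t. q \<in> U \<Longrightarrow> s *\<^sub>R V1 (chart_map c q) + t *\<^sub>R V2 (chart_map c q) = 0 \<Longrightarrow> s = 0 \<and> t = 0"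
proof -
  define \<alpha> where "\<alpha> = (\<lambda>x e. \<omega> (chart_inv c x) (lift A c (chart_inv c x) e))"
  have \<alpha>_C: "Ck_on k (chart_ran c) (\<lambda>x. \<alpha> x e)" for k e
    unfolding \<alpha>_def by (rule Ck_one_form_lift[OF c(1)])
  have \<alpha>_map: "\<alpha> (chart_map c q) e = \<omega> q (lift A c q e)" if "q \<in> chart_dom c" for q e
    by (simp add: \<alpha>_def inv_map[OF c(1) that])
  have \<alpha>_lin: "\<alpha> x (a *\<^sub>R e + b *\<^sub>R f) = a * \<alpha> x e + b * \<alpha> x f" if "x \<in> chart_ran c" for x a b e f
    unfolding \<alpha>_def by (rule one_form_lift_linear[OF c(1) inv_in_dom[OF c(1) that]])
  have \<alpha>_lin3: "\<alpha> x (s *\<^sub>R e1 + t *\<^sub>R e2 + r *\<^sub>R e3) = s * \<alpha> x e1 + t * \<alpha> x e2 + r * \<alpha> x e3"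
    if "x \<in> chart_ran c" for x s t r e1 e2 e3
    using \<alpha>_lin[OF that, of 1 "s *\<^sub>R e1 + t *\<^sub>R e2" r e3] \<alpha>_lin[OF that, of s e1 t e2] by simp
  obtain v where v: "v \<in> tangent A p" "\<omega> p v \<noteq> 0" using nonvanishing by blast
  define x0 where "x0 = chart_map c p"
  have x0: "x0 \<in> chart_ran c" using c by (simp add: x0_def)
  have "\<alpha> x0 (v c) \<noteq> 0"
    using v tangent_eq_lift[OF v(1) c] by (simp add: x0_def \<alpha>_map[OF c(2)])
  moreover have "v c = (v c $ 1) *\<^sub>R axis 1 1 + (v c $ 2) *\<^sub>R axis 2 1 + (v c $ 3) *\<^sub>R axis 3 1"
    by (simp add: vec_eq_iff forall_3 axis_def)
  ultimately have "\<alpha> x0 (axis 1 1) \<noteq> 0 \<or> \<alpha> x0 (axis 2 1) \<noteq> 0 \<or> \<alpha> x0 (axis 3 1) \<noteq> 0"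
    using \<alpha>_lin3[OF x0] by (metis add_0 mult_zero_right)
  then have "\<exists>v1 v2 b :: real^3. \<alpha> x0 b \<noteq> 0 \<and> (\<forall>v. \<exists>s t r. v = s *\<^sub>R v1 + t *\<^sub>R v2 + r *\<^sub>R b) \<and>
      (\<forall>s t r. s *\<^sub>R v1 + t *\<^sub>R v2 + r *\<^sub>R b = 0 \<longrightarrow> s = 0 \<and> t = 0)"
  proof (elim disjE)
    assume "\<alpha> x0 (axis 1 1) \<noteq> 0"
    then show ?thesis by (intro exI conjI) (assumption, rule axis3_basis[of 2 3 1], use UNIV_3 in blast, rule axis3_basis[of 2 3 1], use UNIV_3 in blast)
  next
    assume "\<alpha> x0 (axis 2 1) \<noteq> 0"
    then show ?thesis by (intro exI conjI) (assumption, rule axis3_basis[of 1 3 2], use UNIV_3 in blast, rule axis3_basis[of 1 3 2], use UNIV_3 in blast)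
  next
    assume "\<alpha> x0 (axis 3 1) \<noteq> 0"
    then show ?thesis by (intro exI conjI) (assumption, rule axis3_basis[of 1 2 3], use UNIV_3 in blast, rule axis3_basis[of 1 2 3], use UNIV_3 in blast)
  qed
  then obtain v1 v2 b :: "real^3" where b: "\<alpha> x0 b \<noteq> 0"
    and sp: "\<And>v. \<exists>s t r. v = s *\<^sub>R v1 + t *\<^sub>R v2 + r *\<^sub>R b"
    and ind: "\<And>s t r. s *\<^sub>R v1 + t *\<^sub>R v2 + r *\<^sub>R b = 0 \<Longrightarrow> s = 0 \<and> t = 0" by blast
  define S where "S = (\<lambda>x. \<alpha> x b) -` (- {0}) \<inter> chart_ran c"
  have "open S"
    unfolding S_def using continuous_on_open_vimage[OF open_ran[OF c(1)]] Ck_on_continuous[OF \<alpha>_C[of 0 b]]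
    by (metis open_Compl closed_singleton)
  then have S: "open S" "S \<subseteq> chart_ran c" "x0 \<in> S" using x0 b by (auto simp: S_def)
  define U where "U = chart_map c -` S \<inter> chart_dom c"
  have U: "open U" "U \<subseteq> chart_dom c" "p \<in> U" "chart_map c ` U = S"
    using continuous_on_open_vimage[OF open_dom[OF c(1)]] continuous_map[OF c(1)] S c
    unfolding U_def x0_def by (blast, blast, blast, auto)
  define V where "V = (\<lambda>v x. \<alpha> x b *\<^sub>R v - \<alpha> x v *\<^sub>R b)"
  have V_C: "Ck_on k S (V v)" for k v
    unfolding V_def by (intro Ck_on_diff Ck_on_scaleR Ck_on_const Ck_on_subset[OF \<alpha>_C] S)
  have V_D: "chart_field A c (V v) q \<in> distribution A \<omega> q" if "q \<in> U" for q v
  proof -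
    have q: "q \<in> chart_dom c" "chart_map c q \<in> chart_ran c" using that U by auto
    have "\<alpha> (chart_map c q) (V v (chart_map c q)) = 0"
      unfolding V_def using \<alpha>_lin[OF q(2), of "\<alpha> (chart_map c q) b" v "- \<alpha> (chart_map c q) v" b] by simp
    then show ?thesis
      using lift_distribution_iff[OF c(1) q(1)] \<alpha>_map[OF q(1)] by (simp add: chart_field_def)
  qed
  have V_sum: "s *\<^sub>R V v1 x + t *\<^sub>R V v2 x =
     (s * \<alpha> x b) *\<^sub>R v1 + (t * \<alpha> x b) *\<^sub>R v2 + (- s * \<alpha> x v1 - t * \<alpha> x v2) *\<^sub>R b" for s t x
    by (simp add: V_def algebra_simps)
  have V_sp: "\<exists>s t. v c = s *\<^sub>R V v1 (chart_map c q) + t *\<^sub>R V v2 (chart_map c q)"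
    if q: "q \<in> U" and v: "v \<in> distribution A \<omega> q" for q v
  proof -
    let ?x = "chart_map c q"
    have x: "q \<in> chart_dom c" "?x \<in> chart_ran c" "\<alpha> ?x b \<noteq> 0" using q U(2) by (auto simp: U_def S_def)
    obtain s t r where str: "v c = s *\<^sub>R v1 + t *\<^sub>R v2 + r *\<^sub>R b" using sp by blast
    have "\<alpha> ?x (v c) = 0"
      using v tangent_eq_lift[OF distribution_tangent[OF v] c(1) x(1)] by (simp add: \<alpha>_map[OF x(1)] distribution_def)
    then have "s * \<alpha> ?x v1 + t * \<alpha> ?x v2 + r * \<alpha> ?x b = 0"
      using \<alpha>_lin3[OF x(2)] str by simp
    \<comment> \<open>As the form vanishes on \<open>v\<close>, the coefficient of \<open>b\<close>
      is determined by the other two, and it is the one produced by the fields \<open>V v1\<close>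
      and \<open>V v2\<close>.\<close>
    then have "r = - (s / \<alpha> ?x b) * \<alpha> ?x v1 - (t / \<alpha> ?x b) * \<alpha> ?x v2"
      using x(3) by (simp add: field_simps add_eq_0_iff)
    then have "v c = (s / \<alpha> ?x b) *\<^sub>R V v1 ?x + (t / \<alpha> ?x b) *\<^sub>R V v2 ?x"
      unfolding V_sum str using x(3) by simp
    then show ?thesis by blast
  qed
  have V_ind: "s = 0 \<and> t = 0" if q: "q \<in> U" and 0: "s *\<^sub>R V v1 (chart_map c q) + t *\<^sub>R V v2 (chart_map c q) = 0" for q s t
    using ind[OF 0[unfolded V_sum]] q by (auto simp: U_def S_def)
  show thesis
    by (rule that[of U "V v1" "V v2"]) (use U(1,2,3) V_D V_sp V_ind in \<open>simp_all only: U(4) V_C\<close>)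
qed

end

text \<open>The frame is kept as a pair of coordinate functions on the image of \<open>U\<close>, to
  which calculus on \<open>real^3\<close> applies directly; \<open>chart_field\<close> turns them
  into sections of the distribution.\<close>

locale framed_chart = sub_riemannian A \<omega> g
  for A :: "'m::topological_space chart set" and \<omega> g +
  fixes c :: "'m chart" and U :: "'m set" and X1 X2 :: "real^3 \<Rightarrow> real^3"
  assumes c: "c \<in> A" and open_U: "open U" and U_dom: "U \<subseteq> chart_dom c"
    and Ck_frame: "Ck_on k (chart_map c ` U) X1" "Ck_on k (chart_map c ` U) X2"
    and frame_distribution: "q \<in> U \<Longrightarrow> chart_field A c X1 q \<in> distribution A \<omega> q"
      "q \<in> U \<Longrightarrow> chart_field A c X2 q \<in> distribution A \<omega> q"
    and frame_span: "q \<in> U \<Longrightarrow> v \<in> distribution A \<omega> q \<Longrightarrow>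
      \<exists>s t. v c = s *\<^sub>R X1 (chart_map c q) + t *\<^sub>R X2 (chart_map c q)"
    and orthonormal: "q \<in> U \<Longrightarrow> g q (chart_field A c X1 q) (chart_field A c X1 q) = 1"
      "q \<in> U \<Longrightarrow> g q (chart_field A c X2 q) (chart_field A c X2 q) = 1"
      "q \<in> U \<Longrightarrow> g q (chart_field A c X1 q) (chart_field A c X2 q) = 0"

text \<open>Gram-Schmidt applied to \<open>V1\<close>, \<open>V2\<close> with Gram matrix entries
  \<open>h11\<close>, \<open>h12\<close>, \<open>h22\<close>. The second vector is
  \<open>h11 V2 - h12 V1\<close>, orthogonal to \<open>V1\<close>; its squared length is
  \<open>d\<close>, that is \<open>h11\<close> times the Gram determinant, which is positive because
  the vector does not vanish.\<close>

lemma (in sub_riemannian) ex_framed_chart: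
  assumes c: "c \<in> A" "p \<in> chart_dom c"
  shows "\<exists>U X1 X2. framed_chart A \<omega> g c U X1 X2 \<and> p \<in> U"
proof (rule ex_frame_of_distribution[OF c])
  fix U V1 V2
  assume U: "open U" "p \<in> U" "U \<subseteq> chart_dom c"
    and C: "\<And>k. Ck_on k (chart_map c ` U) V1" "\<And>k. Ck_on k (chart_map c ` U) V2"
    and D: "\<And>q. q \<in> U \<Longrightarrow> chart_field A c V1 q \<in> distribution A \<omega> q"
       "\<And>q. q \<in> U \<Longrightarrow> chart_field A c V2 q \<in> distribution A \<omega> q"
    and sp: "\<And>q v. q \<in> U \<Longrightarrow> v \<in> distribution A \<omega> q \<Longrightarrow>
       \<exists>s t. v c = s *\<^sub>R V1 (chart_map c q) + t *\<^sub>R V2 (chart_map c q)"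
    and ind: "\<And>q s t. q \<in> U \<Longrightarrow> s *\<^sub>R V1 (chart_map c q) + t *\<^sub>R V2 (chart_map c q) = 0 \<Longrightarrow> s = 0 \<and> t = 0"
  let ?S = "chart_map c ` U"
  have S: "open ?S" using open_chart_image[OF c(1) U(1)] U(3) by (simp add: Int_absorb2)
  define h where "h = (\<lambda>V W x. g (chart_inv c x) (chart_field A c V (chart_inv c x)) (chart_field A c W (chart_inv c x)))"
  have sect: "smooth_section A (distribution A \<omega>) U (chart_field A c V1)"
     "smooth_section A (distribution A \<omega>) U (chart_field A c V2)"
    unfolding smooth_section_def by (intro allI Ck_section_chart_field[OF c(1) U(1,3)] C D; assumption)+
  have h_C: "Ck_on k ?S (h V W)" if "smooth_section A (distribution A \<omega>) U (chart_field A c V)"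
    "smooth_section A (distribution A \<omega>) U (chart_field A c W)" for k V W
  proof -
    have "Ck_fun A k U (\<lambda>q. g q (chart_field A c V q) (chart_field A c W q))"
      using conjunct2[OF conjunct2[OF conjunct2[OF metric[unfolded smooth_metric_on_def]]],
          rule_format, OF conjI[OF U(1) conjI[OF that]]] .
    from Ck_funD[OF this c(1) order_refl U(3)] show ?thesis by (simp add: o_def h_def)
  qed
  have h_map: "h V W (chart_map c q) = g q (chart_field A c V q) (chart_field A c W q)" if "q \<in> U" for q V W
    using inv_map[OF c(1)] that U(3) by (auto simp: h_def)
  define h11 where "h11 = h V1 V1"
  define h12 where "h12 = h V1 V2"
  define h22 where "h22 = h V2 V2"
  define d where "d = (\<lambda>x. h11 x * (h11 x * h22 x - h12 x * h12 x))"
  have hC: "Ck_on k ?S h11" "Ck_on k ?S h12" "Ck_on k ?S h22" for k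
    using h_C sect by (auto simp: h11_def h12_def h22_def)
  have comb: "chart_field A c (\<lambda>x. s x *\<^sub>R V1 x + t x *\<^sub>R V2 x) q =
     tadd (tscale (s (chart_map c q)) (chart_field A c V1 q)) (tscale (t (chart_map c q)) (chart_field A c V2 q))"
    if "q \<in> U" for s t q
    using that U(3) c(1) by (auto simp: chart_field_def lift_linear)
  have g_comb: "g q (chart_field A c (\<lambda>x. s x *\<^sub>R V1 x + t x *\<^sub>R V2 x) q) (chart_field A c (\<lambda>x. s' x *\<^sub>R V1 x + t' x *\<^sub>R V2 x) q)
     = (let x = chart_map c q in s x * s' x * h11 x + (s x * t' x + t x * s' x) * h12 x + t x * t' x * h22 x)"
    if q: "q \<in> U" for s t s' t' q
    unfolding comb[OF q] Let_def h11_def h12_def h22_def h_map[OF q]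
    using D[OF q] metric_sym[OF D(2)[OF q] D(1)[OF q]]
    by (simp add: metric_linear_left metric_linear_right distribution_combination algebra_simps)
  have pos: "g q (chart_field A c (\<lambda>x. s x *\<^sub>R V1 x + t x *\<^sub>R V2 x) q) (chart_field A c (\<lambda>x. s x *\<^sub>R V1 x + t x *\<^sub>R V2 x) q) > 0"
    if q: "q \<in> U" and "s (chart_map c q) \<noteq> 0 \<or> t (chart_map c q) \<noteq> 0" for s t q
  proof (rule metric_pos)
    show "chart_field A c (\<lambda>x. s x *\<^sub>R V1 x + t x *\<^sub>R V2 x) q \<in> distribution A \<omega> q"
      unfolding comb[OF q] using D[OF q] by (rule distribution_combination)
    have "chart_field A c (\<lambda>x. s x *\<^sub>R V1 x + t x *\<^sub>R V2 x) q c \<noteq> 0"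
      using ind[OF q] that(2) q U(3) c(1) by (auto simp: chart_field_def)
    then show "chart_field A c (\<lambda>x. s x *\<^sub>R V1 x + t x *\<^sub>R V2 x) q \<noteq> (\<lambda>c. 0)" by metis
  qed
  have h11: "h11 x > 0" if "x \<in> ?S" for x
    using that pos[of _ "\<lambda>_. 1" "\<lambda>_. 0"] g_comb[of _ "\<lambda>_. 1" "\<lambda>_. 0" "\<lambda>_. 1" "\<lambda>_. 0"] by auto
  have d: "d x > 0" if x: "x \<in> ?S" for x
  proof -
    obtain q where q: "q \<in> U" "x = chart_map c q" using x by auto
    have "0 < - h12 x * (- h12 x) * h11 x + (- h12 x * h11 x + h11 x * (- h12 x)) * h12 x + h11 x * h11 x * h22 x"
      using pos[OF q(1), of "\<lambda>x. - h12 x" "h11"] h11[OF x]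
      unfolding g_comb[OF q(1)] Let_def q(2)[symmetric] by simp
    also have "\<dots> = d x" by (simp add: d_def algebra_simps)
    finally show ?thesis .
  qed
  \<comment> \<open>The summand with coefficient 0 gives \<open>X1\<close> the shape to which
    \<open>comb\<close> and \<open>g_comb\<close> apply.\<close>
  define X1 where "X1 = (\<lambda>x. inverse (sqrt (h11 x)) *\<^sub>R V1 x + 0 *\<^sub>R V2 x)"
  define X2 where "X2 = (\<lambda>x. (- h12 x * inverse (sqrt (d x))) *\<^sub>R V1 x + (h11 x * inverse (sqrt (d x))) *\<^sub>R V2 x)"
  have dC: "Ck_on k ?S d" for k
    unfolding d_def by (intro Ck_on_mult Ck_on_diff hC S)
  have isC: "Ck_on k ?S (\<lambda>x. inverse (sqrt (d x)))" "Ck_on k ?S (\<lambda>x. inverse (sqrt (h11 x)))" for k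
    using d h11 by (force intro!: Ck_on_inverse Ck_on_sqrt dC hC S)+
  have X_C: "Ck_on k ?S X1" "Ck_on k ?S X2" for k
    unfolding X1_def X2_def by (intro Ck_on_add Ck_on_scaleR Ck_on_mult Ck_on_uminus Ck_on_const isC hC C S)+
  have XD: "chart_field A c X1 q \<in> distribution A \<omega> q" "chart_field A c X2 q \<in> distribution A \<omega> q" if q: "q \<in> U" for q
    unfolding X1_def X2_def comb[OF q] using D[OF q] by (blast intro: distribution_combination)+
  have "framed_chart A \<omega> g c U X1 X2"
  proof unfold_locales
    fix q v assume q: "q \<in> U" and v: "v \<in> distribution A \<omega> q"
    let ?x = "chart_map c q"
    have x: "h11 ?x > 0" "d ?x > 0" using h11 d q by auto
    obtain s t where "v c = s *\<^sub>R V1 ?x + t *\<^sub>R V2 ?x" using sp[OF q v] by blast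
    also have "\<dots> = (sqrt (h11 ?x) * (s + t * h12 ?x / h11 ?x)) *\<^sub>R X1 ?x + (t * sqrt (d ?x) / h11 ?x) *\<^sub>R X2 ?x"
    proof -
      have i: "sqrt (d ?x) * (z * inverse (sqrt (d ?x))) = z" for z
        using x by (simp add: field_simps)
      have "sqrt (h11 ?x) *\<^sub>R X1 ?x = V1 ?x" "sqrt (d ?x) *\<^sub>R X2 ?x = (- h12 ?x) *\<^sub>R V1 ?x + h11 ?x *\<^sub>R V2 ?x"
        using x by (simp_all add: i X1_def X2_def scaleR_add_right scaleR_diff_right)
      then have "(s + t * h12 ?x / h11 ?x) *\<^sub>R (sqrt (h11 ?x) *\<^sub>R X1 ?x) + (t / h11 ?x) *\<^sub>R (sqrt (d ?x) *\<^sub>R X2 ?x)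
          = s *\<^sub>R V1 ?x + t *\<^sub>R V2 ?x"
        using x by (simp add: scaleR_add_left scaleR_add_right scaleR_diff_right)
      then show ?thesis by (simp add: mult.commute)
    qed
    finally show "\<exists>s t. v c = s *\<^sub>R X1 ?x + t *\<^sub>R X2 ?x" by blast
  next
    fix q assume q: "q \<in> U"
    let ?x = "chart_map c q"
    have x: "h11 ?x > 0" "d ?x > 0" using h11 d q by auto
    show "g q (chart_field A c X1 q) (chart_field A c X1 q) = 1"
      unfolding X1_def g_comb[OF q] using x
      by (simp add: Let_def field_simps flip: power2_eq_square)
    show "g q (chart_field A c X1 q) (chart_field A c X2 q) = 0"
      unfolding X1_def X2_def g_comb[OF q] by (simp add: Let_def algebra_simps)
    let ?i = "inverse (sqrt (d ?x))"
    have "g q (chart_field A c X2 q) (chart_field A c X2 q) = ?i * ?i * d ?x"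
      unfolding X2_def g_comb[OF q] d_def by (simp add: Let_def algebra_simps)
    also have "\<dots> = 1" using x by (simp add: field_simps flip: power2_eq_square)
    finally show "g q (chart_field A c X2 q) (chart_field A c X2 q) = 1" .
  qed (use c U X_C XD in auto)
  then show ?thesis using U(2) by blast
qed

section \<open>Horizontal gradient, Hessian and normal in a frame\<close>

lemma (in atlas) Ck_section_cong:
  assumes U: "open U" and eq: "\<And>q. q \<in> U \<Longrightarrow> X q = Y q" and X: "Ck_section A E k U X"
  shows "Ck_section A E k U Y"
  unfolding Ck_section_def
proof (intro conjI ballI)
  show "Y q \<in> E q" if "q \<in> U" for q
    using bspec[OF conjunct1[OF X[unfolded Ck_section_def]] that] by (simp only: eq[OF that])
next
  fix c assume c: "c \<in> A"
  have "X (chart_inv c x) c = Y (chart_inv c x) c" if "x \<in> chart_map c ` (U \<inter> chart_dom c)" for x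
    using that eq inv_map[OF c] by auto
  from iffD1[OF Ck_on_cong[OF open_chart_image[OF c U] this] bspec[OF conjunct2[OF X[unfolded Ck_section_def]] c]]
  show "Ck_on k (chart_map c ` (U \<inter> chart_dom c)) (\<lambda>x. Y (chart_inv c x) c)" .
qed

lemma sum_linear_axis:
  fixes L :: "real^'n \<Rightarrow> real"
  assumes "linear L"
  shows "(\<Sum>i\<in>UNIV. L (axis i 1) * v $ i) = L v"
proof -
  have "v = (\<Sum>i\<in>UNIV. (v $ i) *\<^sub>R axis i 1)"
    using basis_expansion[of v, symmetric] by (simp only: scalar_mult_eq_scaleR)
  then have "L v = L (\<Sum>i\<in>UNIV. (v $ i) *\<^sub>R axis i 1)" by (rule arg_cong)
  then show ?thesis
    by (simp add: linear_sum[OF assms] linear_cmul[OF assms] mult.commute)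
qed

context framed_chart
begin

abbreviation "S \<equiv> chart_map c ` U"

text \<open>In coordinates, \<open>a1 u\<close> and \<open>a2 u\<close> are the derivatives \<open>X\<^sub>1 u\<close> and \<open>X\<^sub>2 u\<close>.\<close>

definition du :: "('m \<Rightarrow> real) \<Rightarrow> real^3 \<Rightarrow> real^3 \<Rightarrow> real" where
  "du u x = frechet_derivative (u \<circ> chart_inv c) (at x)"

definition a1 :: "('m \<Rightarrow> real) \<Rightarrow> real^3 \<Rightarrow> real" where "a1 u x = du u x (X1 x)"
definition a2 :: "('m \<Rightarrow> real) \<Rightarrow> real^3 \<Rightarrow> real" where "a2 u x = du u x (X2 x)"
definition W :: "('m \<Rightarrow> real) \<Rightarrow> real^3 \<Rightarrow> real" where "W u x = sqrt (a1 u x * a1 u x + a2 u x * a2 u x)"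

lemma open_coordinates: "open N \<Longrightarrow> N \<subseteq> U \<Longrightarrow> open (chart_map c ` N)"
  using open_chart_image[OF c, of N] Int_absorb2[OF subset_trans[OF _ U_dom], of N] by simp

lemma in_dom: "q \<in> U \<Longrightarrow> q \<in> chart_dom c"
  using U_dom by blast

lemma u_coordinates:
  assumes "Ck_fun A k N u" "N \<subseteq> U"
  shows "Ck_on k (chart_map c ` N) (u \<circ> chart_inv c)"
  by (rule Ck_funD[OF assms(1) c order_refl subset_trans[OF assms(2) U_dom]])

lemma du_has_derivative:
  assumes "Ck_fun A (Suc k) N u" "N \<subseteq> U" "x \<in> chart_map c ` N"
  shows "((u \<circ> chart_inv c) has_derivative du u x) (at x)"
  unfolding du_def using Ck_on_has_derivative[OF u_coordinates[OF assms(1,2)] _ assms(3)] by simp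

lemma linear_du:
  assumes "Ck_fun A (Suc k) N u" "N \<subseteq> U" "x \<in> chart_map c ` N"
  shows "linear (du u x)"
  using du_has_derivative[OF assms] by (rule has_derivative_linear)

lemma Ck_a:
  assumes "Ck_fun A (Suc k) N u" "open N" "N \<subseteq> U"
  shows "Ck_on k (chart_map c ` N) (a1 u)" "Ck_on k (chart_map c ` N) (a2 u)"
  unfolding a1_def[abs_def] a2_def[abs_def] du_def
  by (rule Ck_on_dir_derivative[OF open_coordinates[OF assms(2,3)] u_coordinates[OF assms(1,3)]
        Ck_on_subset[OF Ck_frame(1) image_mono[OF assms(3)]]],
      rule Ck_on_dir_derivative[OF open_coordinates[OF assms(2,3)] u_coordinates[OF assms(1,3)]
        Ck_on_subset[OF Ck_frame(2) image_mono[OF assms(3)]]])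

lemma differential_coordinates:
  assumes "Ck_fun A (Suc k) N u" "N \<subseteq> U" "q \<in> N" "v \<in> tangent A q"
  shows "differential A u q v = du u (chart_map c q) (v c)"
  unfolding du_def by (rule differential_in_chart[OF assms(1,3) c in_dom[OF subsetD[OF assms(2,3)]] assms(4)])

lemma chart_field_combination:
  "q \<in> U \<Longrightarrow> chart_field A c (\<lambda>x. s x *\<^sub>R X1 x + t x *\<^sub>R X2 x) q =
     tadd (tscale (s (chart_map c q)) (chart_field A c X1 q)) (tscale (t (chart_map c q)) (chart_field A c X2 q))"
  by (simp add: chart_field_def lift_linear[OF c in_dom])

lemma chart_field_component: "q \<in> U \<Longrightarrow> chart_field A c X q c = X (chart_map c q)"
  by (simp add: chart_field_def lift_same[OF c in_dom])

lemma distribution_eq_combination: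
  assumes "q \<in> U" "v \<in> distribution A \<omega> q"
  obtains s t where "v = tadd (tscale s (chart_field A c X1 q)) (tscale t (chart_field A c X2 q))"
    "v c = s *\<^sub>R X1 (chart_map c q) + t *\<^sub>R X2 (chart_map c q)"
proof -
  obtain s t where st: "v c = s *\<^sub>R X1 (chart_map c q) + t *\<^sub>R X2 (chart_map c q)"
    using frame_span[OF assms] by blast
  then have "v = tadd (tscale s (chart_field A c X1 q)) (tscale t (chart_field A c X2 q))"
    using tangent_eq_lift[OF distribution_tangent[OF assms(2)] c in_dom[OF assms(1)]]
    by (simp add: chart_field_def lift_linear[OF c in_dom[OF assms(1)]])
  then show thesis using st by (rule that)
qed

lemma metric_combination:
  assumes q: "q \<in> U"
  shows "g q (tadd (tscale s (chart_field A c X1 q)) (tscale t (chart_field A c X2 q)))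
    (tadd (tscale s' (chart_field A c X1 q)) (tscale t' (chart_field A c X2 q))) = s * s' + t * t'"
proof -
  have 1: "g q v (tadd (tscale s' (chart_field A c X1 q)) (tscale t' (chart_field A c X2 q))) =
      s' * g q v (chart_field A c X1 q) + t' * g q v (chart_field A c X2 q)" if "v \<in> distribution A \<omega> q" for v
    by (rule metric_linear_right[OF that frame_distribution[OF q]])
  have 2: "g q (chart_field A c X2 q) (chart_field A c X1 q) = 0"
    using metric_sym[OF frame_distribution(2)[OF q] frame_distribution(1)[OF q]] orthonormal(3)[OF q] by simp
  show ?thesis
    unfolding metric_linear_left[OF distribution_combination[OF frame_distribution[OF q]] frame_distribution[OF q]]
      1[OF frame_distribution(1)[OF q]] 1[OF frame_distribution(2)[OF q]]
    using orthonormal[OF q] 2 by simp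
qed

text \<open>In an orthonormal frame the coefficients of a horizontal vector are its products with
  \<open>X1\<close> and \<open>X2\<close>. This yields existence, and also the uniqueness demanded
  by the description operator in \<open>hgrad\<close>.\<close>

lemma hgrad_coordinates:
  assumes u: "Ck_fun A (Suc k) N u" and N: "N \<subseteq> U" and q: "q \<in> N"
  shows "hgrad A \<omega> g u q = chart_field A c (\<lambda>x. a1 u x *\<^sub>R X1 x + a2 u x *\<^sub>R X2 x) q"
proof -
  have qU: "q \<in> U" using N q by blast
  let ?x = "chart_map c q"
  let ?v = "tadd (tscale (a1 u ?x) (chart_field A c X1 q)) (tscale (a2 u ?x) (chart_field A c X2 q))"
  have v: "?v \<in> distribution A \<omega> q"
    by (rule distribution_combination[OF frame_distribution[OF qU]])
  have lin: "linear (du u ?x)" using linear_du[OF u N] q by blast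
  have d: "differential A u q w = s * a1 u ?x + t * a2 u ?x"
    if "w \<in> distribution A \<omega> q" "w c = s *\<^sub>R X1 ?x + t *\<^sub>R X2 ?x" for w s t
    using differential_coordinates[OF u N q distribution_tangent[OF that(1)]] that(2)
    by (simp add: linear_add[OF lin] linear_cmul[OF lin] a1_def a2_def)
  show ?thesis
    unfolding hgrad_def chart_field_combination[OF qU]
  proof (rule the_equality)
    show "?v \<in> distribution A \<omega> q \<and> (\<forall>w\<in>distribution A \<omega> q. g q ?v w = differential A u q w)"
    proof (intro conjI ballI v)
      fix w assume w: "w \<in> distribution A \<omega> q"
      obtain s t where st: "w = tadd (tscale s (chart_field A c X1 q)) (tscale t (chart_field A c X2 q))"
        "w c = s *\<^sub>R X1 ?x + t *\<^sub>R X2 ?x" by (rule distribution_eq_combination[OF qU w])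
      show "g q ?v w = differential A u q w"
        unfolding d[OF w st(2)] unfolding st(1) metric_combination[OF qU] by (simp add: mult.commute)
    qed
  next
    fix v assume *: "v \<in> distribution A \<omega> q \<and> (\<forall>w\<in>distribution A \<omega> q. g q v w = differential A u q w)"
    obtain s t where st: "v = tadd (tscale s (chart_field A c X1 q)) (tscale t (chart_field A c X2 q))"
      "v c = s *\<^sub>R X1 ?x + t *\<^sub>R X2 ?x" by (rule distribution_eq_combination[OF qU conjunct1[OF *]])
    have e: "tadd (tscale 1 (chart_field A c X1 q)) (tscale 0 (chart_field A c X2 q)) = chart_field A c X1 q"
      "tadd (tscale 0 (chart_field A c X1 q)) (tscale 1 (chart_field A c X2 q)) = chart_field A c X2 q"
      by (simp_all add: tadd_def tscale_def)
    have "g q v (chart_field A c X1 q) = s" "g q v (chart_field A c X2 q) = t"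
      unfolding st(1) using metric_combination[OF qU, of s t 1 0] metric_combination[OF qU, of s t 0 1] by (simp_all only: e)
    moreover have "g q v (chart_field A c X1 q) = a1 u ?x" "g q v (chart_field A c X2 q) = a2 u ?x"
      using * frame_distribution[OF qU] d[OF frame_distribution(1)[OF qU], of 1 0] d[OF frame_distribution(2)[OF qU], of 0 1]
      by (simp_all add: chart_field_component[OF qU])
    ultimately show "v = ?v" using st(1) by simp
  qed
qed

lemma hgrad_norm_coordinates:
  assumes u: "Ck_fun A (Suc k) N u" and N: "N \<subseteq> U" and q: "q \<in> N"
  shows "hgrad_norm A \<omega> g u q = W u (chart_map c q)"
proof -
  have qU: "q \<in> U" using N q by blast
  show ?thesis
    unfolding hgrad_norm_def hgrad_coordinates[OF assms] chart_field_combination[OF qU] metric_combination[OF qU] W_def ..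
qed

text \<open>By the Leibniz rule the covariant derivative of \<open>a1 X1 + a2 X2\<close> has terms
  with derivatives of the coefficients and terms with covariant derivatives of the frame. The latter
  carry the factors \<open>a1\<close> and \<open>a2\<close>, which vanish at \<open>q\<close>, so
  the connection disappears.\<close>

lemma hess_coordinates:
  assumes nab: "affine_connection A \<omega> nab" and u: "Ck_fun A 2 N u" and N: "open N" "N \<subseteq> U" and q: "q \<in> N"
    and char: "a1 u (chart_map c q) = 0" "a2 u (chart_map c q) = 0"
    and v: "v \<in> tangent A q" and w: "w \<in> distribution A \<omega> q"
  shows "hess_H A \<omega> g nab u q v w =
    frechet_derivative (a1 u) (at (chart_map c q)) (v c) * g q (chart_field A c X1 q) w +
    frechet_derivative (a2 u) (at (chart_map c q)) (v c) * g q (chart_field A c X2 q) w"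
proof -
  have qU: "q \<in> U" and N_dom: "N \<subseteq> chart_dom c" using N q U_dom by blast+
  have u': "Ck_fun A (Suc 1) N u" using u by (simp add: numeral_2_eq_2)
  let ?x = "chart_map c q"
  define f1 where "f1 = (\<lambda>q. a1 u (chart_map c q))"
  define f2 where "f2 = (\<lambda>q. a2 u (chart_map c q))"
  have coord: "Ck_on 1 (chart_map c ` N) ((\<lambda>q. a (chart_map c q)) \<circ> chart_inv c)" if "Ck_on 1 (chart_map c ` N) a"
    for a :: "real^3 \<Rightarrow> real"
  proof (rule iffD1[OF Ck_on_cong[OF open_coordinates[OF N]] that])
    show "a x = ((\<lambda>q. a (chart_map c q)) \<circ> chart_inv c) x" if "x \<in> chart_map c ` N" for x
      using that map_inv[OF c, of x] N_dom by auto
  qed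
  have f: "Ck_fun A 1 N f1" "Ck_fun A 1 N f2"
    unfolding f1_def f2_def
    by (rule Ck_funI[OF c N(1) N_dom] coord Ck_a[OF u' N])+
  have X: "Ck_section A (distribution A \<omega>) 1 N (chart_field A c X1)"
    "Ck_section A (distribution A \<omega>) 1 N (chart_field A c X2)"
    using N(2) frame_distribution
    by (intro Ck_section_chart_field[OF c N(1) N_dom] Ck_on_subset[OF Ck_frame(1)] Ck_on_subset[OF Ck_frame(2)]; blast)+
  have smult: "Ck_section A (distribution A \<omega>) 1 N (\<lambda>q. tscale (a (chart_map c q)) (chart_field A c Y q))"
    if "Ck_on 1 (chart_map c ` N) a" "\<And>k. Ck_on k (chart_map c ` N) Y" "\<And>q. q \<in> N \<Longrightarrow> chart_field A c Y q \<in> distribution A \<omega> q"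
    for a Y
  proof -
    have "Ck_section A (distribution A \<omega>) 1 N (chart_field A c (\<lambda>x. a x *\<^sub>R Y x))"
    proof (rule Ck_section_chart_field[OF c N(1) N_dom Ck_on_scaleR[OF open_coordinates[OF N] that(1,2)]])
      fix q assume "q \<in> N"
      then have "chart_field A c (\<lambda>x. a x *\<^sub>R Y x) q = tadd (tscale (a (chart_map c q)) (chart_field A c Y q)) (tscale 0 (chart_field A c Y q))"
        using N_dom lift_scale[OF c, of q] by (auto simp: chart_field_def tadd_def tscale_def)
      then show "chart_field A c (\<lambda>x. a x *\<^sub>R Y x) q \<in> distribution A \<omega> q"
        using distribution_combination that(3)[OF \<open>q \<in> N\<close>] by metis
    qed
    moreover have "chart_field A c (\<lambda>x. a x *\<^sub>R Y x) q = tscale (a (chart_map c q)) (chart_field A c Y q)" if "q \<in> N" for q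
      using that N_dom lift_scale[OF c, of q] by (auto simp: chart_field_def)
    ultimately show ?thesis by (rule Ck_section_cong[OF N(1), rotated])
  qed
  have fX: "Ck_section A (distribution A \<omega>) 1 N (\<lambda>q. tscale (f1 q) (chart_field A c X1 q))"
    "Ck_section A (distribution A \<omega>) 1 N (\<lambda>q. tscale (f2 q) (chart_field A c X2 q))"
    unfolding f1_def f2_def
    using smult[OF Ck_a(1)[OF u' N] Ck_on_subset[OF Ck_frame(1) image_mono[OF N(2)]]]
      smult[OF Ck_a(2)[OF u' N] Ck_on_subset[OF Ck_frame(2) image_mono[OF N(2)]]] frame_distribution N(2) by blast+
  define Y where "Y = (\<lambda>q. tadd (tscale (f1 q) (chart_field A c X1 q)) (tscale (f2 q) (chart_field A c X2 q)))"
  have Y: "Y x = hgrad A \<omega> g u x" if "x \<in> N" for x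
    using hgrad_coordinates[OF u' N(2) that] chart_field_combination[of x] that N(2)
    by (auto simp: Y_def f1_def f2_def)
  have C: "Ck_section A (distribution A \<omega>) 1 N (hgrad A \<omega> g u)"
  proof -
    have 1: "Ck_on 1 (chart_map c ` N) (\<lambda>x. a1 u x *\<^sub>R X1 x + a2 u x *\<^sub>R X2 x)"
      by (intro Ck_on_add Ck_on_scaleR open_coordinates N Ck_a[OF u' N] Ck_on_subset[OF Ck_frame(1) image_mono[OF N(2)]]
        Ck_on_subset[OF Ck_frame(2) image_mono[OF N(2)]])
    have 2: "Ck_section A (distribution A \<omega>) 1 N (chart_field A c (\<lambda>x. a1 u x *\<^sub>R X1 x + a2 u x *\<^sub>R X2 x))"
    proof (rule Ck_section_chart_field[OF c N(1) N_dom 1])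
      fix q assume "q \<in> N"
      then have "q \<in> U" using N by blast
      then show "chart_field A c (\<lambda>x. a1 u x *\<^sub>R X1 x + a2 u x *\<^sub>R X2 x) q \<in> distribution A \<omega> q"
        using chart_field_combination distribution_combination[OF frame_distribution] by simp
    qed
    show ?thesis
      by (rule Ck_section_cong[OF N(1) _ 2]) (rule hgrad_coordinates[OF u' N(2), symmetric])
  qed
  \<comment> \<open>The clauses of \<open>affine_connection\<close> concern total functions, while
    \<open>hgrad\<close> equals the frame combination \<open>Y\<close> only on \<open>N\<close>. The
    locality clause bridges this; additivity and the Leibniz rule then apply to
    \<open>Y\<close>.\<close>
  note conn = conjunct1[OF nab[unfolded affine_connection_def], rule_format]
  note local = conjunct2[OF conjunct2[OF conjunct2[OF conjunct2[OF conn[OF conjI[OF N(1) conjI[OF q C]]]]]], rule_format, OF v, of Y]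
  note add = conjunct1[OF conjunct2[OF conjunct2[OF conn[OF conjI[OF N(1) conjI[OF q fX(1)]]]]], rule_format, OF v fX(2)]
  note leibniz1 = conjunct1[OF conjunct2[OF conjunct2[OF conjunct2[OF conn[OF conjI[OF N(1) conjI[OF q X(1)]]]]]], rule_format, OF v f(1)]
  note leibniz2 = conjunct1[OF conjunct2[OF conjunct2[OF conjunct2[OF conn[OF conjI[OF N(1) conjI[OF q X(2)]]]]]], rule_format, OF v f(2)]
  have f0: "f1 q = 0" "f2 q = 0" using char by (simp_all add: f1_def f2_def)
  have df: "differential A (\<lambda>q. a (chart_map c q)) q v = frechet_derivative a (at ?x) (v c)"
    if "Ck_fun A 1 N (\<lambda>q. a (chart_map c q))" for a
  proof -
    have "Ck_fun A (Suc 0) N (\<lambda>q. a (chart_map c q))" using that by simp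
    from differential_in_chart[OF this q c in_dom[OF qU] v]
    have "differential A (\<lambda>q. a (chart_map c q)) q v =
        frechet_derivative ((\<lambda>q. a (chart_map c q)) \<circ> chart_inv c) (at ?x) (v c)" .
    also have "frechet_derivative ((\<lambda>q. a (chart_map c q)) \<circ> chart_inv c) (at ?x) = frechet_derivative a (at ?x)"
    proof (rule frechet_derivative_cong_open[OF open_ran[OF c]])
      show "?x \<in> chart_ran c" using in_dom[OF qU] by blast
      show "((\<lambda>q. a (chart_map c q)) \<circ> chart_inv c) y = a y" if "y \<in> chart_ran c" for y
        using map_inv[OF c that] by simp
    qed
    finally show ?thesis .
  qed
  have z: "tadd a (tscale 0 b) = a" for a b :: "'m tvec" by (simp add: tadd_def tscale_def)
  have "nab q v (hgrad A \<omega> g u) = nab q v Y" using local Y by simp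
  also have "\<dots> = tadd (nab q v (\<lambda>q. tscale (f1 q) (chart_field A c X1 q))) (nab q v (\<lambda>q. tscale (f2 q) (chart_field A c X2 q)))"
    unfolding Y_def by (rule add)
  also have "\<dots> = tadd (tscale (frechet_derivative (a1 u) (at ?x) (v c)) (chart_field A c X1 q))
      (tscale (frechet_derivative (a2 u) (at ?x) (v c)) (chart_field A c X2 q))"
    unfolding leibniz1 leibniz2 f0 z
    using df[OF f(1)[unfolded f1_def]] df[OF f(2)[unfolded f2_def]] by (simp add: f1_def f2_def)
  finally show ?thesis
    unfolding hess_H_def by (simp add: metric_linear_left[OF w frame_distribution[OF qU]])
qed

text \<open>Passing from the frame to \<open>e1\<close>, \<open>e2\<close> multiplies the
  determinant of the bilinear form by the square of the determinant \<open>s1 * t2 - t1 * s2\<close>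
  of the change of basis. A nonzero value for \<open>e1\<close>, \<open>e2\<close> thus forces a
  nonzero value for the frame.\<close>

lemma nondegenerate_coordinates:
  assumes nab: "affine_connection A \<omega> nab" and u: "Ck_fun A 2 N u" and N: "open N" "N \<subseteq> U" and q: "q \<in> N"
    and char: "a1 u (chart_map c q) = 0" "a2 u (chart_map c q) = 0"
    and e: "e1 \<in> distribution A \<omega> q" "e2 \<in> distribution A \<omega> q"
    and det: "det (vector [vector [hess_H A \<omega> g nab u q e1 e1, hess_H A \<omega> g nab u q e1 e2],
                     vector [hess_H A \<omega> g nab u q e2 e1, hess_H A \<omega> g nab u q e2 e2]]
               :: real^2^2) \<noteq> 0"
  defines "x \<equiv> chart_map c q"
  shows "frechet_derivative (a1 u) (at x) (X1 x) * frechet_derivative (a2 u) (at x) (X2 x) -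
    frechet_derivative (a1 u) (at x) (X2 x) * frechet_derivative (a2 u) (at x) (X1 x) \<noteq> 0"
proof -
  have qU: "q \<in> U" using N q by blast
  have u': "Ck_fun A (Suc 1) N u" using u by (simp add: numeral_2_eq_2)
  define A1 where "A1 = frechet_derivative (a1 u) (at x)"
  define A2 where "A2 = frechet_derivative (a2 u) (at x)"
  have x: "x \<in> chart_map c ` N" using q by (simp add: x_def)
  have lin: "linear A1" "linear A2"
    unfolding A1_def A2_def
    using has_derivative_linear[OF Ck_on_has_derivative[OF Ck_a(1)[OF u' N] zero_less_one x]]
      has_derivative_linear[OF Ck_on_has_derivative[OF Ck_a(2)[OF u' N] zero_less_one x]] by blast+
  obtain s1 t1 where e1: "e1 = tadd (tscale s1 (chart_field A c X1 q)) (tscale t1 (chart_field A c X2 q))"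
    "e1 c = s1 *\<^sub>R X1 (chart_map c q) + t1 *\<^sub>R X2 (chart_map c q)" by (rule distribution_eq_combination[OF qU e(1)])
  obtain s2 t2 where e2: "e2 = tadd (tscale s2 (chart_field A c X1 q)) (tscale t2 (chart_field A c X2 q))"
    "e2 c = s2 *\<^sub>R X1 (chart_map c q) + t2 *\<^sub>R X2 (chart_map c q)" by (rule distribution_eq_combination[OF qU e(2)])
  have gX: "g q (chart_field A c X1 q) (tadd (tscale s (chart_field A c X1 q)) (tscale t (chart_field A c X2 q))) = s"
    "g q (chart_field A c X2 q) (tadd (tscale s (chart_field A c X1 q)) (tscale t (chart_field A c X2 q))) = t" for s t
  proof -
    have "tadd (tscale 1 (chart_field A c X1 q)) (tscale 0 (chart_field A c X2 q)) = chart_field A c X1 q"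
      "tadd (tscale 0 (chart_field A c X1 q)) (tscale 1 (chart_field A c X2 q)) = chart_field A c X2 q"
      by (simp_all add: tadd_def tscale_def)
    with metric_combination[OF qU, of 1 0 s t] metric_combination[OF qU, of 0 1 s t]
    show "g q (chart_field A c X1 q) (tadd (tscale s (chart_field A c X1 q)) (tscale t (chart_field A c X2 q))) = s"
    "g q (chart_field A c X2 q) (tadd (tscale s (chart_field A c X1 q)) (tscale t (chart_field A c X2 q))) = t" by simp_all
  qed
  have H: "hess_H A \<omega> g nab u q v w = A1 (v c) * g q (chart_field A c X1 q) w + A2 (v c) * g q (chart_field A c X2 q) w"
    if "v \<in> distribution A \<omega> q" "w \<in> distribution A \<omega> q" for v w
    unfolding A1_def A2_def x_def
    by (rule hess_coordinates[OF nab u N q char distribution_tangent[OF that(1)] that(2)])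
  have g12: "g q (chart_field A c X1 q) e1 = s1" "g q (chart_field A c X2 q) e1 = t1"
    "g q (chart_field A c X1 q) e2 = s2" "g q (chart_field A c X2 q) e2 = t2"
    unfolding e1(1) e2(1) by (rule gX)+
  have "det (vector [vector [hess_H A \<omega> g nab u q e1 e1, hess_H A \<omega> g nab u q e1 e2],
                     vector [hess_H A \<omega> g nab u q e2 e1, hess_H A \<omega> g nab u q e2 e2]]
               :: real^2^2) = (s1 * t2 - t1 * s2)\<^sup>2 * (A1 (X1 x) * A2 (X2 x) - A1 (X2 x) * A2 (X1 x))"
    unfolding H[OF e(1,1)] H[OF e(1,2)] H[OF e(2,1)] H[OF e(2,2)] g12 e1(2) e2(2) x_def[symmetric]
    by (simp add: det_2 linear_add[OF lin(1)] linear_add[OF lin(2)] linear_cmul[OF lin(1)] linear_cmul[OF lin(2)]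
        power2_eq_square algebra_simps)
  then show ?thesis using det by (auto simp: A1_def A2_def)
qed

end

section \<open>Divergence of the normalized horizontal gradient\<close>

context framed_chart
begin

text \<open>The divergence, computed in the chart \<open>c\<close>, of the field with components
  \<open>X\<close>.\<close>

definition frame_div :: "('m chart \<Rightarrow> real^3 \<Rightarrow> real) \<Rightarrow> (real^3 \<Rightarrow> real^3) \<Rightarrow> real^3 \<Rightarrow> real" where
  "frame_div \<rho> X x = frechet_derivative (\<rho> c) (at x) (X x) / \<rho> c x + trace (matrix (frechet_derivative X (at x)))"

text \<open>The horizontal gradient turned by a right angle in the frame; the differential of
  \<open>u\<close> annihilates it.\<close>

definition tangent_dir :: "('m \<Rightarrow> real) \<Rightarrow> real^3 \<Rightarrow> real^3" where
  "tangent_dir u x = a1 u x *\<^sub>R X2 x - a2 u x *\<^sub>R X1 x"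

text \<open>With \<open>\<theta>\<close> a polar angle of \<open>(a1, a2)\<close>, the first
  fraction is the derivative of \<open>\<theta>\<close> along the unit vector
  \<open>tangent_dir / W\<close>. Only the direction of \<open>(a1, a2)\<close> along the surface
  enters, which makes a comparison of two defining functions possible.\<close>

definition normal_div :: "('m chart \<Rightarrow> real^3 \<Rightarrow> real) \<Rightarrow> ('m \<Rightarrow> real) \<Rightarrow> real^3 \<Rightarrow> real" where
  "normal_div \<rho> u x =
    (a1 u x * frechet_derivative (a2 u) (at x) (tangent_dir u x) -
     a2 u x * frechet_derivative (a1 u) (at x) (tangent_dir u x)) / W u x ^ 3 +
    (a1 u x * frame_div \<rho> X1 x + a2 u x * frame_div \<rho> X2 x) / W u x"

text \<open>Since \<open>(a\<^sub>1, a\<^sub>2) / W\<close> has length \<open>1\<close>, only its derivative in the direction of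
  \<open>- a\<^sub>2 X\<^sub>1 + a\<^sub>1 X\<^sub>2\<close> enters the divergence, and this direction is tangent to the level sets of \<open>u\<close>.\<close>

lemma divergence_normal:
  assumes \<rho>: "smooth_positive_density A \<rho>" and u: "Ck_fun A 2 N u" and N: "open N" "N \<subseteq> U" and q: "q \<in> N"
    and W0: "W u (chart_map c q) \<noteq> 0"
  shows "divergence A \<rho> (\<lambda>x. tscale (1 / hgrad_norm A \<omega> g u x) (hgrad A \<omega> g u x)) q = normal_div \<rho> u (chart_map c q)"
proof -
  have qU: "q \<in> U" using N q by blast
  have u': "Ck_fun A (Suc 1) N u" using u by (simp add: numeral_2_eq_2)
  let ?F = "\<lambda>x. tscale (1 / hgrad_norm A \<omega> g u x) (hgrad A \<omega> g u x)"
  define x where "x = chart_map c q"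
  have x: "x \<in> chart_map c ` N" "x \<in> S" using q qU by (simp_all add: x_def)
  have o: "open (chart_map c ` N)" by (rule open_coordinates[OF N])
  define A1 where "A1 = frechet_derivative (a1 u) (at x)"
  define A2 where "A2 = frechet_derivative (a2 u) (at x)"
  define Y1 where "Y1 = frechet_derivative X1 (at x)"
  define Y2 where "Y2 = frechet_derivative X2 (at x)"
  have dA: "(a1 u has_derivative A1) (at x)" "(a2 u has_derivative A2) (at x)"
    unfolding A1_def A2_def
    by (rule Ck_on_has_derivative[OF Ck_a(1)[OF u' N] zero_less_one x(1)])
      (rule Ck_on_has_derivative[OF Ck_a(2)[OF u' N] zero_less_one x(1)])
  have dX: "(X1 has_derivative Y1) (at x)" "(X2 has_derivative Y2) (at x)"
    unfolding Y1_def Y2_def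
    by (rule Ck_on_has_derivative[OF Ck_frame(1) zero_less_one x(2)])
      (rule Ck_on_has_derivative[OF Ck_frame(2) zero_less_one x(2)])
  define w where "w = W u x"
  have ww: "w * w = a1 u x * a1 u x + a2 u x * a2 u x" by (simp add: w_def W_def)
  have "w \<ge> 0" by (simp add: w_def W_def)
  then have "w > 0" using W0 by (simp add: w_def x_def)
  from mult_pos_pos[OF this this] have pos: "a1 u x * a1 u x + a2 u x * a2 u x > 0" by (simp only: ww)
  have dW: "(W u has_derivative (\<lambda>h. (a1 u x * A1 h + a2 u x * A2 h) / w)) (at x)"
  proof -
    have f: "((\<lambda>y. a1 u y * a1 u y + a2 u y * a2 u y) has_derivative
        (\<lambda>h. (a1 u x * A1 h + A1 h * a1 u x) + (a2 u x * A2 h + A2 h * a2 u x))) (at x)"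
      by (intro has_derivative_add has_derivative_mult dA)
    have "(sqrt has_derivative (*) (inverse (sqrt (a1 u x * a1 u x + a2 u x * a2 u x)) / 2))
        (at (a1 u x * a1 u x + a2 u x * a2 u x))"
      using DERIV_real_sqrt[OF pos] by (simp only: has_field_derivative_def)
    from has_derivative_compose[OF f this]
    have "(W u has_derivative (\<lambda>h. inverse w / 2 *
        ((a1 u x * A1 h + A1 h * a1 u x) + (a2 u x * A2 h + A2 h * a2 u x)))) (at x)"
      by (simp only: W_def[abs_def] w_def)
    moreover have "inverse w / 2 * ((a1 u x * A1 h + A1 h * a1 u x) + (a2 u x * A2 h + A2 h * a2 u x)) =
        (a1 u x * A1 h + a2 u x * A2 h) / w" for h
      using \<open>w > 0\<close> by (simp add: field_simps)
    ultimately show ?thesis by (simp only:)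
  qed
  define n1 where "n1 = (\<lambda>h. A1 h / w - a1 u x * (a1 u x * A1 h + a2 u x * A2 h) / w ^ 3)"
  define n2 where "n2 = (\<lambda>h. A2 h / w - a2 u x * (a1 u x * A1 h + a2 u x * A2 h) / w ^ 3)"
  have dn: "((\<lambda>y. a1 u y / W u y) has_derivative n1) (at x)" "((\<lambda>y. a2 u y / W u y) has_derivative n2) (at x)"
  proof -
    have "((\<lambda>y. a y / W u y) has_derivative
        (\<lambda>h. - a x * (inverse w * ((a1 u x * A1 h + a2 u x * A2 h) / w) * inverse w) + A h / w)) (at x)"
      if "(a has_derivative A) (at x)" for a A
      using has_derivative_divide[OF that dW] \<open>w > 0\<close> by (simp only: w_def)
    moreover have "- a * (inverse w * (b / w) * inverse w) + A / w = A / w - a * b / w ^ 3" for a b A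
      using \<open>w > 0\<close> by (simp add: field_simps power3_eq_cube)
    ultimately have "((\<lambda>y. a y / W u y) has_derivative
        (\<lambda>h. A h / w - a x * (a1 u x * A1 h + a2 u x * A2 h) / w ^ 3)) (at x)"
      if "(a has_derivative A) (at x)" for a A using that by (simp only:)
    then show "((\<lambda>y. a1 u y / W u y) has_derivative n1) (at x)" "((\<lambda>y. a2 u y / W u y) has_derivative n2) (at x)"
      unfolding n1_def n2_def using dA by blast+
  qed
  have dZ: "((\<lambda>y. (a1 u y / W u y) *\<^sub>R X1 y + (a2 u y / W u y) *\<^sub>R X2 y) has_derivative
      (\<lambda>h. ((a1 u x / W u x) *\<^sub>R Y1 h + n1 h *\<^sub>R X1 x) + ((a2 u x / W u x) *\<^sub>R Y2 h + n2 h *\<^sub>R X2 x))) (at x)"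
    by (intro has_derivative_add has_derivative_scaleR dn dX)
  have F: "?F (chart_inv c y) c = (a1 u y / W u y) *\<^sub>R X1 y + (a2 u y / W u y) *\<^sub>R X2 y"
    if y: "y \<in> chart_map c ` N" for y
  proof -
    obtain r where r: "r \<in> N" "y = chart_map c r" using y by blast
    then have "r \<in> U" using N by blast
    then show ?thesis
      by (simp only: r(2) inv_map[OF c in_dom[OF \<open>r \<in> U\<close>]] hgrad_coordinates[OF u' N(2) r(1)]
        hgrad_norm_coordinates[OF u' N(2) r(1)] tscale_def chart_field_component[OF \<open>r \<in> U\<close>]
        scaleR_add_right scaleR_scaleR times_divide_eq_left mult_1_left)
  qed
  have dF: "((\<lambda>y. ?F (chart_inv c y) c) has_derivative
      (\<lambda>h. ((a1 u x / W u x) *\<^sub>R Y1 h + n1 h *\<^sub>R X1 x) + ((a2 u x / W u x) *\<^sub>R Y2 h + n2 h *\<^sub>R X2 x))) (at x)"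
    by (rule has_derivative_transform_within_open[OF dZ o x(1) F[symmetric]])
  have F_tangent: "?F r \<in> tangent A r" if "r \<in> N" for r
    unfolding hgrad_coordinates[OF u' N(2) that]
    using that N(2) in_dom by (intro tangent_tscale chart_field_tangent c) blast
  have dif: "(\<lambda>y. ?F (chart_inv c y) c) differentiable at (chart_map c q)"
    using dF unfolding x_def differentiable_def by blast
  have lin: "linear A1" "linear A2" using dA has_derivative_linear by blast+
  then have lin': "linear n1" "linear n2"
    unfolding n1_def n2_def
    by (auto intro!: linearI simp: linear_add linear_cmul algebra_simps add_divide_distrib)
  have xr: "x \<in> chart_ran c" unfolding x_def by (rule imageI[OF in_dom[OF qU]])
  have \<rho>x: "\<rho> c x > 0" by (rule density_pos[OF \<rho> c xr])
  have lin\<rho>: "linear (frechet_derivative (\<rho> c) (at x))"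
    using has_derivative_linear[OF Ck_on_has_derivative[OF Ck_density[OF \<rho> c] zero_less_one xr]] .
  have tr: "(\<Sum>i\<in>UNIV. frechet_derivative (\<lambda>y. ?F (chart_inv c y) c) (at x) (axis i 1) $ i) =
      (a1 u x / w) * trace (matrix Y1) + n1 (X1 x) + ((a2 u x / w) * trace (matrix Y2) + n2 (X2 x))"
    unfolding frechet_derivative_eqI[OF dF] vector_add_component vector_scaleR_component sum.distrib
      sum_linear_axis[OF lin'(1)] sum_linear_axis[OF lin'(2)] trace_matrix
    by (simp add: sum_distrib_left w_def sum_linear_axis[OF lin'(1)] sum_linear_axis[OF lin'(2)])
  have d\<rho>: "frechet_derivative (\<rho> c) (at x) (?F (chart_inv c x) c) =
      a1 u x / w * frechet_derivative (\<rho> c) (at x) (X1 x) + a2 u x / w * frechet_derivative (\<rho> c) (at x) (X2 x)"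
    unfolding F[OF x(1)] by (simp add: linear_add[OF lin\<rho>] linear_cmul[OF lin\<rho>] w_def)
  have "divergence A \<rho> ?F q = lie_derivative_density \<rho> ?F c x / \<rho> c x"
    unfolding x_def by (rule divergence_in_chart[where X = ?F, OF \<rho> c in_dom[OF qU] N(1) q F_tangent dif])
  also have "\<dots> = a1 u x / w * frame_div \<rho> X1 x + a2 u x / w * frame_div \<rho> X2 x + (n1 (X1 x) + n2 (X2 x))"
    unfolding lie_derivative_density_def tr d\<rho> frame_div_def Y1_def[symmetric] Y2_def[symmetric]
    using \<rho>x \<open>w > 0\<close> by (simp add: field_simps)
  finally have "divergence A \<rho> ?F q = a1 u x / w * frame_div \<rho> X1 x + a2 u x / w * frame_div \<rho> X2 x + (n1 (X1 x) + n2 (X2 x))" .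
  moreover have "n1 (X1 x) + n2 (X2 x) = (a1 u x * A2 (tangent_dir u x) - a2 u x * A1 (tangent_dir u x)) / w ^ 3"
  proof -
    have "w ^ 3 * (n1 (X1 x) + n2 (X2 x)) = w * w * A1 (X1 x) - a1 u x * (a1 u x * A1 (X1 x) + a2 u x * A2 (X1 x))
       + (w * w * A2 (X2 x) - a2 u x * (a1 u x * A1 (X2 x) + a2 u x * A2 (X2 x)))"
      unfolding n1_def n2_def using \<open>w > 0\<close> by (simp add: field_simps power3_eq_cube)
    \<comment> \<open>Replacing \<open>w * w\<close> by the sum of squares cancels the pure squares.
      The \<open>X1\<close> part becomes \<open>a2 * (a2 * A1 - a1 * A2)\<close> at
      \<open>X1\<close>, the \<open>X2\<close> part \<open>a1 * (a1 * A2 - a2 * A1)\<close> at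
      \<open>X2\<close>, and together they are one functional evaluated at
      \<open>tangent_dir\<close>.\<close>
    also have "\<dots> = a1 u x * A2 (tangent_dir u x) - a2 u x * A1 (tangent_dir u x)"
      unfolding ww tangent_dir_def
      by (simp add: linear_diff[OF lin(1)] linear_diff[OF lin(2)] linear_cmul[OF lin(1)] linear_cmul[OF lin(2)] algebra_simps)
    finally show ?thesis using \<open>w > 0\<close> by (simp add: field_simps)
  qed
  ultimately show ?thesis
    unfolding normal_div_def x_def[symmetric] A1_def[symmetric] A2_def[symmetric] w_def[symmetric]
    by (simp add: add_divide_distrib)
qed

end

section \<open>Surfaces\<close>

lemma local_defining_function_mono:
  assumes "local_defining_function A \<Sigma> p N u" "open N'" "N' \<subseteq> N" "q \<in> N'"
  shows "local_defining_function A \<Sigma> q N' u"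
  using assms unfolding local_defining_function_def Ck_fun_def
  by (intro conjI ballI) (blast, blast, meson Ck_on_subset Int_mono image_mono order_refl, blast, blast)

context atlas
begin

lemma surface_param_coordinates:
  assumes \<psi>: "surface_param A \<Sigma> V \<psi>" and c: "c \<in> A"
  shows "open (V \<inter> \<psi> -` chart_dom c)" "Ck_on 2 (V \<inter> \<psi> -` chart_dom c) (chart_map c \<circ> \<psi>)"
    "y \<in> V \<Longrightarrow> \<psi> y \<in> chart_dom c \<Longrightarrow>
      ((chart_map c \<circ> \<psi>) has_derivative frechet_derivative (chart_map c \<circ> \<psi>) (at y)) (at y)"
    "y \<in> V \<Longrightarrow> \<psi> y \<in> chart_dom c \<Longrightarrow> inj (frechet_derivative (chart_map c \<circ> \<psi>) (at y))"
    "continuous_on V \<psi>"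
proof -
  show cont: "continuous_on V \<psi>"
    using \<psi> unfolding surface_param_def homeomorphism_def by blast
  have V: "open V" using \<psi> unfolding surface_param_def by blast
  show "open (V \<inter> \<psi> -` chart_dom c)"
    using continuous_on_open_vimage[OF V] cont open_dom[OF c] by (metis Int_commute)
  show C: "Ck_on 2 (V \<inter> \<psi> -` chart_dom c) (chart_map c \<circ> \<psi>)"
    using \<psi> c unfolding surface_param_def by blast
  show "((chart_map c \<circ> \<psi>) has_derivative frechet_derivative (chart_map c \<circ> \<psi>) (at y)) (at y)"
    if "y \<in> V" "\<psi> y \<in> chart_dom c"
    by (rule Ck_on_has_derivative[OF C]) (use that in auto)
  show "inj (frechet_derivative (chart_map c \<circ> \<psi>) (at y))" if "y \<in> V" "\<psi> y \<in> chart_dom c"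
    using \<psi> c that unfolding surface_param_def by blast
qed

lemma push_tangent:
  assumes \<psi>: "surface_param A \<Sigma> V \<psi>" and y: "y \<in> V"
  shows "push A \<psi> y e \<in> tangent A (\<psi> y)"
  unfolding tangent_def mem_Collect_eq
proof (intro conjI ballI allI impI)
  fix c c' assume c: "c \<in> A" "c' \<in> A" "\<psi> y \<in> chart_dom c \<inter> chart_dom c'"
  have V: "open V" using \<psi> unfolding surface_param_def by blast
  from derivative_of_map_in_charts[OF c(1,2) IntD1[OF c(3)] IntD2[OF c(3)] V y surface_param_coordinates(5)[OF \<psi> c(1)]
      surface_param_coordinates(3)[OF \<psi> c(1) y IntD1[OF c(3)]]]
  show "push A \<psi> y e c' = frechet_derivative (chart_map c' \<circ> chart_inv c) (at (chart_map c (\<psi> y))) (push A \<psi> y e c)"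
    using c by (simp add: push_def frechet_derivative_eqI)
next
  fix c assume "\<not> (c \<in> A \<and> \<psi> y \<in> chart_dom c)"
  then show "push A \<psi> y e c = 0" unfolding push_def by (rule if_not_P)
qed

lemma push_component: "c \<in> A \<Longrightarrow> \<psi> y \<in> chart_dom c \<Longrightarrow>
    push A \<psi> y e c = frechet_derivative (chart_map c \<circ> \<psi>) (at y) e"
  by (simp add: push_def)

end

section \<open>Differentials of defining functions along the surface\<close>

context framed_chart
begin

text \<open>Near \<open>y\<close> the parametrization stays in the zero set of \<open>u\<close>, so
  the composition is locally constant and the chain rule gives 0.\<close>

lemma du_tangent:
  assumes u: "local_defining_function A \<Sigma> p N u" and N: "N \<subseteq> U"
    and \<psi>: "surface_param A \<Sigma> V \<psi>" and y: "y \<in> V" "\<psi> y \<in> N"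
  shows "du u (chart_map c (\<psi> y)) (frechet_derivative (chart_map c \<circ> \<psi>) (at y) e) = 0"
proof -
  have N': "open N" "Ck_fun A (Suc 1) N u" "\<Sigma> \<inter> N = {x \<in> N. u x = 0}"
    using u by (simp_all add: local_defining_function_def numeral_2_eq_2)
  have V: "open V" "\<psi> ` V \<subseteq> \<Sigma>" using \<psi> unfolding surface_param_def by blast+
  have yc: "\<psi> y \<in> chart_dom c" using y N in_dom by blast
  have "open (\<psi> -` N \<inter> V)"
    using continuous_on_open_vimage[OF V(1)] surface_param_coordinates(5)[OF \<psi> c] N'(1) by blast
  moreover have "(u \<circ> chart_inv c) ((chart_map c \<circ> \<psi>) z) = 0" if "z \<in> \<psi> -` N \<inter> V" for z
  proof -
    have "\<psi> z \<in> \<Sigma> \<inter> N" using that V(2) by blast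
    then have "u (\<psi> z) = 0" "\<psi> z \<in> chart_dom c" using N'(3) N in_dom by blast+
    then show ?thesis by (simp add: inv_map[OF c])
  qed
  ultimately have "((\<lambda>z. (u \<circ> chart_inv c) ((chart_map c \<circ> \<psi>) z)) has_derivative (\<lambda>h. 0)) (at y)"
    using has_derivative_transform_within_open[OF has_derivative_const[of 0]] y by (metis (mono_tags, lifting) IntI vimageI)
  moreover have "((\<lambda>z. (u \<circ> chart_inv c) ((chart_map c \<circ> \<psi>) z)) has_derivative
     (\<lambda>h. du u (chart_map c (\<psi> y)) (frechet_derivative (chart_map c \<circ> \<psi>) (at y) h))) (at y)"
  proof (rule has_derivative_compose[OF surface_param_coordinates(3)[OF \<psi> c y(1) yc]])
    have "chart_map c (\<psi> y) \<in> chart_map c ` N" using y(2) by blast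
    from du_has_derivative[OF N'(2) N this]
    show "((u \<circ> chart_inv c) has_derivative du u (chart_map c (\<psi> y))) (at ((chart_map c \<circ> \<psi>) y))" by simp
  qed
  ultimately show ?thesis
    by (metis has_derivative_unique)
qed

lemma du_nonzero:
  assumes u: "local_defining_function A \<Sigma> p N u" and N: "N \<subseteq> U" and q: "q \<in> \<Sigma> \<inter> N"
  shows "\<exists>\<nu>. du u (chart_map c q) \<nu> \<noteq> 0"
proof -
  have "Ck_fun A (Suc 1) N u" using u by (simp add: local_defining_function_def numeral_2_eq_2)
  moreover obtain v where "v \<in> tangent A q" "differential A u q v \<noteq> 0"
    using u q unfolding local_defining_function_def by blast
  ultimately show ?thesis
    using differential_coordinates[OF _ N IntD2[OF q]] by metis
qed

text \<open>At a characteristic point each frame vector is the velocity of some parametrization of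
  the surface, and \<open>du_tangent\<close> applies to it.\<close>

lemma characteristic_coordinates:
  assumes u: "local_defining_function A \<Sigma> p N u" and N: "N \<subseteq> U" and q: "q \<in> N" "q \<in> characteristic_set A \<omega> \<Sigma>"
  shows "a1 u (chart_map c q) = 0" "a2 u (chart_map c q) = 0"
proof -
  have qU: "q \<in> U" using q(1) N by blast
  have *: "du u (chart_map c q) (v c) = 0" if "v \<in> distribution A \<omega> q" for v
  proof -
    have "v \<in> surface_tangent A \<Sigma> q" using that q(2) unfolding characteristic_set_def by blast
    then obtain V \<psi> y e where "surface_param A \<Sigma> V \<psi>" "y \<in> V" "\<psi> y = q" "v = push A \<psi> y e"
      unfolding surface_tangent_def by blast
    then show ?thesis
      using du_tangent[OF u N, of V \<psi> y e] q(1) push_component[OF c, of \<psi> y e] in_dom[OF qU] by simp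
  qed
  from *[OF frame_distribution(1)[OF qU]] *[OF frame_distribution(2)[OF qU]]
  show "a1 u (chart_map c q) = 0" "a2 u (chart_map c q) = 0"
    by (simp_all add: chart_field_component[OF qU] a1_def a2_def)
qed

text \<open>Both differentials vanish on the tangent plane of the surface, so their ratio can be
  read off from one transverse vector \<open>\<nu>\<close>. If the second differential vanished on
  \<open>\<nu>\<close>, it would vanish identically, against the definition of a defining
  function.\<close>

lemma du_proportional:
  assumes u: "local_defining_function A \<Sigma> p N u" "N \<subseteq> U"
    and u': "local_defining_function A \<Sigma> p' N' u'" "N' \<subseteq> U"
    and \<psi>: "surface_param A \<Sigma> V \<psi>" and y: "y \<in> V" "\<psi> y \<in> N" "\<psi> y \<in> N'"
    and \<nu>: "du u (chart_map c (\<psi> y)) \<nu> \<noteq> 0"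
  shows "du u' (chart_map c (\<psi> y)) v = du u' (chart_map c (\<psi> y)) \<nu> / du u (chart_map c (\<psi> y)) \<nu> * du u (chart_map c (\<psi> y)) v"
    and "du u' (chart_map c (\<psi> y)) \<nu> \<noteq> 0"
proof -
  have C: "Ck_fun A (Suc 1) N u" "Ck_fun A (Suc 1) N' u'"
    using u(1) u'(1) by (simp_all add: local_defining_function_def numeral_2_eq_2)
  have yc: "\<psi> y \<in> chart_dom c" using y u(2) in_dom by blast
  have x: "chart_map c (\<psi> y) \<in> chart_map c ` N" "chart_map c (\<psi> y) \<in> chart_map c ` N'" using y by blast+
  show *: "du u' (chart_map c (\<psi> y)) v = du u' (chart_map c (\<psi> y)) \<nu> / du u (chart_map c (\<psi> y)) \<nu> * du u (chart_map c (\<psi> y)) v" for v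
    by (rule functionals_vanishing_on_plane_proportional[OF has_derivative_linear[OF surface_param_coordinates(3)[OF \<psi> c y(1) yc]]
      surface_param_coordinates(4)[OF \<psi> c y(1) yc] linear_du[OF C(1) u(2) x(1)] du_tangent[OF u \<psi> y(1,2)] \<nu>
      linear_du[OF C(2) u'(2) x(2)] du_tangent[OF u' \<psi> y(1,3)]])
  have "\<psi> y \<in> \<Sigma> \<inter> N'" using \<psi> y unfolding surface_param_def by blast
  then obtain \<nu>' where "du u' (chart_map c (\<psi> y)) \<nu>' \<noteq> 0" using du_nonzero[OF u'] by blast
  then show "du u' (chart_map c (\<psi> y)) \<nu> \<noteq> 0" using *[of \<nu>'] by auto
qed

text \<open>Realizes a direction annihilated by \<open>du\<close> as a velocity along the surface,
  so that identities valid only on the surface may be differentiated in that direction.\<close>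

lemma kernel_du_eq_range:
  assumes u: "local_defining_function A \<Sigma> p N u" "N \<subseteq> U"
    and \<psi>: "surface_param A \<Sigma> V \<psi>" and y: "y \<in> V" "\<psi> y \<in> N"
    and T: "du u (chart_map c (\<psi> y)) T = 0"
  obtains e where "T = frechet_derivative (chart_map c \<circ> \<psi>) (at y) e"
proof -
  have C: "Ck_fun A (Suc 1) N u"
    using u(1) by (simp add: local_defining_function_def numeral_2_eq_2)
  have yc: "\<psi> y \<in> chart_dom c" using y u(2) in_dom by blast
  have x: "chart_map c (\<psi> y) \<in> chart_map c ` N" using y by blast
  have "\<psi> y \<in> \<Sigma> \<inter> N" using \<psi> y unfolding surface_param_def by blast
  then obtain \<nu> where "du u (chart_map c (\<psi> y)) \<nu> \<noteq> 0" using du_nonzero[OF u] by blast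
  from hyperplane_eq_range[OF has_derivative_linear[OF surface_param_coordinates(3)[OF \<psi> c y(1) yc]]
      surface_param_coordinates(4)[OF \<psi> c y(1) yc] linear_du[OF C u(2) x] du_tangent[OF u \<psi> y] this]
  show thesis using T that by blast
qed

text \<open>On \<open>\<Sigma>\<close> the pairs \<open>(a\<^sub>1, a\<^sub>2)\<close> of \<open>u\<close> and \<open>u'\<close> are proportional; the proportionality factor is not
  known to be differentiable, so the relation \<open>a'\<^sub>1 a\<^sub>2 = a'\<^sub>2 a\<^sub>1\<close> is differentiated along \<open>\<Sigma>\<close> instead.\<close>

lemma abs_normal_div_independent:
  assumes u: "local_defining_function A \<Sigma> p N u" "N \<subseteq> U"
    and u': "local_defining_function A \<Sigma> p' N' u'" "N' \<subseteq> U"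
    and \<psi>: "surface_param A \<Sigma> V \<psi>" and y: "y \<in> V" "\<psi> y \<in> N" "\<psi> y \<in> N'"
    and W0: "W u (chart_map c (\<psi> y)) \<noteq> 0"
  shows "\<bar>normal_div \<rho> u' (chart_map c (\<psi> y))\<bar> = \<bar>normal_div \<rho> u (chart_map c (\<psi> y))\<bar>"
    and "W u' (chart_map c (\<psi> y)) \<noteq> 0"
proof -
  define x where "x = chart_map c (\<psi> y)"
  have C: "Ck_fun A (Suc 1) N u" "Ck_fun A (Suc 1) N' u'" and oN: "open N" "open N'"
    using u(1) u'(1) by (simp_all add: local_defining_function_def numeral_2_eq_2)
  have yc: "\<psi> y \<in> chart_dom c" using y u(2) in_dom by blast
  have x: "x \<in> chart_map c ` N" "x \<in> chart_map c ` N'" using y unfolding x_def by blast+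
  have V: "open V" "\<psi> ` V \<subseteq> \<Sigma>" using \<psi> unfolding surface_param_def by blast+
  have ratio: "\<exists>l. l \<noteq> 0 \<and> a1 u' (chart_map c (\<psi> z)) = l * a1 u (chart_map c (\<psi> z)) \<and>
      a2 u' (chart_map c (\<psi> z)) = l * a2 u (chart_map c (\<psi> z))"
    if z: "z \<in> V" "\<psi> z \<in> N" "\<psi> z \<in> N'" for z
  proof -
    have "\<psi> z \<in> \<Sigma> \<inter> N" using V(2) z by blast
    then obtain \<nu> where \<nu>: "du u (chart_map c (\<psi> z)) \<nu> \<noteq> 0" using du_nonzero[OF u] by blast
    then have "du u' (chart_map c (\<psi> z)) \<nu> / du u (chart_map c (\<psi> z)) \<nu> \<noteq> 0"
      using du_proportional(2)[OF u u' \<psi> z \<nu>] by simp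
    with du_proportional(1)[OF u u' \<psi> z \<nu>] show ?thesis unfolding a1_def a2_def by blast
  qed
  obtain l where l: "l \<noteq> 0" "a1 u' x = l * a1 u x" "a2 u' x = l * a2 u x"
    using ratio[OF y] unfolding x_def by blast
  have "W u' x = sqrt (l\<^sup>2 * (a1 u x * a1 u x + a2 u x * a2 u x))"
    unfolding W_def l by (simp add: power2_eq_square algebra_simps)
  then have W: "W u' x = \<bar>l\<bar> * W u x"
    unfolding W_def by (simp add: real_sqrt_mult)
  then show "W u' (chart_map c (\<psi> y)) \<noteq> 0" using W0 l(1) by (simp add: x_def)
  define A1 where "A1 = frechet_derivative (a1 u) (at x)"
  define A2 where "A2 = frechet_derivative (a2 u) (at x)"
  define B1 where "B1 = frechet_derivative (a1 u') (at x)"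
  define B2 where "B2 = frechet_derivative (a2 u') (at x)"
  have d: "(a1 u has_derivative A1) (at x)" "(a2 u has_derivative A2) (at x)"
    "(a1 u' has_derivative B1) (at x)" "(a2 u' has_derivative B2) (at x)"
    unfolding A1_def A2_def B1_def B2_def
    by (rule Ck_on_has_derivative[OF _ zero_less_one], (rule Ck_a[OF C(1) oN(1) u(2)] Ck_a[OF C(2) oN(2) u'(2)]), (rule x))+
  have linB: "linear B1" "linear B2" using d has_derivative_linear by blast+
  define P where "P = (\<lambda>z. a1 u' z * a2 u z - a2 u' z * a1 u z)"
  have dP: "(P has_derivative (\<lambda>h. (a1 u' x * A2 h + B1 h * a2 u x) - (a2 u' x * A1 h + B2 h * a1 u x))) (at ((chart_map c \<circ> \<psi>) y))"
    unfolding P_def comp_apply x_def[symmetric] by (intro has_derivative_diff has_derivative_mult d)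
  let ?D = "frechet_derivative (chart_map c \<circ> \<psi>) (at y)"
  have 1: "((\<lambda>z. P ((chart_map c \<circ> \<psi>) z)) has_derivative
      (\<lambda>h. (a1 u' x * A2 (?D h) + B1 (?D h) * a2 u x) - (a2 u' x * A1 (?D h) + B2 (?D h) * a1 u x))) (at y)"
    by (rule has_derivative_compose[OF surface_param_coordinates(3)[OF \<psi> c y(1) yc] dP])
  have 2: "((\<lambda>z. P ((chart_map c \<circ> \<psi>) z)) has_derivative (\<lambda>h. 0)) (at y)"
  proof (rule has_derivative_transform_within_open[OF has_derivative_const[of 0]])
    show "open (\<psi> -` (N \<inter> N') \<inter> V)"
      using continuous_on_open_vimage[OF V(1)] surface_param_coordinates(5)[OF \<psi> c] oN by blast
    show "y \<in> \<psi> -` (N \<inter> N') \<inter> V" using y by blast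
    show "0 = P ((chart_map c \<circ> \<psi>) z)" if "z \<in> \<psi> -` (N \<inter> N') \<inter> V" for z
      using ratio[of z] that by (auto simp: P_def)
  qed
  define T where "T = tangent_dir u x"
  have "du u x T = 0"
    unfolding T_def tangent_dir_def linear_diff[OF linear_du[OF C(1) u(2) x(1)]] linear_cmul[OF linear_du[OF C(1) u(2) x(1)]]
    by (simp add: a1_def a2_def)
  then obtain e where e: "T = ?D e"
    using kernel_du_eq_range[OF u \<psi> y(1,2)] unfolding x_def by blast
  have "(a1 u' x * A2 T + B1 T * a2 u x) - (a2 u' x * A1 T + B2 T * a1 u x) = 0"
    using fun_cong[OF has_derivative_unique[OF 1 2], of e] by (simp only: e)
  \<comment> \<open>Substituting the values \<open>l * a1\<close> and \<open>l * a2\<close> at the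
    single point \<open>x\<close> relates the derivatives of the two pairs along \<open>T\<close>;
    no derivative of the factor occurs.\<close>
  then have e1: "a1 u x * B2 T - a2 u x * B1 T = l * (a1 u x * A2 T - a2 u x * A1 T)"
    unfolding l by (simp add: algebra_simps)
  have T': "tangent_dir u' x = l *\<^sub>R T"
    unfolding T_def tangent_dir_def l by (simp add: algebra_simps)
  \<comment> \<open>The three factors \<open>l\<close> come from the coefficients, from
    \<open>tangent_dir\<close> and from \<open>e1\<close>. The denominator scales by the cube of the
    absolute value, so only the sign of \<open>l\<close> survives.\<close>
  have num: "a1 u' x * B2 (tangent_dir u' x) - a2 u' x * B1 (tangent_dir u' x) = l ^ 3 * (a1 u x * A2 T - a2 u x * A1 T)"
  proof -
    have "a1 u' x * B2 (tangent_dir u' x) - a2 u' x * B1 (tangent_dir u' x) = l * l * (a1 u x * B2 T - a2 u x * B1 T)"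
      unfolding T' linear_cmul[OF linB(1)] linear_cmul[OF linB(2)] l by (simp add: algebra_simps)
    then show ?thesis unfolding e1 by (simp add: power3_eq_cube)
  qed
  have s: "l ^ 3 / \<bar>l\<bar> ^ 3 = sgn l" "l / \<bar>l\<bar> = sgn l"
    using l(1) by (simp_all add: sgn_if power3_eq_cube)
  have "normal_div \<rho> u' x = (l ^ 3 / \<bar>l\<bar> ^ 3) * ((a1 u x * A2 T - a2 u x * A1 T) / W u x ^ 3) +
     (l / \<bar>l\<bar>) * ((a1 u x * frame_div \<rho> X1 x + a2 u x * frame_div \<rho> X2 x) / W u x)"
    unfolding normal_div_def B1_def[symmetric] B2_def[symmetric] num
    unfolding W l(2,3) power_mult_distrib mult.assoc distrib_left[symmetric] times_divide_times_eq ..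
  also have "\<dots> = sgn l * normal_div \<rho> u x"
    unfolding s normal_div_def A1_def[symmetric] A2_def[symmetric] T_def[symmetric] by (simp add: algebra_simps)
  finally show "\<bar>normal_div \<rho> u' (chart_map c (\<psi> y))\<bar> = \<bar>normal_div \<rho> u (chart_map c (\<psi> y))\<bar>"
    using l(1) by (simp add: abs_mult x_def[symmetric])
qed

end

section \<open>Estimates near a characteristic point\<close>

text \<open>On the ring between radii \<open>r / 2 ^ Suc k\<close> and \<open>r / 2 ^ k\<close> the
  integrand is at most \<open>C * 2 ^ Suc k / r\<close>, while the image has measure at most a
  constant times the square of \<open>r / 2 ^ k\<close>. Summing over the rings gives a geometric
  series of ratio 1/2.\<close>

lemma nn_integral_dyadic_finite:
  fixes \<psi> :: "real^2 \<Rightarrow> 'm" and f :: "'m \<Rightarrow> ennreal"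
  assumes r: "r > 0" and CK: "C \<ge> 0" "K \<ge> 0"
    and S: "\<And>B. B \<in> sets borel \<Longrightarrow> B \<subseteq> ball y0 r \<Longrightarrow> \<psi> ` B \<in> sets \<sigma>"
    and K: "\<And>B. B \<in> sets borel \<Longrightarrow> B \<subseteq> ball y0 r \<Longrightarrow> emeasure \<sigma> (\<psi> ` B) \<le> ennreal K * emeasure lborel B"
    and f: "\<And>y. y \<in> ball y0 r \<Longrightarrow> y \<noteq> y0 \<Longrightarrow> f (\<psi> y) \<le> ennreal (C / norm (y - y0))"
  shows "(\<integral>\<^sup>+x\<in>\<psi> ` ball y0 r. f x \<partial>\<sigma>) < \<infinity>"
proof -
  define B where "B = (\<lambda>k. ball y0 (r / 2 ^ k))"
  define R where "R = (\<lambda>k. B k - ball y0 (r / 2 ^ Suc k))"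
  have B_sub: "B k \<subseteq> ball y0 r" for k
    unfolding B_def by (rule subset_ball) (use r in \<open>simp add: field_simps\<close>)
  have R_borel: "R k \<in> sets borel" "R k \<subseteq> ball y0 r" "R k \<subseteq> B k" for k
    using B_sub[of k] by (auto simp: R_def B_def)
  \<comment> \<open>At \<open>y0\<close> no bound on \<open>f\<close> is available, and in the
    application to \<open>1 / W\<close> the value there is infinite. The infinite summand covers
    this point at no cost, since its image is a null set.\<close>
  define F where "F = (\<lambda>x. (\<Sum>k. ennreal (C * 2 ^ Suc k / r) * indicator (\<psi> ` R k) x) + \<infinity> * indicator (\<psi> ` {y0}) x)"
  have point: "f x * indicator (\<psi> ` ball y0 r) x \<le> F x" for x
  proof (cases "x \<in> \<psi> ` ball y0 r")
    case True
    then obtain y where y: "y \<in> ball y0 r" "x = \<psi> y" by blast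
    show ?thesis
    proof (cases "y = y0")
      case True
      then show ?thesis by (simp add: F_def y(2))
    next
      case False
      then have pos: "norm (y - y0) > 0" by simp
      have yr: "norm (y - y0) < r" using y(1) by (simp add: dist_norm norm_minus_commute)
      obtain n where "r / norm (y - y0) < 2 ^ n" using real_arch_pow[of 2 "r / norm (y - y0)"] by auto
      then have n: "r / 2 ^ n \<le> norm (y - y0)" using pos by (simp add: field_simps)
      \<comment> \<open>The first index whose radius does not exceed the distance to
        \<open>y0\<close>. It is positive because the distance is below \<open>r\<close>; the point
        therefore lies in the ring with index one less.\<close>
      define k where "k = (LEAST n. r / 2 ^ n \<le> norm (y - y0))"
      have k: "r / 2 ^ k \<le> norm (y - y0)" unfolding k_def by (rule LeastI[of _ n]) (rule n)
      have "k \<noteq> 0" using k yr by (intro notI) simp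
      then obtain j where j: "k = Suc j" using not0_implies_Suc by blast
      have "\<not> r / 2 ^ j \<le> norm (y - y0)"
        using not_less_Least[of j "\<lambda>n. r / 2 ^ n \<le> norm (y - y0)"] j unfolding k_def by simp
      then have yj: "y \<in> R j" using k j by (simp add: R_def B_def dist_norm norm_minus_commute)
      have "C / norm (y - y0) \<le> C / (r / 2 ^ Suc j)"
        using k j r CK(1) pos by (intro divide_left_mono mult_pos_pos) auto
      then have "f x \<le> ennreal (C * 2 ^ Suc j / r)"
        using f[OF y(1) False] y(2) by (auto intro: order_trans ennreal_leI)
      also have "\<dots> = (\<Sum>k\<in>{j}. ennreal (C * 2 ^ Suc k / r) * indicator (\<psi> ` R k) x)"
        using yj y(2) by simp
      also have "\<dots> \<le> (\<Sum>k. ennreal (C * 2 ^ Suc k / r) * indicator (\<psi> ` R k) x)"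
        by (rule sum_le_suminf) auto
      also have "\<dots> \<le> F x" unfolding F_def by simp
      finally show ?thesis using \<open>x \<in> \<psi> ` ball y0 r\<close> by simp
    qed
  qed (simp add: F_def)
  define D where "D = unit_ball_vol 2"
  have D: "D \<ge> 0" by (simp add: D_def)
  have sets: "\<psi> ` R k \<in> sets \<sigma>" "\<psi> ` {y0} \<in> sets \<sigma>" for k
    using S[OF R_borel(1,2)] S[of "{y0}"] r by simp_all
  have "emeasure \<sigma> (\<psi> ` {y0}) \<le> ennreal K * emeasure lborel {y0}" by (rule K) (use r in auto)
  then have null: "emeasure \<sigma> (\<psi> ` {y0}) = 0" by simp
  have ring: "ennreal (C * 2 ^ Suc k / r) * emeasure \<sigma> (\<psi> ` R k) \<le> ennreal (2 * C * K * D * r * (1 / 2) ^ k)" for k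
  proof -
    have "emeasure lborel (B k) = ennreal (D * (r / 2 ^ k)\<^sup>2)"
      using r by (simp add: B_def emeasure_ball D_def)
    moreover have "emeasure lborel (R k) \<le> emeasure lborel (B k)"
      by (rule emeasure_mono[OF R_borel(3)]) (simp add: B_def)
    ultimately have "emeasure lborel (R k) \<le> ennreal (D * (r / 2 ^ k)\<^sup>2)" by simp
    then have "ennreal K * emeasure lborel (R k) \<le> ennreal K * ennreal (D * (r / 2 ^ k)\<^sup>2)"
      by (rule mult_left_mono) simp
    then have "emeasure \<sigma> (\<psi> ` R k) \<le> ennreal K * ennreal (D * (r / 2 ^ k)\<^sup>2)"
      by (rule order_trans[OF K[OF R_borel(1,2)]])
    then have "ennreal (C * 2 ^ Suc k / r) * emeasure \<sigma> (\<psi> ` R k) \<le>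
        ennreal (C * 2 ^ Suc k / r) * (ennreal K * ennreal (D * (r / 2 ^ k)\<^sup>2))"
      by (rule mult_left_mono) simp
    also have "\<dots> = ennreal (C * 2 ^ Suc k / r * (K * (D * (r / 2 ^ k)\<^sup>2)))"
    proof -
      have "ennreal a * (ennreal K * ennreal Q) = ennreal (a * (K * Q))" if "a \<ge> 0" "Q \<ge> 0" for a Q
        using CK that by (simp add: ennreal_mult)
      then show ?thesis using CK D r by simp
    qed
    also have "C * 2 ^ Suc k / r * (K * (D * (r / 2 ^ k)\<^sup>2)) = 2 * C * K * D * r * (1 / 2) ^ k"
      using r by (simp add: power2_eq_square field_simps)
    finally show ?thesis .
  qed
  have "(\<integral>\<^sup>+x\<in>\<psi> ` ball y0 r. f x \<partial>\<sigma>) \<le> (\<integral>\<^sup>+x. F x \<partial>\<sigma>)"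
    by (intro nn_integral_mono point)
  also have "\<dots> = (\<Sum>k. ennreal (C * 2 ^ Suc k / r) * emeasure \<sigma> (\<psi> ` R k)) + \<infinity> * emeasure \<sigma> (\<psi> ` {y0})"
    unfolding F_def using sets
    by (subst nn_integral_add) (auto simp: nn_integral_suminf nn_integral_cmult_indicator intro!: borel_measurable_suminf)
  also have "\<dots> = (\<Sum>k. ennreal (C * 2 ^ Suc k / r) * emeasure \<sigma> (\<psi> ` R k))" using null by simp
  also have "\<dots> \<le> (\<Sum>k. ennreal (2 * C * K * D * r * (1 / 2) ^ k))"
    by (intro suminf_le ring) auto
  also have "\<dots> = ennreal (\<Sum>k. 2 * C * K * D * r * (1 / 2) ^ k)"
    using CK D r by (intro suminf_ennreal2 summable_mult summable_geometric) auto
  also have "\<dots> < \<infinity>" by simp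
  finally show ?thesis .
qed

section \<open>Boundedness of the density of the induced measure\<close>

lemma abs_det3_le:
  fixes a b c :: "real^3"
  shows "\<bar>det (vector [a, b, c] :: real^3^3)\<bar> \<le> 6 * (norm a * norm b * norm c)"
proof -
  have *: "\<bar>a $ i * b $ j * c $ k\<bar> \<le> norm a * norm b * norm c" for i j k
    unfolding abs_mult by (intro mult_mono component_le_norm_cart mult_nonneg_nonneg) auto
  have "det (vector [a, b, c] :: real^3^3) =
      a $ 1 * b $ 2 * c $ 3 + a $ 2 * b $ 3 * c $ 1 + a $ 3 * b $ 1 * c $ 2
      - a $ 1 * b $ 3 * c $ 2 - a $ 2 * b $ 1 * c $ 3 - a $ 3 * b $ 2 * c $ 1"
    by (simp add: det_3)
  then show ?thesis
    using *[of 1 2 3, unfolded abs_le_iff] *[of 2 3 1, unfolded abs_le_iff] *[of 3 1 2, unfolded abs_le_iff]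
      *[of 1 3 2, unfolded abs_le_iff] *[of 2 1 3, unfolded abs_le_iff] *[of 3 2 1, unfolded abs_le_iff]
    by (intro abs_leI) linarith+
qed

text \<open>The quadratic form of \<open>G\<close> attains a positive minimum \<open>m0\<close> on
  the compact product of a closed coordinate ball and the unit sphere; by homogeneity unit vectors
  have components of norm at most \<open>1 / sqrt m0\<close>. This controls the normal
  \<open>n\<close>, whose dependence on the point is left free by
  \<open>unit_normal\<close>.\<close>

lemma (in atlas) unit_vectors_bounded:
  assumes G: "smooth_metric_on A (tangent A) G" and c: "c \<in> A" "p \<in> chart_dom c"
  shows "\<exists>N K. open N \<and> p \<in> N \<and> N \<subseteq> chart_dom c \<and> (\<forall>q\<in>N. \<forall>v\<in>tangent A q. G q v v = 1 \<longrightarrow> norm (v c) \<le> K)"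
proof -
  define B where "B = (\<lambda>x e f. G (chart_inv c x) (lift A c (chart_inv c x) e) (lift A c (chart_inv c x) f))"
  note m = G[unfolded smooth_metric_on_def]
  have lin: "linear (B x e)" and sym: "B x e f = B x f e" if x: "x \<in> chart_ran c" for x e f
  proof -
    let ?q = "chart_inv c x"
    have q: "?q \<in> chart_dom c" by (rule inv_in_dom[OF c(1) x])
    note t = lift_tangent[OF c(1) q]
    have "B x e (a *\<^sub>R f + b *\<^sub>R h) = a * B x e f + b * B x e h" for a b f h
      unfolding B_def lift_linear[OF c(1) q]
      by (rule bspec[OF spec[OF conjunct1[OF m]] t, unfolded tlinear_on_def, rule_format, OF t t])
    from this[of 1 _ 1] this[of _ _ 0 0] show "linear (B x e)" by (intro linearI) simp_all
    show "B x e f = B x f e"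
      unfolding B_def by (rule bspec[OF bspec[OF spec[OF conjunct1[OF conjunct2[OF m]]] t] t])
  qed
  have cont: "continuous_on (chart_ran c) (\<lambda>x. B x e f)" for e f
  proof -
    have sect: "smooth_section A (tangent A) (chart_dom c) (chart_field A c (\<lambda>_. e))" for e
      unfolding smooth_section_def
      by (intro allI Ck_section_chart_field[OF c(1) open_dom[OF c(1)] order_refl] Ck_on_const chart_field_tangent[OF c(1)])
    have "Ck_fun A 0 (chart_dom c) (\<lambda>q. G q (chart_field A c (\<lambda>_. e) q) (chart_field A c (\<lambda>_. f) q))"
      using conjunct2[OF conjunct2[OF conjunct2[OF m]], rule_format, OF conjI[OF open_dom[OF c(1)] conjI[OF sect sect]]] .
    from Ck_funD[OF this c(1) order_refl order_refl] show ?thesis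
      by (simp add: o_def chart_field_def B_def)
  qed
  \<comment> \<open>Smoothness of the metric speaks of sections, hence gives continuity in
    \<open>x\<close> for fixed \<open>e\<close> and \<open>f\<close>. Continuity jointly in the
    point and the vector comes from this expansion into finitely many coefficients.\<close>
  have expand: "B x e e = (\<Sum>i\<in>Basis. \<Sum>j\<in>Basis. (e \<bullet> i) * ((e \<bullet> j) * B x i j))" if x: "x \<in> chart_ran c" for x e
  proof -
    have "B x e e = (\<Sum>i\<in>Basis. (e \<bullet> i) *\<^sub>R B x e i)"
      by (rule linear_euclidean_expand[OF lin[OF x]])
    also have "\<dots> = (\<Sum>i\<in>Basis. (e \<bullet> i) *\<^sub>R (\<Sum>j\<in>Basis. (e \<bullet> j) *\<^sub>R B x i j))"
    proof (rule sum.cong[OF refl])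
      fix i
      have "B x e i = (\<Sum>j\<in>Basis. (e \<bullet> j) *\<^sub>R B x i j)"
        by (rule trans[OF sym[OF x] linear_euclidean_expand[OF lin[OF x]]])
      then show "(e \<bullet> i) *\<^sub>R B x e i = (e \<bullet> i) *\<^sub>R (\<Sum>j\<in>Basis. (e \<bullet> j) *\<^sub>R B x i j)"
        by (rule arg_cong)
    qed
    finally show ?thesis by (simp only: sum_distrib_left real_scaleR_def)
  qed
  define x0 where "x0 = chart_map c p"
  have "x0 \<in> chart_ran c" unfolding x0_def using c(2) by blast
  then obtain r where r: "r > 0" "cball x0 r \<subseteq> chart_ran c"
    using open_ran[OF c(1)] open_contains_cball by blast
  have eq: "B (fst z) (snd z) (snd z) = (\<Sum>i\<in>Basis. \<Sum>j\<in>Basis. (snd z \<bullet> i) * ((snd z \<bullet> j) * B (fst z) i j))"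
    if "z \<in> cball x0 r \<times> sphere 0 1" for z
    by (rule expand) (use that r in auto)
  have "continuous_on (cball x0 r \<times> sphere 0 1) (\<lambda>z. B (fst z) i j)" for i j
    by (rule continuous_on_compose2[OF cont continuous_on_fst[OF continuous_on_id]]) (use r(2) in auto)
  then have "continuous_on (cball x0 r \<times> sphere 0 1)
        (\<lambda>z. \<Sum>i\<in>Basis. \<Sum>j\<in>Basis. (snd z \<bullet> i) * ((snd z \<bullet> j) * B (fst z) i j))"
    by (intro continuous_on_sum continuous_on_mult continuous_on_inner continuous_on_snd continuous_on_id continuous_on_const)
  then have "continuous_on (cball x0 r \<times> sphere 0 1) (\<lambda>z. B (fst z) (snd z) (snd z))"
    by (rule iffD2[OF continuous_on_cong[OF refl eq], rotated])
  moreover have "compact (cball x0 r \<times> sphere (0::real^3) 1)" by (intro compact_Times compact_cball compact_sphere)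
  moreover have "(x0, axis 1 1) \<in> cball x0 r \<times> sphere (0::real^3) 1" using r(1) by simp
  then have "cball x0 r \<times> sphere (0::real^3) 1 \<noteq> {}" by blast
  ultimately have "\<exists>z\<in>cball x0 r \<times> sphere 0 1. \<forall>z'\<in>cball x0 r \<times> sphere 0 1.
      B (fst z) (snd z) (snd z) \<le> B (fst z') (snd z') (snd z')"
    by (intro continuous_attains_inf)
  then obtain z where z: "z \<in> cball x0 r \<times> sphere 0 1"
    and min: "\<forall>z'\<in>cball x0 r \<times> sphere 0 1. B (fst z) (snd z) (snd z) \<le> B (fst z') (snd z') (snd z')"
    by (rule bexE)
  define m0 where "m0 = B (fst z) (snd z) (snd z)"
  have z1: "fst z \<in> chart_ran c" "norm (snd z) = 1" using z r(2) by auto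
  have m0: "m0 > 0"
  proof -
    let ?q = "chart_inv c (fst z)"
    have q: "?q \<in> chart_dom c" by (rule inv_in_dom[OF c(1) z1(1)])
    have "lift A c ?q (snd z) c \<noteq> 0" using z1(2) lift_same[OF c(1) q] by auto
    then have "lift A c ?q (snd z) \<noteq> (\<lambda>c. 0)" by metis
    then show ?thesis
      unfolding m0_def B_def
      by (rule mp[OF bspec[OF spec[OF conjunct1[OF conjunct2[OF conjunct2[OF m]]]] lift_tangent[OF c(1) q]]])
  qed
  define N where "N = chart_map c -` ball x0 r \<inter> chart_dom c"
  have N: "open N" "p \<in> N" "N \<subseteq> chart_dom c"
    unfolding N_def using continuous_on_open_vimage[OF open_dom[OF c(1)]] continuous_map[OF c(1)] c(2) r(1)
    by (blast, simp add: x0_def, blast)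
  have "norm (v c) \<le> 1 / sqrt m0" if q: "q \<in> N" and v: "v \<in> tangent A q" "G q v v = 1" for q v
  proof (cases "v c = 0")
    case False
    have qd: "q \<in> chart_dom c" "chart_map c q \<in> ball x0 r" using q by (auto simp: N_def)
    let ?x = "chart_map c q" and ?s = "norm (v c)"
    have x: "?x \<in> chart_ran c" using qd(1) by blast
    have Bv: "B ?x (v c) (v c) = 1"
      using v(2) tangent_eq_lift[OF v(1) c(1) qd(1)] by (simp add: B_def inv_map[OF c(1) qd(1)])
    define e where "e = (1 / ?s) *\<^sub>R v c"
    have e: "norm e = 1" "v c = ?s *\<^sub>R e" using False by (simp_all add: e_def)
    have "m0 \<le> B ?x e e"
      using bspec[OF min, of "(?x, e)"] qd(2) e(1) by (simp add: m0_def)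
    then have "(?s * ?s) * m0 \<le> (?s * ?s) * B ?x e e" by (rule mult_left_mono) simp
    also have "\<dots> = ?s *\<^sub>R (?s *\<^sub>R B ?x e e)" by simp
    also have "\<dots> = ?s *\<^sub>R B ?x e (?s *\<^sub>R e)" by (simp only: linear_cmul[OF lin[OF x]])
    also have "\<dots> = ?s *\<^sub>R B ?x (?s *\<^sub>R e) e" by (simp only: sym[OF x, of e "?s *\<^sub>R e"])
    also have "\<dots> = B ?x (?s *\<^sub>R e) (?s *\<^sub>R e)" by (simp only: linear_cmul[OF lin[OF x]])
    also have "\<dots> = 1" using Bv by (simp only: e(2)[symmetric])
    finally have "(?s * ?s) * m0 \<le> 1" .
    then have "?s\<^sup>2 \<le> 1 / m0" using m0 by (simp add: field_simps power2_eq_square)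
    then have "?s \<le> sqrt (1 / m0)" by (rule real_le_rsqrt)
    then show ?thesis by (simp add: real_sqrt_divide)
  qed (use m0 in simp)
  then show ?thesis using N by blast
qed

context atlas
begin

lemma param_eventually:
  assumes \<psi>: "surface_param A \<Sigma> V \<psi>" and y: "y \<in> V" "\<psi> y \<in> N" and N: "open N"
  shows "\<forall>\<^sub>F z in nhds y. z \<in> V \<and> \<psi> z \<in> N"
proof -
  have V: "open V" "continuous_on V \<psi>"
    using \<psi> unfolding surface_param_def homeomorphism_def by blast+
  have "open (\<psi> -` N \<inter> V)"
    using continuous_on_open_vimage[OF V(1), of \<psi>] V(2) N by blast
  then show ?thesis
    unfolding eventually_nhds using y by blast
qed

lemma continuous_at_param:
  assumes \<psi>: "surface_param A \<Sigma> V \<psi>" and c: "c \<in> A" and y: "y \<in> V" "\<psi> y \<in> N"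
    and N: "open N" "N \<subseteq> chart_dom c" and f: "continuous_on (chart_map c ` N) f"
  shows "isCont (\<lambda>z. f (chart_map c (\<psi> z))) y"
proof -
  have V: "open V" "continuous_on V \<psi>"
    using \<psi> unfolding surface_param_def homeomorphism_def by blast+
  let ?V = "\<psi> -` N \<inter> V"
  have o: "open ?V"
    using continuous_on_open_vimage[OF V(1), of \<psi>] V(2) N by blast
  have "continuous_on ?V (\<lambda>z. chart_map c (\<psi> z))"
    by (rule continuous_on_compose2[OF continuous_map[OF c] continuous_on_subset[OF V(2)]]) (use N(2) in auto)
  then have "continuous_on ?V (\<lambda>z. f (chart_map c (\<psi> z)))"
    by (rule continuous_on_compose2[OF f]) auto
  moreover have "y \<in> ?V" using y by blast
  ultimately show ?thesis using continuous_on_eq_continuous_at[OF o] by blast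
qed

end

lemma isCont_eventually_less:
  fixes f :: "'a::t2_space \<Rightarrow> real"
  assumes "isCont f x" "f x < a"
  shows "\<forall>\<^sub>F y in nhds x. f y < a"
  by (rule order_tendstoD(2)[OF _ assms(2)])
    (use assms(1) in \<open>simp add: isCont_def tendsto_at_iff_tendsto_nhds\<close>)

context atlas
begin

text \<open>In a fixed chart the density is a coefficient times the determinant of the normal and
  the two velocities of the parametrization. The coefficient and the velocities are continuous, and
  the normal is bounded by \<open>unit_vectors_bounded\<close>.\<close>

lemma density_on_surface_bounded:
  assumes \<rho>: "smooth_positive_density A \<rho>" and G: "smooth_metric_on A (tangent A) G"
    and n: "unit_normal A G \<Sigma> n" and \<psi>: "surface_param A \<Sigma> V \<psi>" and y: "y \<in> V"
  shows "\<exists>K\<ge>0. \<forall>\<^sub>F z in nhds y. density_eval A \<rho> (\<psi> z) (n (\<psi> z)) (push A \<psi> z (axis 1 1)) (push A \<psi> z (axis 2 1)) \<le> K"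
proof -
  let ?J = "\<lambda>z. density_eval A \<rho> (\<psi> z) (n (\<psi> z)) (push A \<psi> z (axis 1 1)) (push A \<psi> z (axis 2 1))"
  obtain c where c: "c \<in> A" "\<psi> y \<in> chart_dom c" using ex_chart by blast
  obtain N K where N: "open N" "\<psi> y \<in> N" "N \<subseteq> chart_dom c"
    and K: "\<forall>q\<in>N. \<forall>v\<in>tangent A q. G q v v = 1 \<longrightarrow> norm (v c) \<le> K"
    using unit_vectors_bounded[OF G c] by (elim exE conjE)
  have V: "\<psi> ` V \<subseteq> \<Sigma>" using \<psi> unfolding surface_param_def by blast
  define D where "D = (\<lambda>z. frechet_derivative (chart_map c \<circ> \<psi>) (at z))"
  note o = surface_param_coordinates(1)[OF \<psi> c(1)]
  have yV: "y \<in> V \<inter> \<psi> -` chart_dom c" using y c(2) by blast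
  have D_cont: "isCont (\<lambda>z. D z e) y" for e
  proof -
    have "Ck_on 1 (V \<inter> \<psi> -` chart_dom c) (\<lambda>z. D z e)"
      using surface_param_coordinates(2)[OF \<psi> c(1)] by (simp add: numeral_2_eq_2 D_def)
    then show ?thesis
      using continuous_on_eq_continuous_at[OF o] Ck_on_continuous yV by blast
  qed
  have \<rho>_cont: "isCont (\<lambda>z. \<rho> c (chart_map c (\<psi> z))) y"
    by (rule continuous_at_param[OF \<psi> c(1) y c(2) open_dom[OF c(1)] order_refl Ck_on_continuous[OF Ck_density[OF \<rho> c(1), of 0]]])
  define b where "b = (\<lambda>z. \<rho> c (chart_map c (\<psi> z)) * (6 * (\<bar>K\<bar> * norm (D z (axis 1 1)) * norm (D z (axis 2 1)))))"
  have "isCont b y"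
    unfolding b_def by (intro continuous_mult continuous_norm continuous_const \<rho>_cont D_cont)
  then have "\<forall>\<^sub>F z in nhds y. b z < \<bar>b y\<bar> + 1" by (rule isCont_eventually_less) linarith
  moreover have "\<forall>\<^sub>F z in nhds y. z \<in> V \<and> \<psi> z \<in> N"
    by (rule param_eventually[OF \<psi> y N(2,1)])
  ultimately have "\<forall>\<^sub>F z in nhds y. ?J z \<le> \<bar>b y\<bar> + 1"
  proof eventually_elim
    case (elim z)
    then have z: "z \<in> V" "\<psi> z \<in> N" "\<psi> z \<in> chart_dom c" "\<psi> z \<in> \<Sigma>" using N(3) V by blast+
    have nz: "n (\<psi> z) \<in> tangent A (\<psi> z)" "G (\<psi> z) (n (\<psi> z)) (n (\<psi> z)) = 1"
      using n z(4) unfolding unit_normal_def by blast+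
    have nK: "norm (n (\<psi> z) c) \<le> \<bar>K\<bar>"
      using K[rule_format, OF z(2) nz] by linarith
    have "?J z =
        \<rho> c (chart_map c (\<psi> z)) * \<bar>det (vector [n (\<psi> z) c, D z (axis 1 1), D z (axis 2 1)] :: real^3^3)\<bar>"
      unfolding density_eval_in_chart[OF \<rho> c(1) z(3) nz(1) push_tangent[OF \<psi> z(1)] push_tangent[OF \<psi> z(1)]]
        push_component[where \<psi> = \<psi> and y = z, OF c(1) z(3)] D_def ..
    also have "\<dots> \<le> b z"
      unfolding b_def
    proof (rule mult_left_mono)
      show "0 \<le> \<rho> c (chart_map c (\<psi> z))" using density_pos[OF \<rho> c(1), of "chart_map c (\<psi> z)"] z(3) by force
      have "\<bar>det (vector [n (\<psi> z) c, D z (axis 1 1), D z (axis 2 1)] :: real^3^3)\<bar> \<le>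
          6 * (norm (n (\<psi> z) c) * norm (D z (axis 1 1)) * norm (D z (axis 2 1)))" by (rule abs_det3_le)
      also have "\<dots> \<le> 6 * (\<bar>K\<bar> * norm (D z (axis 1 1)) * norm (D z (axis 2 1)))"
        by (intro mult_left_mono mult_right_mono nK) auto
      finally show "\<bar>det (vector [n (\<psi> z) c, D z (axis 1 1), D z (axis 2 1)] :: real^3^3)\<bar> \<le>
          6 * (\<bar>K\<bar> * norm (D z (axis 1 1)) * norm (D z (axis 2 1)))" .
    qed
    finally show ?case using elim by linarith
  qed
  then show ?thesis by (intro exI[of _ "\<bar>b y\<bar> + 1"]) auto
qed

end

section \<open>Growth of \<open>W\<close> and bounds for the divergence of the normal\<close>

context framed_chart
begin

text \<open>Nondegeneracy is stated for some defining function \<open>v\<close>, possibly different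
  from \<open>u\<close>. Linear growth is first obtained for \<open>W v\<close>, from injectivity of
  the derivative of \<open>(a1 v, a2 v)\<close> along the surface, and then transferred: on the
  surface \<open>W u\<close> is \<open>W v\<close> times the ratio of the differentials, which stays
  away from 0 near \<open>p\<close>.\<close>

lemma W_lower_bound:
  assumes nd: "nondegenerate_characteristic_point A \<omega> g \<Sigma> p"
    and u: "local_defining_function A \<Sigma> p N u" "N \<subseteq> U"
    and \<psi>: "surface_param A \<Sigma> V \<psi>" and y0: "y0 \<in> V" "\<psi> y0 = p"
  shows "\<exists>k>0. \<forall>\<^sub>F y in nhds y0. k * norm (y - y0) \<le> W u (chart_map c (\<psi> y))"
proof -
  obtain nab U1 v e1 e2 where char: "p \<in> characteristic_set A \<omega> \<Sigma>"
    and nab: "affine_connection A \<omega> nab" and v1: "local_defining_function A \<Sigma> p U1 v"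
    and e: "e1 \<in> distribution A \<omega> p" "e2 \<in> distribution A \<omega> p"
    and det: "det (vector [vector [hess_H A \<omega> g nab v p e1 e1, hess_H A \<omega> g nab v p e1 e2],
                     vector [hess_H A \<omega> g nab v p e2 e1, hess_H A \<omega> g nab v p e2 e2]] :: real^2^2) \<noteq> 0"
    using nd unfolding nondegenerate_characteristic_point_def by (elim conjE exE bexE)
  have uN: "open N" "p \<in> N" "Ck_fun A 2 N u" using u(1) unfolding local_defining_function_def by blast+
  define M where "M = U1 \<inter> U"
  have M: "open M" "p \<in> M" "M \<subseteq> U1" "M \<subseteq> U"
    using v1 open_U uN(2) u(2) unfolding local_defining_function_def M_def by blast+
  have v: "local_defining_function A \<Sigma> p M v" by (rule local_defining_function_mono[OF v1 M(1,3,2)])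
  have vC: "Ck_fun A 2 M v" "Ck_fun A (Suc 1) M v"
    using v unfolding local_defining_function_def by (simp_all add: numeral_2_eq_2)
  define x0 where "x0 = chart_map c p"
  define A1 where "A1 = frechet_derivative (a1 v) (at x0)"
  define A2 where "A2 = frechet_derivative (a2 v) (at x0)"
  have a0: "a1 v x0 = 0" "a2 v x0 = 0"
    unfolding x0_def by (rule characteristic_coordinates[OF v M(4,2) char])+
  have nondeg: "A1 (X1 x0) * A2 (X2 x0) - A1 (X2 x0) * A2 (X1 x0) \<noteq> 0"
    unfolding A1_def A2_def x0_def
    by (rule nondegenerate_coordinates[OF nab vC(1) M(1,4,2) a0[unfolded x0_def] e det])
  have x0: "x0 \<in> chart_map c ` M" unfolding x0_def using M(2) by blast
  have dA: "(a1 v has_derivative A1) (at x0)" "(a2 v has_derivative A2) (at x0)"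
    unfolding A1_def A2_def
    by (rule Ck_on_has_derivative[OF Ck_a(1)[OF vC(2) M(1,4)] zero_less_one x0])
      (rule Ck_on_has_derivative[OF Ck_a(2)[OF vC(2) M(1,4)] zero_less_one x0])
  have linA: "linear A1" "linear A2" using dA has_derivative_linear by blast+
  have pc: "\<psi> y0 \<in> chart_dom c" using y0(2) M(2,4) in_dom by blast
  define D where "D = frechet_derivative (chart_map c \<circ> \<psi>) (at y0)"
  have dD: "((chart_map c \<circ> \<psi>) has_derivative D) (at y0)"
    unfolding D_def by (rule surface_param_coordinates(3)[OF \<psi> c y0(1) pc])
  have linD: "linear D" by (rule has_derivative_linear[OF dD])
  define F where "F = (\<lambda>y. (a1 v (chart_map c (\<psi> y)), a2 v (chart_map c (\<psi> y))))"
  define F' where "F' = (\<lambda>h. (A1 (D h), A2 (D h)))"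
  have at: "(chart_map c \<circ> \<psi>) y0 = x0" by (simp add: x0_def y0(2))
  have dF: "(F has_derivative F') (at y0)"
    unfolding F_def F'_def
    using has_derivative_compose[OF dD, of "a1 v" A1] has_derivative_compose[OF dD, of "a2 v" A2] dA at
    by (intro has_derivative_Pair) simp_all
  have linF: "linear F'" by (rule has_derivative_linear[OF dF])
  have F0: "F y0 = 0" using a0 by (simp add: F_def y0(2) x0_def zero_prod_def)
  have du0: "du v (chart_map c (\<psi> y0)) (X1 x0) = 0" "du v (chart_map c (\<psi> y0)) (X2 x0) = 0"
    using a0 by (simp_all add: a1_def a2_def y0(2) x0_def)
  have pM: "\<psi> y0 \<in> M" using y0(2) M(2) by simp
  obtain h1 where h1: "X1 x0 = D h1" unfolding D_def by (rule kernel_du_eq_range[OF v M(4) \<psi> y0(1) pM du0(1)])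
  obtain h2 where h2: "X2 x0 = D h2" unfolding D_def by (rule kernel_du_eq_range[OF v M(4) \<psi> y0(1) pM du0(2)])
  \<comment> \<open>The frame vectors at \<open>p\<close> are tangent to the surface, so they are
    images of parameter directions \<open>h1\<close> and \<open>h2\<close>. In these directions
    \<open>F'\<close> has the matrix whose determinant is \<open>nondeg\<close>.\<close>
  define L where "L = (\<lambda>z::real^2. (z $ 1) *\<^sub>R h1 + (z $ 2) *\<^sub>R h2)"
  have linL: "linear L" unfolding L_def by (intro linearI) (simp_all add: algebra_simps)
  have FL: "F' (L z) = (z $ 1 * A1 (X1 x0) + z $ 2 * A1 (X2 x0), z $ 1 * A2 (X1 x0) + z $ 2 * A2 (X2 x0))" for z
    unfolding F'_def L_def linear_add[OF linD] linear_cmul[OF linD] h1[symmetric] h2[symmetric]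
    by (simp add: linear_add[OF linA(1)] linear_cmul[OF linA(1)] linear_add[OF linA(2)] linear_cmul[OF linA(2)])
  \<comment> \<open>Cramer's rule with the determinant from \<open>nondeg\<close>.\<close>
  have FL0: "z = 0" if "F' (L z) = 0" for z
  proof -
    have eq: "z $ 1 * A1 (X1 x0) + z $ 2 * A1 (X2 x0) = 0" "z $ 1 * A2 (X1 x0) + z $ 2 * A2 (X2 x0) = 0"
      using that unfolding FL by (simp_all add: zero_prod_def)
    have "z $ 1 * (A1 (X1 x0) * A2 (X2 x0) - A1 (X2 x0) * A2 (X1 x0)) =
       (z $ 1 * A1 (X1 x0) + z $ 2 * A1 (X2 x0)) * A2 (X2 x0) - (z $ 1 * A2 (X1 x0) + z $ 2 * A2 (X2 x0)) * A1 (X2 x0)"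
      by (simp add: algebra_simps)
    then have 1: "z $ 1 = 0" using eq nondeg by simp
    have "z $ 2 * (A1 (X1 x0) * A2 (X2 x0) - A1 (X2 x0) * A2 (X1 x0)) =
       (z $ 1 * A2 (X1 x0) + z $ 2 * A2 (X2 x0)) * A1 (X1 x0) - (z $ 1 * A1 (X1 x0) + z $ 2 * A1 (X2 x0)) * A2 (X1 x0)"
      by (simp add: algebra_simps)
    then have "z $ 2 = 0" using eq nondeg by simp
    with 1 show ?thesis by (simp add: vec_eq_iff forall_2)
  qed
  have "inj L"
  proof (rule linear_injective_0[OF linL, THEN iffD2], intro allI impI)
    fix z assume "L z = 0"
    then show "z = 0" using FL0[of z] linear_0[OF linF] by simp
  qed
  then have surjL: "surj L" using linear_injective_imp_surjective[OF linL] by simp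
  have "inj F'"
  proof (rule linear_injective_0[OF linF, THEN iffD2], intro allI impI)
    fix h assume h: "F' h = 0"
    obtain z where z: "h = L z" using surjL by (metis surjD)
    have "z = 0" by (rule FL0) (use h z in simp)
    then show "h = 0" using z linear_0[OF linL] by simp
  qed
  from linear_growth_of_injective_derivative[OF dF F0 this]
  obtain k r where k: "k > 0" "r > 0" "\<forall>y. norm (y - y0) < r \<longrightarrow> k * norm (y - y0) \<le> norm (F y)"
    by (elim exE conjE)
  have normF: "norm (F y) = W v (chart_map c (\<psi> y))" for y
    by (simp add: F_def W_def norm_Pair power2_eq_square)
  have grow: "\<forall>\<^sub>F y in nhds y0. k * norm (y - y0) \<le> W v (chart_map c (\<psi> y))"
    unfolding eventually_nhds_metric using k(2,3) normF by (metis dist_norm)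
  have pS: "p \<in> \<Sigma> \<inter> M" using \<psi> y0 M(2) unfolding surface_param_def by blast
  obtain \<nu> where \<nu>: "du v (chart_map c p) \<nu> \<noteq> 0" using du_nonzero[OF v M(4) pS] by blast
  have pN: "\<psi> y0 \<in> N" using y0(2) uN(2) by simp
  have \<nu>': "du u (chart_map c p) \<nu> \<noteq> 0"
    using du_proportional(2)[OF v M(4) u \<psi> y0(1) pM pN] \<nu> by (simp add: y0(2))
  have du_cont: "continuous_on (chart_map c ` N') (\<lambda>x. du w x \<nu>)" if "Ck_fun A 2 N' w" "N' \<subseteq> U" for w N'
  proof -
    have "Ck_on 1 (chart_map c ` N') (\<lambda>x. du w x \<nu>)"
      using u_coordinates[OF that] by (simp add: numeral_2_eq_2 du_def)
    then show ?thesis by (rule Ck_on_continuous)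
  qed
  have cont: "isCont (\<lambda>y. du v (chart_map c (\<psi> y)) \<nu>) y0" "isCont (\<lambda>y. du u (chart_map c (\<psi> y)) \<nu>) y0"
    by (rule continuous_at_param[OF \<psi> c y0(1) pM M(1) _ du_cont[OF vC(1) M(4)]], use M(4) U_dom in blast)
      (rule continuous_at_param[OF \<psi> c y0(1) pN uN(1) _ du_cont[OF uN(3) u(2)]], use u(2) U_dom in blast)
  \<comment> \<open>The ratio of the differentials measured on the vector \<open>\<nu>\<close>,
    fixed at \<open>p\<close> and still transverse at nearby points. By continuity it stays above
    half its value at \<open>p\<close>, whence the constant \<open>q0 / 2 * k\<close>.\<close>
  define q where "q = (\<lambda>y. \<bar>du u (chart_map c (\<psi> y)) \<nu>\<bar> / \<bar>du v (chart_map c (\<psi> y)) \<nu>\<bar>)"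
  define q0 where "q0 = \<bar>du u (chart_map c p) \<nu>\<bar> / \<bar>du v (chart_map c p) \<nu>\<bar>"
  have q0: "q0 > 0" using \<nu> \<nu>' by (simp add: q0_def)
  have "isCont q y0"
    unfolding q_def using cont \<nu> by (intro continuous_divide continuous_rabs) (simp_all add: y0(2))
  then have "isCont (\<lambda>y. - q y) y0" by (rule continuous_minus)
  then have "\<forall>\<^sub>F y in nhds y0. - q y < - (q0 / 2)"
    by (rule isCont_eventually_less) (use q0 in \<open>simp add: q_def q0_def y0(2)\<close>)
  moreover have "isCont (\<lambda>y. - \<bar>du v (chart_map c (\<psi> y)) \<nu>\<bar>) y0" by (intro continuous_minus continuous_rabs cont)
  then have "\<forall>\<^sub>F y in nhds y0. - \<bar>du v (chart_map c (\<psi> y)) \<nu>\<bar> < 0"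
    by (rule isCont_eventually_less) (use \<nu> in \<open>simp add: y0(2)\<close>)
  moreover note param_eventually[OF \<psi> y0(1) pM M(1)] param_eventually[OF \<psi> y0(1) pN uN(1)] grow
  ultimately have "\<forall>\<^sub>F y in nhds y0. (q0 / 2 * k) * norm (y - y0) \<le> W u (chart_map c (\<psi> y))"
  proof eventually_elim
    case (elim y)
    let ?x = "chart_map c (\<psi> y)"
    have y: "y \<in> V" "\<psi> y \<in> M" "\<psi> y \<in> N" using elim by blast+
    have ne: "du v ?x \<nu> \<noteq> 0" using elim by simp
    define l where "l = du u ?x \<nu> / du v ?x \<nu>"
    have l: "a1 u ?x = l * a1 v ?x" "a2 u ?x = l * a2 v ?x"
      unfolding a1_def a2_def l_def by (rule du_proportional(1)[OF v M(4) u \<psi> y ne])+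
    have "W u ?x = sqrt (l\<^sup>2 * (a1 v ?x * a1 v ?x + a2 v ?x * a2 v ?x))"
      unfolding W_def l by (simp add: power2_eq_square algebra_simps)
    then have Wl: "W u ?x = \<bar>l\<bar> * W v ?x" unfolding W_def by (simp add: real_sqrt_mult)
    have "q0 / 2 \<le> \<bar>l\<bar>" using elim by (simp add: l_def q_def abs_divide)
    then have "(q0 / 2) * (k * norm (y - y0)) \<le> \<bar>l\<bar> * W v ?x"
      using elim q0 k(1) by (intro mult_mono) auto
    then show ?case unfolding Wl by (simp only: mult.assoc)
  qed
  moreover have "q0 / 2 * k > 0" using q0 k(1) by simp
  ultimately show ?thesis by blast
qed

lemma continuous_normal_data:
  assumes \<rho>: "smooth_positive_density A \<rho>" and u: "Ck_fun A 2 N u" and N: "open N" "N \<subseteq> U"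
  shows "continuous_on (chart_map c ` N) (a1 u)" "continuous_on (chart_map c ` N) (a2 u)"
    "continuous_on (chart_map c ` N) (W u)"
    "\<And>X. Ck_on 0 (chart_map c ` N) X \<Longrightarrow> continuous_on (chart_map c ` N) (\<lambda>x. frechet_derivative (a1 u) (at x) (X x))"
    "\<And>X. Ck_on 0 (chart_map c ` N) X \<Longrightarrow> continuous_on (chart_map c ` N) (\<lambda>x. frechet_derivative (a2 u) (at x) (X x))"
    "continuous_on (chart_map c ` N) (frame_div \<rho> X1)" "continuous_on (chart_map c ` N) (frame_div \<rho> X2)"
proof -
  have u': "Ck_fun A (Suc 1) N u" using u by (simp add: numeral_2_eq_2)
  have o: "open (chart_map c ` N)" by (rule open_coordinates[OF N])
  note a = Ck_a[OF u' N]
  show c12: "continuous_on (chart_map c ` N) (a1 u)" "continuous_on (chart_map c ` N) (a2 u)"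
    by (rule Ck_on_continuous[OF a(1)], rule Ck_on_continuous[OF a(2)])
  show "continuous_on (chart_map c ` N) (W u)"
    unfolding W_def[abs_def] by (intro continuous_intros c12)
  show "continuous_on (chart_map c ` N) (\<lambda>x. frechet_derivative (a1 u) (at x) (X x))"
    "continuous_on (chart_map c ` N) (\<lambda>x. frechet_derivative (a2 u) (at x) (X x))"
    if "Ck_on 0 (chart_map c ` N) X" for X
    by (rule Ck_on_continuous[OF Ck_on_dir_derivative[OF o a(1)[unfolded One_nat_def] that]])
      (rule Ck_on_continuous[OF Ck_on_dir_derivative[OF o a(2)[unfolded One_nat_def] that]])
  have ran: "chart_map c ` N \<subseteq> chart_ran c" using N(2) U_dom by blast
  have fd: "continuous_on (chart_map c ` N) (frame_div \<rho> X)" if X: "\<And>k. Ck_on k (chart_map c ` N) X" for X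
  proof -
    have 1: "continuous_on (chart_map c ` N) (\<lambda>x. frechet_derivative (\<rho> c) (at x) (X x))"
      by (rule Ck_on_continuous[OF Ck_on_dir_derivative[OF o Ck_on_subset[OF Ck_density[OF \<rho> c] ran] X]])
    have 2: "continuous_on (chart_map c ` N) (\<rho> c)"
      by (rule Ck_on_continuous[OF Ck_on_subset[OF Ck_density[OF \<rho> c] ran]])
    have 3: "continuous_on (chart_map c ` N) (\<lambda>x. frechet_derivative X (at x) e)" for e
      by (rule Ck_on_continuous[OF Ck_on_dir_derivative[OF o X Ck_on_const]])
    have "\<rho> c x \<noteq> 0" if "x \<in> chart_map c ` N" for x
      using density_pos[OF \<rho> c subsetD[OF ran that]] by simp
    then show ?thesis
      unfolding frame_div_def[abs_def] trace_matrix
      by (intro continuous_on_add continuous_on_divide continuous_on_sum continuous_on_component 1 2 3) blast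
  qed
  show "continuous_on (chart_map c ` N) (frame_div \<rho> X1)" "continuous_on (chart_map c ` N) (frame_div \<rho> X2)"
    by (rule fd[OF Ck_on_subset[OF Ck_frame(1) image_mono[OF N(2)]]],
      rule fd[OF Ck_on_subset[OF Ck_frame(2) image_mono[OF N(2)]]])
qed

text \<open>Since \<open>tangent_dir\<close> contributes one more factor, the first numerator is
  quadratic in \<open>(a1, a2)\<close> and hence bounded by \<open>W^2\<close> times first
  derivatives; over \<open>W^3\<close> this leaves \<open>1 / W\<close>. The second term is bounded
  and is written over \<open>W\<close> only to share the denominator.\<close>

lemma abs_normal_div_le:
  assumes u: "Ck_fun A 2 N u" and N: "open N" "N \<subseteq> U" and x: "x \<in> chart_map c ` N" and W0: "W u x > 0"
  shows "\<bar>normal_div \<rho> u x\<bar> \<le>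
    (\<bar>frechet_derivative (a1 u) (at x) (X1 x)\<bar> + \<bar>frechet_derivative (a1 u) (at x) (X2 x)\<bar> +
     \<bar>frechet_derivative (a2 u) (at x) (X1 x)\<bar> + \<bar>frechet_derivative (a2 u) (at x) (X2 x)\<bar> +
     W u x * (\<bar>frame_div \<rho> X1 x\<bar> + \<bar>frame_div \<rho> X2 x\<bar>)) / W u x"
proof -
  have u': "Ck_fun A (Suc 1) N u" using u by (simp add: numeral_2_eq_2)
  define A1 where "A1 = frechet_derivative (a1 u) (at x)"
  define A2 where "A2 = frechet_derivative (a2 u) (at x)"
  have lin: "linear A1" "linear A2"
    unfolding A1_def A2_def
    by (rule has_derivative_linear[OF Ck_on_has_derivative[OF Ck_a(1)[OF u' N] zero_less_one x]])
      (rule has_derivative_linear[OF Ck_on_has_derivative[OF Ck_a(2)[OF u' N] zero_less_one x]])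
  define w where "w = W u x"
  define a where "a = a1 u x"
  define b where "b = a2 u x"
  have w: "w > 0" "\<bar>a\<bar> \<le> w" "\<bar>b\<bar> \<le> w"
    using W0 unfolding w_def a_def b_def W_def by (auto intro!: real_le_rsqrt simp: power2_eq_square)
  have prod: "\<bar>s * t * z\<bar> \<le> w * w * \<bar>z\<bar>" if "\<bar>s\<bar> \<le> w" "\<bar>t\<bar> \<le> w" for s t z
    unfolding abs_mult using that w(1) by (intro mult_right_mono mult_mono) auto
  have "a * A2 (tangent_dir u x) - b * A1 (tangent_dir u x) =
      a * a * A2 (X2 x) - a * b * A2 (X1 x) - b * a * A1 (X2 x) + b * b * A1 (X1 x)"
    unfolding tangent_dir_def a_def[symmetric] b_def[symmetric]
    by (simp add: linear_diff[OF lin(1)] linear_diff[OF lin(2)] linear_cmul[OF lin(1)] linear_cmul[OF lin(2)] algebra_simps)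
  then have "\<bar>a * A2 (tangent_dir u x) - b * A1 (tangent_dir u x)\<bar> \<le>
      \<bar>a * a * A2 (X2 x)\<bar> + \<bar>a * b * A2 (X1 x)\<bar> + \<bar>b * a * A1 (X2 x)\<bar> + \<bar>b * b * A1 (X1 x)\<bar>" by linarith
  also have "\<dots> \<le> w * w * \<bar>A2 (X2 x)\<bar> + w * w * \<bar>A2 (X1 x)\<bar> + w * w * \<bar>A1 (X2 x)\<bar> + w * w * \<bar>A1 (X1 x)\<bar>"
    by (intro add_mono prod w(2,3))
  finally have n: "\<bar>a * A2 (tangent_dir u x) - b * A1 (tangent_dir u x)\<bar> \<le>
      w * w * (\<bar>A1 (X1 x)\<bar> + \<bar>A1 (X2 x)\<bar> + \<bar>A2 (X1 x)\<bar> + \<bar>A2 (X2 x)\<bar>)" by (simp add: algebra_simps)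
  have "\<bar>(a * A2 (tangent_dir u x) - b * A1 (tangent_dir u x)) / w ^ 3\<bar> \<le>
      w * w * (\<bar>A1 (X1 x)\<bar> + \<bar>A1 (X2 x)\<bar> + \<bar>A2 (X1 x)\<bar> + \<bar>A2 (X2 x)\<bar>) / w ^ 3"
    unfolding abs_divide using n w(1) by (simp add: divide_right_mono)
  also have "\<dots> = (\<bar>A1 (X1 x)\<bar> + \<bar>A1 (X2 x)\<bar> + \<bar>A2 (X1 x)\<bar> + \<bar>A2 (X2 x)\<bar>) / w"
    using w(1) by (simp add: power3_eq_cube)
  finally have 1: "\<bar>(a * A2 (tangent_dir u x) - b * A1 (tangent_dir u x)) / w ^ 3\<bar> \<le>
      (\<bar>A1 (X1 x)\<bar> + \<bar>A1 (X2 x)\<bar> + \<bar>A2 (X1 x)\<bar> + \<bar>A2 (X2 x)\<bar>) / w" .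
  have "\<bar>a * frame_div \<rho> X1 x + b * frame_div \<rho> X2 x\<bar> \<le> \<bar>a\<bar> * \<bar>frame_div \<rho> X1 x\<bar> + \<bar>b\<bar> * \<bar>frame_div \<rho> X2 x\<bar>"
    unfolding abs_mult[symmetric] by (rule abs_triangle_ineq)
  also have "\<dots> \<le> w * \<bar>frame_div \<rho> X1 x\<bar> + w * \<bar>frame_div \<rho> X2 x\<bar>"
    by (intro add_mono mult_right_mono w(2,3)) auto
  finally have 2: "\<bar>(a * frame_div \<rho> X1 x + b * frame_div \<rho> X2 x) / w\<bar> \<le> w * (\<bar>frame_div \<rho> X1 x\<bar> + \<bar>frame_div \<rho> X2 x\<bar>) / w"
    unfolding abs_divide using w(1) by (simp add: divide_right_mono distrib_left)
  show ?thesis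
    unfolding normal_div_def A1_def[symmetric] A2_def[symmetric] w_def[symmetric] a_def[symmetric] b_def[symmetric]
      add_divide_distrib[of "\<bar>A1 (X1 x)\<bar> + \<bar>A1 (X2 x)\<bar> + \<bar>A2 (X1 x)\<bar> + \<bar>A2 (X2 x)\<bar>"]
    using 1 2 abs_triangle_ineq by (meson add_mono order_trans)
qed

text \<open>The numerator of the preceding estimate is continuous, because \<open>u\<close> is of
  class C^2, and is therefore bounded near \<open>y0\<close>. The premise \<open>W > 0\<close> sets
  aside the zeros of \<open>W\<close>.\<close>

lemma normal_div_bound:
  assumes \<rho>: "smooth_positive_density A \<rho>" and u: "Ck_fun A 2 N u" and N: "open N" "N \<subseteq> U"
    and \<psi>: "surface_param A \<Sigma> V \<psi>" and y0: "y0 \<in> V" "\<psi> y0 \<in> N"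
  shows "\<exists>C\<ge>0. \<forall>\<^sub>F y in nhds y0. W u (chart_map c (\<psi> y)) > 0 \<longrightarrow>
     \<bar>normal_div \<rho> u (chart_map c (\<psi> y))\<bar> \<le> C / W u (chart_map c (\<psi> y))"
proof -
  define Q where "Q = (\<lambda>x. \<bar>frechet_derivative (a1 u) (at x) (X1 x)\<bar> + \<bar>frechet_derivative (a1 u) (at x) (X2 x)\<bar> +
     \<bar>frechet_derivative (a2 u) (at x) (X1 x)\<bar> + \<bar>frechet_derivative (a2 u) (at x) (X2 x)\<bar> +
     W u x * (\<bar>frame_div \<rho> X1 x\<bar> + \<bar>frame_div \<rho> X2 x\<bar>))"
  note cn = continuous_normal_data[OF \<rho> u N]
  have X: "Ck_on 0 (chart_map c ` N) X1" "Ck_on 0 (chart_map c ` N) X2"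
    by (rule Ck_on_subset[OF Ck_frame(1) image_mono[OF N(2)]], rule Ck_on_subset[OF Ck_frame(2) image_mono[OF N(2)]])
  have "continuous_on (chart_map c ` N) Q"
    unfolding Q_def
    by (intro continuous_on_add continuous_on_mult continuous_on_rabs cn(3) cn(4)[OF X(1)] cn(4)[OF X(2)]
        cn(5)[OF X(1)] cn(5)[OF X(2)] cn(6) cn(7))
  then have "isCont (\<lambda>y. Q (chart_map c (\<psi> y))) y0"
    by (rule continuous_at_param[OF \<psi> c y0 N(1), rotated]) (use N(2) U_dom in blast)
  then have "\<forall>\<^sub>F y in nhds y0. Q (chart_map c (\<psi> y)) < \<bar>Q (chart_map c (\<psi> y0))\<bar> + 1"
    by (rule isCont_eventually_less) linarith
  with param_eventually[OF \<psi> y0 N(1)]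
  have "\<forall>\<^sub>F y in nhds y0. W u (chart_map c (\<psi> y)) > 0 \<longrightarrow>
     \<bar>normal_div \<rho> u (chart_map c (\<psi> y))\<bar> \<le> (\<bar>Q (chart_map c (\<psi> y0))\<bar> + 1) / W u (chart_map c (\<psi> y))"
  proof eventually_elim
    case (elim y)
    show ?case
    proof
      assume W0: "W u (chart_map c (\<psi> y)) > 0"
      have "chart_map c (\<psi> y) \<in> chart_map c ` N" using elim by blast
      from abs_normal_div_le[OF u N this W0, of \<rho>]
      have "\<bar>normal_div \<rho> u (chart_map c (\<psi> y))\<bar> \<le> Q (chart_map c (\<psi> y)) / W u (chart_map c (\<psi> y))"
        unfolding Q_def .
      also have "\<dots> \<le> (\<bar>Q (chart_map c (\<psi> y0))\<bar> + 1) / W u (chart_map c (\<psi> y))"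
        using elim W0 by (intro divide_right_mono) auto
      finally show "\<bar>normal_div \<rho> u (chart_map c (\<psi> y))\<bar> \<le> (\<bar>Q (chart_map c (\<psi> y0))\<bar> + 1) / W u (chart_map c (\<psi> y))" .
    qed
  qed
  then show ?thesis by (intro exI[of _ "\<bar>Q (chart_map c (\<psi> y0))\<bar> + 1"]) auto
qed

text \<open>\<open>normal_div\<close> need not be continuous where \<open>W\<close> vanishes, but it
  is built from continuous functions by total division and is therefore Borel on all of
  \<open>Z\<close>.\<close>

lemma measurable_normal_data:
  assumes \<rho>: "smooth_positive_density A \<rho>" and u: "Ck_fun A 2 N u" and N: "open N" "N \<subseteq> U" and Z: "Z \<subseteq> N"
  shows "(\<lambda>q. W u (chart_map c q)) \<in> borel_measurable (restrict_space borel Z)"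
    "(\<lambda>q. normal_div \<rho> u (chart_map c q)) \<in> borel_measurable (restrict_space borel Z)"
proof -
  note cn = continuous_normal_data[OF \<rho> u N]
  have comp: "(\<lambda>q. f (chart_map c q)) \<in> borel_measurable (restrict_space borel Z)"
    if "continuous_on (chart_map c ` N) f" for f :: "real^3 \<Rightarrow> real"
  proof (rule borel_measurable_continuous_on_restrict[OF continuous_on_compose2[OF that]])
    show "continuous_on Z (chart_map c)"
      by (rule continuous_on_subset[OF continuous_map[OF c]]) (use Z N(2) U_dom in blast)
  qed (use Z in blast)
  show W: "(\<lambda>q. W u (chart_map c q)) \<in> borel_measurable (restrict_space borel Z)"
    by (rule comp[OF cn(3)])
  have X: "Ck_on 0 (chart_map c ` N) X1" "Ck_on 0 (chart_map c ` N) X2"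
    by (rule Ck_on_subset[OF Ck_frame(1) image_mono[OF N(2)]], rule Ck_on_subset[OF Ck_frame(2) image_mono[OF N(2)]])
  have T: "Ck_on 0 (chart_map c ` N) (tangent_dir u)"
    using cn(1,2) X unfolding tangent_dir_def[abs_def] by (simp add: continuous_intros)
  show "(\<lambda>q. normal_div \<rho> u (chart_map c q)) \<in> borel_measurable (restrict_space borel Z)"
    unfolding normal_div_def
    by (intro borel_measurable_add borel_measurable_divide borel_measurable_diff borel_measurable_times
        borel_measurable_power comp cn(1,2,3,6,7) cn(4)[OF T] cn(5)[OF T])
qed

end

section \<open>Images of open and Borel sets under parametrizations\<close>

lemma surface_param_image_open:
  assumes \<psi>: "surface_param A \<Sigma> V \<psi>" and B: "open B" "B \<subseteq> V"
  obtains E where "open E" "\<psi> ` B = \<Sigma> \<inter> E"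
proof -
  have V: "openin (top_of_set \<Sigma>) (\<psi> ` V)" using \<psi> unfolding surface_param_def by blast
  obtain \<psi>' where h: "homeomorphism V (\<psi> ` V) \<psi> \<psi>'"
    using \<psi> unfolding surface_param_def by (elim conjE exE)
  have "openin (top_of_set V) B" using B unfolding openin_open by blast
  then have "openin (top_of_set (\<psi> ` V)) (\<psi> ` B)" by (rule homeomorphism_imp_open_map[OF h])
  then have "openin (top_of_set \<Sigma>) (\<psi> ` B)" using openin_trans[OF _ V] by blast
  then show thesis using that unfolding openin_open by blast
qed

text \<open>The image of \<open>B\<close> is the preimage of \<open>B\<close> under the continuous
  inverse, hence Borel relative to the image of \<open>V\<close>; the latter is the trace of an open
  set on the surface.\<close>

lemma surface_param_image_borel:
  fixes A :: "'m::topological_space chart set"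
  assumes \<psi>: "surface_param A \<Sigma> V \<psi>" and B: "B \<in> sets borel" "B \<subseteq> V"
  shows "\<psi> ` B \<in> sets (restrict_space borel \<Sigma>)"
proof -
  obtain \<psi>' where h: "homeomorphism V (\<psi> ` V) \<psi> \<psi>'"
    using \<psi> unfolding surface_param_def by (elim conjE exE)
  have V: "open V" using \<psi> unfolding surface_param_def by blast
  obtain E where E: "open E" "\<psi> ` V = \<Sigma> \<inter> E"
    by (rule surface_param_image_open[OF \<psi> V order_refl])
  have h': "\<And>y. y \<in> V \<Longrightarrow> \<psi>' (\<psi> y) = y" "continuous_on (\<psi> ` V) \<psi>'"
    using h unfolding homeomorphism_def by blast+
  have "\<psi>' \<in> borel_measurable (restrict_space borel (\<psi> ` V))"
    by (rule borel_measurable_continuous_on_restrict[OF h'(2)])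
  from measurable_sets[OF this B(1)]
  have "\<psi>' -` B \<inter> \<psi> ` V \<in> sets (restrict_space borel (\<psi> ` V))" by (simp add: space_restrict_space)
  moreover have "\<psi>' -` B \<inter> \<psi> ` V = \<psi> ` B" using h'(1) B(2) by force
  ultimately obtain F where F: "F \<in> sets borel" "\<psi> ` B = \<psi> ` V \<inter> F"
    by (auto simp: sets_restrict_space)
  then have "\<psi> ` B = \<Sigma> \<inter> (E \<inter> F)" "E \<inter> F \<in> sets borel" using E by auto
  then show ?thesis unfolding sets_restrict_space by blast
qed

section \<open>Combination of the estimates on one small parameter disc\<close>

theorem theorem3p2:
  fixes A :: "'m::{second_countable_topology,t2_space} chart set"
    and \<omega> :: "'m \<Rightarrow> 'm tvec \<Rightarrow> real"
    and g G :: "'m \<Rightarrow> 'm tvec \<Rightarrow> 'm tvec \<Rightarrow> real"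
    and \<rho> :: "'m chart \<Rightarrow> real^3 \<Rightarrow> real"
    and \<mu> \<sigma> :: "'m measure"
    and \<Sigma> U :: "'m set"
    and n :: "'m \<Rightarrow> 'm tvec"
    and p :: 'm
    and u :: "'m \<Rightarrow> real"
  assumes "contact_sub_riemannian A \<omega> g"
    and "smooth_measure A \<rho> \<mu>"
    and "embedded_C2_surface A \<Sigma>"
    and "p isolated_in characteristic_set A \<omega> \<Sigma>"
    and "nondegenerate_characteristic_point A \<omega> g \<Sigma> p"
    and "local_defining_function A \<Sigma> p U u"
    and "riemannian_extension A \<omega> g G"
    and "unit_normal A G \<Sigma> n"
    and "riemannian_induced_measure A \<rho> \<Sigma> n \<sigma>"
  shows "(\<exists>U'. open U' \<and> p \<in> U' \<and> U' \<subseteq> U \<and>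
            finite_integral_over \<sigma> (\<Sigma> \<inter> U') (\<lambda>q. 1 / ennreal (hgrad_norm A \<omega> g u q)))
       \<and> (\<forall>H. horizontal_mean_curvature A \<omega> g \<rho> \<Sigma> H \<longrightarrow>
            (\<exists>U'. open U' \<and> p \<in> U' \<and>
               finite_integral_over \<sigma> (\<Sigma> \<inter> U') (\<lambda>q. ennreal \<bar>H q\<bar>)))"
proof -
  have at: "smooth_atlas A" and cf: "contact_form A \<omega>" and met: "smooth_metric_on A (distribution A \<omega>) g"
    using assms(1) unfolding contact_sub_riemannian_def by blast+
  have om: "smooth_one_form A \<omega>" using cf unfolding contact_form_def by blast
  \<comment> \<open>Every summand in the contact condition has a value of the form as a
    factor.\<close>
  have nz: "\<exists>v\<in>tangent A q. \<omega> q v \<noteq> 0" for q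
  proof (rule ccontr)
    assume "\<not> ?thesis"
    then have "\<omega> q v = 0" if "v \<in> tangent A q" for v using that by blast
    moreover obtain v1 v2 v3 where "v1 \<in> tangent A q" "v2 \<in> tangent A q" "v3 \<in> tangent A q"
      "\<omega> q v1 * ext_deriv A \<omega> q v2 v3 + \<omega> q v2 * ext_deriv A \<omega> q v3 v1 + \<omega> q v3 * ext_deriv A \<omega> q v1 v2 \<noteq> 0"
      using cf unfolding contact_form_def by blast
    ultimately show False by simp
  qed
  interpret sub_riemannian A \<omega> g
    by (unfold_locales) (rule at om nz met)+
  have \<rho>: "smooth_positive_density A \<rho>" using assms(2) unfolding smooth_measure_def by blast
  have G: "smooth_metric_on A (tangent A) G" using assms(7) unfolding riemannian_extension_def by blast
  obtain c where c: "c \<in> A" "p \<in> chart_dom c" using ex_chart by blast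
  obtain U0 X1 X2 where fr: "framed_chart A \<omega> g c U0 X1 X2" and pU0: "p \<in> U0"
    using ex_framed_chart[OF c] by (elim exE conjE)
  interpret framed_chart A \<omega> g c U0 X1 X2 by (rule fr)
  define N where "N = U \<inter> U0"
  have oU: "open U" "p \<in> U" using assms(6) unfolding local_defining_function_def by blast+
  have N: "open N" "N \<subseteq> U0" "N \<subseteq> U" "p \<in> N" using oU open_U pU0 by (auto simp: N_def)
  have u: "local_defining_function A \<Sigma> p N u" by (rule local_defining_function_mono[OF assms(6) N(1,3,4)])
  have uC: "Ck_fun A 2 N u" "Ck_fun A (Suc 1) N u"
    using u unfolding local_defining_function_def by (simp_all add: numeral_2_eq_2)
  obtain T where T: "open T" "T \<inter> characteristic_set A \<omega> \<Sigma> = {p}" and pchar: "p \<in> characteristic_set A \<omega> \<Sigma>"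
    using assms(4) unfolding isolated_in_def by blast
  have pT: "p \<in> T" using T(2) by blast
  have pS: "p \<in> \<Sigma>" using pchar unfolding characteristic_set_def by blast
  obtain V \<psi> where \<psi>: "surface_param A \<Sigma> V \<psi>" and "p \<in> \<psi> ` V"
    using assms(3) pS unfolding embedded_C2_surface_def by blast
  then obtain y0 where y0: "y0 \<in> V" "\<psi> y0 = p" by blast
  let ?J = "\<lambda>y. density_eval A \<rho> (\<psi> y) (n (\<psi> y)) (push A \<psi> y (axis 1 1)) (push A \<psi> y (axis 2 1))"
  let ?x = "\<lambda>y. chart_map c (\<psi> y)"
  have V: "\<psi> ` V \<subseteq> \<Sigma>" "inj_on \<psi> V"
    using \<psi> unfolding surface_param_def homeomorphism_def by (blast, metis inj_on_inverseI)
  obtain k where k: "k > 0" "\<forall>\<^sub>F y in nhds y0. k * norm (y - y0) \<le> W u (?x y)"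
    using W_lower_bound[OF assms(5) u N(2) \<psi> y0] by blast
  obtain C where C: "C \<ge> 0" "\<forall>\<^sub>F y in nhds y0. W u (?x y) > 0 \<longrightarrow>
     \<bar>normal_div \<rho> u (?x y)\<bar> \<le> C / W u (?x y)"
    using normal_div_bound[OF \<rho> uC(1) N(1,2) \<psi> y0(1)] N(4) y0(2) by blast
  obtain K where K: "K \<ge> 0" "\<forall>\<^sub>F y in nhds y0.
      ?J y \<le> K"
    using density_on_surface_bounded[OF \<rho> G assms(8) \<psi> y0(1)] by blast
  have "\<forall>\<^sub>F y in nhds y0. y \<in> V \<and> \<psi> y \<in> N \<inter> T"
    by (rule param_eventually[OF \<psi> y0(1)]) (use N T(1) pT y0(2) in auto)
  with k(2) C(2) K(2) have "\<forall>\<^sub>F y in nhds y0. (y \<in> V \<and> \<psi> y \<in> N \<inter> T) \<and> k * norm (y - y0) \<le> W u (?x y) \<and>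
     (W u (?x y) > 0 \<longrightarrow>
       \<bar>normal_div \<rho> u (?x y)\<bar> \<le> C / W u (?x y)) \<and>
      ?J y \<le> K"
    by eventually_elim blast
  then obtain r where r: "r > 0" and all: "\<And>y. dist y y0 < r \<Longrightarrow> (y \<in> V \<and> \<psi> y \<in> N \<inter> T) \<and> k * norm (y - y0) \<le> W u (?x y) \<and>
     (W u (?x y) > 0 \<longrightarrow>
       \<bar>normal_div \<rho> u (?x y)\<bar> \<le> C / W u (?x y)) \<and>
      ?J y \<le> K"
    unfolding eventually_nhds_metric by blast
  have near: "y \<in> V" "\<psi> y \<in> N" "\<psi> y \<in> T" "k * norm (y - y0) \<le> W u (?x y)"
     "W u (?x y) > 0 \<Longrightarrow> \<bar>normal_div \<rho> u (?x y)\<bar> \<le> C / W u (?x y)"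
     "?J y \<le> K"
    if "y \<in> ball y0 r" for y
    using all[of y] that by (simp_all add: dist_commute)
  have W_pos: "W u (?x y) > 0" if "y \<in> ball y0 r" "y \<noteq> y0" for y
    using near(4)[OF that(1)] mult_pos_pos[OF k(1), of "norm (y - y0)"] that(2) by simp
  have W_inv: "C' / W u (?x y) \<le> (C' / k) / norm (y - y0)"
    if "y \<in> ball y0 r" "y \<noteq> y0" "C' \<ge> 0" for y C'
  proof -
    have "C' / W u (?x y) \<le> C' / (k * norm (y - y0))"
      using near(4)[OF that(1)] W_pos[OF that(1,2)] k(1) that by (intro divide_left_mono mult_pos_pos) auto
    then show ?thesis by simp
  qed
  let ?Z = "\<psi> ` ball y0 r"
  have ball_V: "ball y0 r \<subseteq> V" using near(1) by blast
  have Z_N: "?Z \<subseteq> N" using near(2) by blast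
  obtain E where E: "open E" "?Z = \<Sigma> \<inter> E"
    by (rule surface_param_image_open[OF \<psi> open_ball ball_V])
  \<comment> \<open>Intersecting with \<open>N\<close> brings the set inside \<open>U\<close>. Its
    trace on the surface is still the image of the disc, because that image already lies in
    \<open>N\<close>.\<close>
  define U' where "U' = E \<inter> N"
  have U': "open U'" "U' \<subseteq> U" "\<Sigma> \<inter> U' = ?Z" using E N Z_N by (auto simp: U'_def)
  have pZ: "p \<in> ?Z" using y0(2) r by force
  then have pU': "p \<in> U'" using U'(3) by blast
  have sets_\<sigma>: "sets \<sigma> = sets (restrict_space borel \<Sigma>)"
    using assms(9) unfolding riemannian_induced_measure_def by blast
  have Z_sets: "?Z \<in> sets \<sigma>"
    unfolding sets_\<sigma> by (rule surface_param_image_borel[OF \<psi> _ ball_V]) simp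
  have B_sets: "\<psi> ` B \<in> sets \<sigma>" if "B \<in> sets borel" "B \<subseteq> ball y0 r" for B
    unfolding sets_\<sigma> by (rule surface_param_image_borel[OF \<psi> that(1)]) (use that(2) ball_V in blast)
  have B_measure: "emeasure \<sigma> (\<psi> ` B) \<le> ennreal K * emeasure lborel B" if B: "B \<in> sets borel" "B \<subseteq> ball y0 r" for B
  proof -
    have "emeasure \<sigma> (\<psi> ` B) = (\<integral>\<^sup>+y\<in>B. ennreal (?J y) \<partial>lborel)"
      using assms(9) \<psi> B ball_V unfolding riemannian_induced_measure_def by blast
    also have "\<dots> \<le> (\<integral>\<^sup>+y. ennreal K * indicator B y \<partial>lborel)"
    proof (rule nn_integral_mono)
      fix y
      show "ennreal (?J y) * indicator B y
        \<le> ennreal K * indicator B y"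
        using ennreal_leI[OF near(6)[OF subsetD[OF B(2)]], of y] by (cases "y \<in> B") simp_all
    qed
    also have "\<dots> = ennreal K * emeasure lborel B"
      by (rule nn_integral_cmult_indicator) (use B(1) in simp)
    finally show ?thesis .
  qed
  \<comment> \<open>Common to both integrals: away from \<open>y0\<close>, a bound by a multiple of
    the inverse distance suffices. Measurability may be checked for the Borel sets of the image of
    the disc, since that image is contained in the surface.\<close>
  have finite: "finite_integral_over \<sigma> (\<Sigma> \<inter> U') f"
    if f: "f \<in> borel_measurable (restrict_space borel ?Z)" and C': "C' \<ge> 0"
      and le: "\<And>y. y \<in> ball y0 r \<Longrightarrow> y \<noteq> y0 \<Longrightarrow> f (\<psi> y) \<le> ennreal (C' / norm (y - y0))" for f C'
    unfolding finite_integral_over_def U'(3)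
  proof (intro conjI Z_sets)
    have "sets (restrict_space \<sigma> ?Z) = sets (restrict_space (restrict_space borel \<Sigma>) ?Z)"
      by (rule sets_restrict_space_cong[OF sets_\<sigma>])
    also have "\<dots> = sets (restrict_space borel ?Z)"
      using E(2) unfolding sets_restrict_space image_image by (auto intro!: image_cong)
    finally show "f \<in> borel_measurable (restrict_space \<sigma> ?Z)"
      using f by (simp cong: measurable_cong_sets)
    show "(\<integral>\<^sup>+x\<in>?Z. f x \<partial>\<sigma>) < \<infinity>"
      by (rule nn_integral_dyadic_finite[OF r C' K(1) B_sets B_measure le])
  qed
  have hW: "hgrad_norm A \<omega> g u q = W u (chart_map c q)" if "q \<in> N" for q
    by (rule hgrad_norm_coordinates[OF uC(2) N(2) that])
  note meas = measurable_normal_data[OF \<rho> uC(1) N(1,2) Z_N]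
  have space_Z: "q \<in> space (restrict_space borel ?Z) \<Longrightarrow> q \<in> ?Z" for q :: 'm
    by (simp add: space_restrict_space)
  show ?thesis
  proof (intro conjI allI impI)
    have "finite_integral_over \<sigma> (\<Sigma> \<inter> U') (\<lambda>q. 1 / ennreal (hgrad_norm A \<omega> g u q))"
    proof (rule finite[where C' = "1 / k"])
      have "(\<lambda>q. 1 / ennreal (W u (chart_map c q))) \<in> borel_measurable (restrict_space borel ?Z)"
        using meas(1) by measurable
      then show "(\<lambda>q. 1 / ennreal (hgrad_norm A \<omega> g u q)) \<in> borel_measurable (restrict_space borel ?Z)"
        by (rule iffD1[OF measurable_cong, rotated]) (simp add: hW[OF subsetD[OF Z_N space_Z]])
      fix y assume y: "y \<in> ball y0 r" "y \<noteq> y0"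
      have "1 / ennreal (W u (?x y)) = ennreal (1 / W u (?x y))"
        using divide_ennreal[of 1, OF _ W_pos[OF y]] by simp
      then show "1 / ennreal (hgrad_norm A \<omega> g u (\<psi> y)) \<le> ennreal (1 / k / norm (y - y0))"
        using W_inv[OF y, of 1] by (simp add: hW[OF near(2)[OF y(1)]] ennreal_leI)
    qed (use k(1) in simp)
    then show "\<exists>U'. open U' \<and> p \<in> U' \<and> U' \<subseteq> U \<and>
        finite_integral_over \<sigma> (\<Sigma> \<inter> U') (\<lambda>q. 1 / ennreal (hgrad_norm A \<omega> g u q))"
      using U'(1,2) pU' by blast
  next
    fix H assume H: "horizontal_mean_curvature A \<omega> g \<rho> \<Sigma> H"
    \<comment> \<open>Injectivity of the parametrization and the choice of \<open>T\<close> make the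
      point noncharacteristic, so \<open>H\<close> is given there by some defining function
      \<open>u2\<close> of its own. The absolute value removes both the minus sign and the sign
      ambiguity, and \<open>u2\<close> can be replaced by \<open>u\<close>.\<close>
    have H_eq: "\<bar>H (\<psi> y)\<bar> = \<bar>normal_div \<rho> u (?x y)\<bar>" if y: "y \<in> ball y0 r" "y \<noteq> y0" for y
    proof -
      let ?q = "\<psi> y"
      have "?q \<noteq> p" using inj_onD[OF V(2), of y y0] near(1)[OF y(1)] y0 y(2) by auto
      then have "?q \<notin> characteristic_set A \<omega> \<Sigma>" using T(2) near(3)[OF y(1)] by blast
      moreover have "?q \<in> \<Sigma>" using V(1) near(1)[OF y(1)] by blast
      ultimately obtain U2 u2 where u2: "local_defining_function A \<Sigma> ?q U2 u2"
        and Hq: "H ?q = - divergence A \<rho> (\<lambda>x. tscale (1 / hgrad_norm A \<omega> g u2 x) (hgrad A \<omega> g u2 x)) ?q"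
        using H unfolding horizontal_mean_curvature_def by blast
      define M where "M = U2 \<inter> U0"
      have M: "open M" "M \<subseteq> U2" "M \<subseteq> U0" "?q \<in> M"
        using u2 open_U near(2)[OF y(1)] N(2) unfolding local_defining_function_def M_def by blast+
      have u2': "local_defining_function A \<Sigma> ?q M u2" by (rule local_defining_function_mono[OF u2 M(1,2,4)])
      have C2: "Ck_fun A 2 M u2" using u2' unfolding local_defining_function_def by blast
      have W0: "W u (chart_map c ?q) \<noteq> 0" using W_pos[OF y] by simp
      note indep = abs_normal_div_independent[OF u N(2) u2' M(3) \<psi> near(1)[OF y(1)] near(2)[OF y(1)] M(4) W0]
      show ?thesis
        unfolding Hq divergence_normal[OF \<rho> C2 M(1,3,4) indep(2)] using indep(1)[of \<rho>] by simp
    qed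
    have "finite_integral_over \<sigma> (\<Sigma> \<inter> U') (\<lambda>q. ennreal \<bar>H q\<bar>)"
    proof (rule finite[where C' = "C / k"])
      \<comment> \<open>At the characteristic point \<open>p\<close> the value of \<open>H\<close>
        is arbitrary, so it is split off on the closed set \<open>{p}\<close>; elsewhere
        \<open>H\<close> has the absolute value of a Borel function.\<close>
      have "(\<lambda>q. if q = p then ennreal \<bar>H p\<bar> else ennreal \<bar>normal_div \<rho> u (chart_map c q)\<bar>) \<in> borel_measurable (restrict_space borel ?Z)"
      proof (rule measurable_If)
        show "(\<lambda>q. ennreal \<bar>normal_div \<rho> u (chart_map c q)\<bar>) \<in> borel_measurable (restrict_space borel ?Z)"
          using meas(2) by measurable
        have "{q \<in> space (restrict_space borel ?Z). q = p} = ?Z \<inter> {p}" by (auto simp: space_restrict_space)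
        then show "{q \<in> space (restrict_space borel ?Z). q = p} \<in> sets (restrict_space borel ?Z)"
          unfolding sets_restrict_space by (metis borel_closed closed_singleton imageI)
      qed simp
      moreover have "(if q = p then ennreal \<bar>H p\<bar> else ennreal \<bar>normal_div \<rho> u (chart_map c q)\<bar>) = ennreal \<bar>H q\<bar>"
        if q: "q \<in> space (restrict_space borel ?Z)" for q
      proof -
        obtain y where y: "y \<in> ball y0 r" "q = \<psi> y" using space_Z[OF q] by blast
        show ?thesis using H_eq[OF y(1)] y(2) y0(2) by (cases "y = y0") auto
      qed
      ultimately show "(\<lambda>q. ennreal \<bar>H q\<bar>) \<in> borel_measurable (restrict_space borel ?Z)"
        by (rule iffD1[OF measurable_cong, rotated])
      fix y assume y: "y \<in> ball y0 r" "y \<noteq> y0"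
      have "\<bar>H (\<psi> y)\<bar> \<le> C / k / norm (y - y0)"
        unfolding H_eq[OF y] using near(5)[OF y(1) W_pos[OF y]] W_inv[OF y C(1)] by linarith
      then show "ennreal \<bar>H (\<psi> y)\<bar> \<le> ennreal (C / k / norm (y - y0))" by (rule ennreal_leI)
    qed (use k(1) C(1) in simp)
    then show "\<exists>U'. open U' \<and> p \<in> U' \<and> finite_integral_over \<sigma> (\<Sigma> \<inter> U') (\<lambda>q. ennreal \<bar>H q\<bar>)"
      using U'(1) pU' by blast
  qed
qed

end
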